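(* In the regression setup described in the context, assume that $(X_i,\varepsilon_i)_{i\ge1}$ is ergodic, that $\mathbb{E}\|U_1\|^2<\infty$, that $h_n\to0$, $nh_n\to\infty$ and $nh_n\,\lambda_{\max}(\operatorname{Cov}(\overline U_n))\to0$ with $\overline U_n=\frac1n\sum_{i=1}^nU_i$, that $c_2(K)=\int K^2(u)\,du<\infty$, that $\mu\in\mathcal{D}$, that $\mathbb{E}\|X_1\|^4<\infty$, that $0<\mathbb{E}[\varepsilon_1^2\mid X_1]<\infty$ almost surely, and that the support of $X_1$ has nonempty interior in $\mathbb{R}^p$. Let $\alpha\in(0,1)$. Components of vectors in $\mathbb{R}^{p+1}$ and diagonal entries of $(p+1)\times(p+1)$ matrices are indexed by $j=0,\dots,p$. (i) If $\sqrt{nh_n}\,\|A_n-I_q\|\to0$, then $$\Big\{b\in\mathbb{R}^{p+1}:\ nh_n\,(\widetilde\beta_n-b)^\top\widehat\Sigma_{\beta,n}^{-1}(\widetilde\beta_n-b)\le\chi^2_{p+1,1-\alpha}\Big\}$$ is an asymptotic $(1-\alpha)100\%$ confidence region for $\beta$, and for each $j=0,\dots,p$ the interval with endpoints $\widetilde\beta_{n,j}\pm z_{1-\alpha/2}\sqrt{(\widehat\Sigma_{\beta,n})_{jj}/(nh_n)}$ is an asymptotic $(1-\alpha)100\%$ confidence interval for $\beta_j$. (ii) Suppose that $f$ has a bounded and continuous second derivative at $0$ with $f''(0)\ne0$, that $d_2(K)=\int u^2K(u)\,du<\infty$, and that $h_n$ is of exact order $n^{-1/5}$ (i.e. $n^{1/5}h_n$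 is bounded away from $0$ and $\infty$). Put $$\kappa=\frac{f''(0)\,d_2(K)}{2f(0)},\quad \Lambda=\operatorname{diag}(\lambda_\Sigma^2I_{q_1},\lambda_\Gamma^2I_{p+1}),\quad \widetilde D_n=\kappa h_n^2\,\nabla g(\widetilde\mu_n)\Lambda\widetilde\mu_n,\quad \widetilde\Sigma_{\beta,n}=\nabla g(\widetilde\mu_n)\,\widehat\Sigma_{\mu,n}\,\nabla g(\widetilde\mu_n)^\top .$$ Then $$\Big\{b\in\mathbb{R}^{p+1}:\ nh_n\,(\widetilde\beta_n-\widetilde D_n-b)^\top\widetilde\Sigma_{\beta,n}^{-1}(\widetilde\beta_n-\widetilde D_n-b)\le\chi^2_{p+1,1-\alpha}\Big\}$$ is an asymptotic $(1-\alpha)100\%$ confidence region for $\beta$, and for each $j=0,\dots,p$ the interval with endpoints $\widetilde\beta_{n,j}-\widetilde D_{n,j}\pm z_{1-\alpha/2}\sqrt{(\widehat\Sigma_{\beta,n})_{jj}/(nh_n)}$ is an asymptotic $(1-\alpha)100\%$ confidence interval for $\beta_j$.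
   Context: Regression setup. Let $p\ge1$, $m=p+1$, $q_1=m(m+1)/2$, $q=q_1+m$. $(X_i,\varepsilon_i)_{i\ge1}$ is a stationary sequence with $X_i=(X_{i,1},\dots,X_{i,p})^\top\in\mathbb{R}^p$, $\varepsilon_i\in\mathbb{R}$, $\mathbb{E}[\varepsilon_1\mid X_1]=0$, $\mathbb{E}\|X_1\|^2<\infty$, and $Y_i=\beta_0+\beta_1X_{i,1}+\cdots+\beta_pX_{i,p}+\varepsilon_i$. Put $\widetilde X_i=(1,X_i^\top)^\top\in\mathbb{R}^{m}$, $\beta=(\beta_0,\dots,\beta_p)^\top$, $\Sigma=\mathbb{E}[\widetilde X_1\widetilde X_1^\top]$, $\Gamma=\mathbb{E}[\widetilde X_1Y_1]$, $\mu=(\operatorname{Vech}(\Sigma)^\top,\Gamma^\top)^\top\in\mathbb{R}^q$, where $\operatorname{Vech}$ stacks the lower-triangular entries of a symmetric matrix. For $\mathbf{x}\in\mathbb{R}^q$, let $\Sigma(\mathbf{x})$ (symmetric $m\times m$) and $\Gamma(\mathbf{x})\in\mathbb{R}^m$ be determined by $\mathbf{x}=(\operatorname{Vech}(\Sigma(\mathbf{x}))^\top,\Gamma(\mathbf{x})^\top)^\top$; let $\Delta(\mathbf{x})=\det\Sigma(\mathbf{x})$, $\mathcal{D}=\{\mathbf{x}\in\mathbb{R}^q:\Delta(\mathbf{x})>0\}$, and $g:\mathcal{D}\to\mathbb{R}^{p+1}$, $g(\mathbf{x})=\Sigma(\mathbf{x})^{-1}\Gamma(\mathbf{x})$; $\nabla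 g$ is its $(p+1)\times q$ Jacobian. If $\mu\in\mathcal{D}$ then $\beta=g(\mu)$. Let $U_i=(\operatorname{Vech}(\widetilde X_i\widetilde X_i^\top)^\top,(\widetilde X_iY_i)^\top)^\top\in\mathbb{R}^q$, so $\mathbb{E}[U_1]=\mu$. Smoothing. $(V_i)_{i\ge1}$ is i.i.d., real, independent of $(U_i)_{i\ge1}$, with bounded density $f$ continuous at $0$ and $f(0)>0$; $K$ is a symmetric bounded probability density on $\mathbb{R}$; $(h_n)$ are positive (deterministic) bandwidths. Define $$\widehat\mu_n=\frac{1}{n\,\mathbb{E}[K(V_1/h_n)]}\sum_{i=1}^nU_i\,K(V_i/h_n),\quad \widehat\Sigma_{\mu,n}=\frac{c_2(K)}{f(0)}\cdot\frac1n\sum_{i=1}^nU_iU_i^\top,\quad \widehat\Sigma_{\beta,n}=\nabla g(\widehat\mu_n)\,\widehat\Sigma_{\mu,n}\,\nabla g(\widehat\mu_n)^\top.$$ Scaled estimator. Fix $\lambda_\Sigma,\lambda_\Gamma>0$ with $\lambda_\Sigma\ne\lambda_\Gamma$. For $\lambda>0$ let $\hat f_{n,\lambda}(x)=\frac{1}{n\lambda h_n}\sum_{i=1}^nK\big(\frac{x-V_i}{\lambda h_n}\big)$, and let $a_{\Sigma,n}=\mathbb{E}[\hat f_{n,\lambda_\Sigma}(0)]/f(0)$, $a_{\Gamma,n}=\mathbb{E}[\hat f_{n,\lambda_\Gamma}(0)]/f(0)$, $A_n=\operatorname{diag}(a_{\Sigma,n}I_{q_1},a_{\Gamma,n}I_m)$,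 $\widetilde\mu_n=A_n\widehat\mu_n$, $\widetilde\beta_n=g(\widetilde\mu_n)$ whenever $\widetilde\mu_n\in\mathcal{D}$. Quantities are defined arbitrarily (measurably) on the events where the formulas make no sense; these events have probability tending to $0$. "Asymptotic $(1-\alpha)100\%$ confidence region/interval" means that the coverage probability tends to $1-\alpha$. $\chi^2_{p+1,1-\alpha}$ and $z_{1-\alpha/2}$ are quantiles of the $\chi^2_{p+1}$ and standard normal laws; $\lambda_{\max}$ is the largest eigenvalue. *)

theory Defs
  imports "HOL-Probability.Probability" "HOL-Library.Option_ord"
begin

section \<open>Vectors, matrices, and the half-vectorization\<close>

text \<open>
  The covariate space is \<open>real ^ 'p\<close>. The index type of the augmented covariate
  \<open>(1, x)\<close> and of the coefficient vector is \<open>'p option\<close>, which has \<open>p + 1\<close> elements: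
  \<open>None\<close> is the index 0 of the intercept and \<open>Some k\<close> is the index of the \<open>k\<close>-th covariate.
\<close>

definition design :: "real ^ 'p \<Rightarrow> real ^ 'p option" where
  "design x = (\<chi> j. case j of None \<Rightarrow> 1 | Some k \<Rightarrow> x $ k)"

definition outer :: "real ^ 'a \<Rightarrow> real ^ 'b \<Rightarrow> real ^ 'b ^ 'a" where
  "outer v w = (\<chi> i j. v $ i * w $ j)"

text \<open>The positions \<open>(row, column)\<close> in the lower triangle of a square matrix, diagonal included.\<close>

typedef (overloaded) ('m::linorder) lowtri = "{(i::'m, j). j \<le> i}"
  by auto

instance lowtri :: ("{finite, linorder}") finite
proof
  have *: "(UNIV :: 'a lowtri set) = Abs_lowtri ` {(i, j). j \<le> i}"
    by (rule type_definition.Abs_image[OF type_definition_lowtri, symmetric])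
  show "finite (UNIV :: 'a lowtri set)"
    unfolding * by (rule finite_imageI, rule finite)
qed

lemma card_lowtri: "2 * CARD('m::{finite, linorder} lowtri) = CARD('m) * (CARD('m) + 1)"
proof -
  let ?L = "{(i::'m, j). j \<le> i}" and ?U = "{(i::'m, j). i \<le> j}"
  have "?U = prod.swap ` ?L"
    by (auto simp: image_def)
  then have U: "card ?U = card ?L"
    by (simp add: card_image)
  have "card (?L \<union> ?U) + card (?L \<inter> ?U) = card ?L + card ?U"
    by (rule card_Un_Int[symmetric]) simp_all
  moreover have "?L \<union> ?U = UNIV"
    by auto
  moreover have "?L \<inter> ?U = (\<lambda>i. (i, i)) ` UNIV"
    by auto
  moreover have "card ((\<lambda>i::'m. (i, i)) ` UNIV) = CARD('m)"
    by (intro card_image) (auto simp: inj_on_def)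
  moreover have "CARD('m \<times> 'm) = CARD('m) * CARD('m)"
    by simp
  ultimately have "CARD('m) * CARD('m) + CARD('m) = 2 * card ?L"
    using U by simp
  then show ?thesis
    by (simp add: type_definition.card[OF type_definition_lowtri])
qed

definition vech :: "real ^ ('m::{finite, linorder}) ^ ('m::{finite, linorder}) \<Rightarrow> real ^ 'm lowtri" where
  "vech S = (\<chi> k. case Rep_lowtri k of (i, j) \<Rightarrow> S $ i $ j)"

definition stack :: "real ^ 'a \<Rightarrow> real ^ 'b \<Rightarrow> real ^ ('a + 'b)" where
  "stack v w = (\<chi> k. case k of Inl a \<Rightarrow> v $ a | Inr b \<Rightarrow> w $ b)"

definition Sigma_of :: "real ^ ('m::{finite, linorder} lowtri + 'm) \<Rightarrow> real ^ ('m::{finite, linorder}) ^ ('m::{finite, linorder})" where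
  "Sigma_of x = (\<chi> i j. x $ Inl (Abs_lowtri (max i j, min i j)))"

definition Gamma_of :: "real ^ ('m::{finite, linorder} lowtri + 'm) \<Rightarrow> real ^ ('m::{finite, linorder})" where
  "Gamma_of x = (\<chi> i. x $ Inr i)"

lemma stack_vech_iff:
  assumes "transpose S = S"
  shows "x = stack (vech S) v \<longleftrightarrow> S = Sigma_of x \<and> v = Gamma_of x"
proof
  assume x: "x = stack (vech S) v"
  have "S $ i $ j = S $ j $ i" for i j
    using assms by (metis transpose_def vec_lambda_beta)
  then show "S = Sigma_of x \<and> v = Gamma_of x"
    by (auto simp: x vec_eq_iff Sigma_of_def Gamma_of_def stack_def vech_def
        Abs_lowtri_inverse max_def min_def)
next
  assume R: "S = Sigma_of x \<and> v = Gamma_of x"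
  have "x $ Inl k = vech S $ k" for k
  proof -
    obtain i j where k: "Rep_lowtri k = (i, j)" "j \<le> i"
      using Rep_lowtri[of k] by auto
    then have "k = Abs_lowtri (i, j)"
      by (metis Rep_lowtri_inverse)
    then show ?thesis
      using R k by (simp add: vech_def Sigma_of_def max_def min_def)
  qed
  then show "x = stack (vech S) v"
    using R unfolding vec_eq_iff by (simp add: stack_def Gamma_of_def split: sum.splits)
qed

lemma transpose_Sigma_of: "transpose (Sigma_of x) = Sigma_of x"
  by (simp add: vec_eq_iff transpose_def Sigma_of_def max.commute min.commute)

definition pos_dom :: "(real ^ ('m::{finite, linorder} lowtri + 'm)) set" where
  "pos_dom = {x. 0 < det (Sigma_of x)}"

text \<open>
  Only the values of \<open>g_map\<close> on the open set \<open>pos_dom\<close> matter;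
  its Jacobian there is \<open>jacobian g_map (at x)\<close>.
\<close>

definition g_map :: "real ^ ('m::{finite, linorder} lowtri + 'm) \<Rightarrow> real ^ ('m::{finite, linorder})" where
  "g_map x = matrix_inv (Sigma_of x) *v Gamma_of x"

definition block_diag :: "real \<Rightarrow> real \<Rightarrow> real ^ ('a::finite + 'b::finite) ^ ('a + 'b)" where
  "block_diag s t = (\<chi> k l. if k = l then (case k of Inl _ \<Rightarrow> s | Inr _ \<Rightarrow> t) else 0)"

definition lambda_max :: "real ^ 'a ^ 'a \<Rightarrow> real" where
  "lambda_max S = Max {l. \<exists>v. v \<noteq> 0 \<and> S *v v = l *\<^sub>R v}"

definition sandwich :: "real ^ 'a ^ 'b \<Rightarrow> real ^ 'a ^ 'a \<Rightarrow> real ^ 'b ^ 'b" where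
  "sandwich J S = J ** S ** transpose J"


section \<open>Probability\<close>

definition stationary_process :: "'w measure \<Rightarrow> (nat \<Rightarrow> 'w \<Rightarrow> 'a::topological_space) \<Rightarrow> bool" where
  "stationary_process M Z \<longleftrightarrow> (\<forall>i. Z i \<in> borel_measurable M) \<and>
     (\<forall>k. distr M (\<Pi>\<^sub>M i\<in>UNIV. borel) (\<lambda>w i. Z (i + k) w) = distr M (\<Pi>\<^sub>M i\<in>UNIV. borel) (\<lambda>w i. Z i w))"

text \<open>Ergodicity of the left shift under the law of the process.\<close>

definition ergodic_process :: "'w measure \<Rightarrow> (nat \<Rightarrow> 'w \<Rightarrow> 'a::topological_space) \<Rightarrow> bool" where
  "ergodic_process M Z \<longleftrightarrow>
     (\<forall>A \<in> sets (\<Pi>\<^sub>M i\<in>UNIV. borel). {z. (\<lambda>i. z (Suc i)) \<in> A} = A \<longrightarrow>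
        measure M {w \<in> space M. (\<lambda>i. Z i w) \<in> A} \<in> {0, 1})"

definition cov_matrix :: "'w measure \<Rightarrow> ('w \<Rightarrow> real ^ 'a) \<Rightarrow> real ^ 'a ^ 'a" where
  "cov_matrix M W =
     (\<integral>w. outer (W w - (\<integral>w'. W w' \<partial>M)) (W w - (\<integral>w'. W w' \<partial>M)) \<partial>M)"

definition law_support :: "'w measure \<Rightarrow> ('w \<Rightarrow> 'a::topological_space) \<Rightarrow> 'a set" where
  "law_support M W = {x. \<forall>G. open G \<and> x \<in> G \<longrightarrow> 0 < measure M {w \<in> space M. W w \<in> G}}"

definition chi_square :: "nat \<Rightarrow> real measure" where
  "chi_square k = distr (\<Pi>\<^sub>M i\<in>{..<k}. std_normal_distribution) borel (\<lambda>z. \<Sum>i<k. (z i)\<^sup>2)"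

definition quantile :: "real measure \<Rightarrow> real \<Rightarrow> real" where
  "quantile N t = Inf {x. t \<le> cdf N x}"

text \<open>
  \<open>rv_where M P z Z\<close>: the random variable \<open>Z\<close> is given by the formula \<open>z\<close> on the outcomes
  satisfying \<open>P\<close>, where the formula makes sense, and is arbitrary but measurable elsewhere.
\<close>

definition rv_where ::
  "'w measure \<Rightarrow> ('w \<Rightarrow> bool) \<Rightarrow> ('w \<Rightarrow> 'a::topological_space) \<Rightarrow> ('w \<Rightarrow> 'a) \<Rightarrow> bool" where
  "rv_where M P z Z \<longleftrightarrow> Z \<in> borel_measurable M \<and> (\<forall>w \<in> space M. P w \<longrightarrow> Z w = z w)"

definition asymptotic_confidence_set ::
  "'w measure \<Rightarrow> real \<Rightarrow> (nat \<Rightarrow> 'w \<Rightarrow> 'a set) \<Rightarrow> 'a \<Rightarrow> bool" where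
  "asymptotic_confidence_set M \<alpha> C \<theta> \<longleftrightarrow>
     (\<lambda>n. measure M {w \<in> space M. \<theta> \<in> C n w}) \<longlonglongrightarrow> 1 - \<alpha>"

definition ellipsoid :: "real \<Rightarrow> real ^ 'a \<Rightarrow> real ^ 'a ^ 'a \<Rightarrow> real \<Rightarrow> (real ^ 'a) set" where
  "ellipsoid s c W r = {b. s * ((c - b) \<bullet> (W *v (c - b))) \<le> r}"


section \<open>Regression and smoothing\<close>

text \<open>Processes indexed by \<open>i = 1, 2, \<dots>\<close> are written with indices \<open>0, 1, \<dots>\<close>.\<close>

definition moment_obs :: "real ^ ('p::{finite, linorder}) \<Rightarrow> real
    \<Rightarrow> real ^ ('p option lowtri + 'p option)" where
  "moment_obs x y = stack (vech (outer (design x) (design x))) (y *\<^sub>R design x)"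

definition c2 :: "(real \<Rightarrow> real) \<Rightarrow> real" where
  "c2 K = (\<integral>u. (K u)\<^sup>2 \<partial>lborel)"

definition d2 :: "(real \<Rightarrow> real) \<Rightarrow> real" where
  "d2 K = (\<integral>u. u\<^sup>2 * K u \<partial>lborel)"

definition sample_mean :: "(nat \<Rightarrow> 'w \<Rightarrow> 'a::real_vector) \<Rightarrow> nat \<Rightarrow> 'w \<Rightarrow> 'a" where
  "sample_mean W n w = (1 / real n) *\<^sub>R (\<Sum>i<n. W i w)"

definition mu_hat :: "'w measure \<Rightarrow> (real \<Rightarrow> real) \<Rightarrow> (nat \<Rightarrow> real) \<Rightarrow> (nat \<Rightarrow> 'w \<Rightarrow> real)
    \<Rightarrow> (nat \<Rightarrow> 'w \<Rightarrow> real ^ 'q) \<Rightarrow> nat \<Rightarrow> 'w \<Rightarrow> real ^ 'q" where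
  "mu_hat M K h V U n w =
     (1 / (real n * (\<integral>w'. K (V 0 w' / h n) \<partial>M))) *\<^sub>R (\<Sum>i<n. K (V i w / h n) *\<^sub>R U i w)"

definition Sigma_mu_hat :: "(real \<Rightarrow> real) \<Rightarrow> (real \<Rightarrow> real)
    \<Rightarrow> (nat \<Rightarrow> 'w \<Rightarrow> real ^ 'q) \<Rightarrow> nat \<Rightarrow> 'w \<Rightarrow> real ^ 'q ^ 'q" where
  "Sigma_mu_hat K f U n w = (c2 K / f 0) *\<^sub>R sample_mean (\<lambda>i w. outer (U i w) (U i w)) n w"

definition f_hat :: "(real \<Rightarrow> real) \<Rightarrow> (nat \<Rightarrow> real) \<Rightarrow> (nat \<Rightarrow> 'w \<Rightarrow> real)
    \<Rightarrow> real \<Rightarrow> nat \<Rightarrow> real \<Rightarrow> 'w \<Rightarrow> real" where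
  "f_hat K h V l n x w = (1 / (real n * l * h n)) * (\<Sum>i<n. K ((x - V i w) / (l * h n)))"

definition a_scale :: "'w measure \<Rightarrow> (real \<Rightarrow> real) \<Rightarrow> (real \<Rightarrow> real) \<Rightarrow> (nat \<Rightarrow> real)
    \<Rightarrow> (nat \<Rightarrow> 'w \<Rightarrow> real) \<Rightarrow> real \<Rightarrow> nat \<Rightarrow> real" where
  "a_scale M K f h V l n = (\<integral>w. f_hat K h V l n 0 w \<partial>M) / f 0"

end

theory Submission
  imports Defs
begin

text \<open>
  Write \<open>\<rho> = n h\<close> and \<open>\<mu>\<close> for the mean of the observations \<open>U\<close>.
  The deviation \<open>sqrt \<rho> (mu_hat - \<mu>)\<close> splits into a sum \<open>\<Sum> \<xi>(V i) U i\<close> with centred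
  i.i.d. weights independent of \<open>U\<close>, and \<open>sqrt \<rho>\<close> times the error of the sample mean, which is
  negligible in mean square by the assumption on the largest eigenvalue. Conditionally on \<open>U\<close> the sum
  has independent terms, so its characteristic function is asymptotically that of a normal law with
  variance proportional to \<open>(1/n) \<Sum> (t \<bullet> U i)\<^sup>2\<close>, which converges by the ergodic theorem.

  The normal equations give the exact identity \<open>g y - g x = \<Sigma>(y)\<inverse> (\<Gamma>(y - x) - \<Sigma>(y - x) g x)\<close>,
  which yields at once the derivative of \<open>g\<close> and the delta method, and the limiting covariance of the
  estimator is positive definite because \<open>\<Gamma>(U) - \<Sigma>(U) \<beta>\<close> is the design vector times the error.

  Multivariate weak convergence is bypassed: for a standard Gaussian vector \<open>G\<close>,
  \<open>E exp(- j |W|\<^sup>2 / 2) = E exp(i sqrt j (G \<bullet> W))\<close>, so convergence of characteristic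
  functions gives convergence of all moments of \<open>exp(- |W|\<^sup>2 / 2)\<close>, hence (Weierstrass) convergence in law
  of \<open>|W|\<^sup>2\<close> to a chi-square law. Convergence in probability is expressed as convergence along a filter on
  pairs \<open>(n, w)\<close>, so that the continuity lemmas for \<open>tendsto\<close> apply to it directly.
\<close>

section \<open>The ergodic theorem\<close>

definition birkhoff_sum :: "('a \<Rightarrow> 'a) \<Rightarrow> ('a \<Rightarrow> real) \<Rightarrow> nat \<Rightarrow> 'a \<Rightarrow> real" where
  "birkhoff_sum T f n x = (\<Sum>i<n. f ((T ^^ i) x))"

lemma birkhoff_sum_Suc: "birkhoff_sum T f (Suc n) x = f x + birkhoff_sum T f n (T x)"
  unfolding birkhoff_sum_def by (simp only: sum.lessThan_Suc_shift funpow_Suc_right) simp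

lemma birkhoff_sum_0 [simp]: "birkhoff_sum T f 0 x = 0"
  by (simp add: birkhoff_sum_def)

primrec max_birkhoff :: "('a \<Rightarrow> 'a) \<Rightarrow> ('a \<Rightarrow> real) \<Rightarrow> nat \<Rightarrow> 'a \<Rightarrow> real" where
  "max_birkhoff T f 0 x = 0"
| "max_birkhoff T f (Suc n) x = max 0 (f x + max_birkhoff T f n (T x))"

lemma max_birkhoff_nonneg: "0 \<le> max_birkhoff T f n x"
  by (cases n) auto

lemma max_birkhoff_le_Suc: "max_birkhoff T f n x \<le> max_birkhoff T f (Suc n) x"
proof (induction n arbitrary: x)
  case (Suc n)
  show ?case using Suc[of "T x"] by (simp add: max_def)
qed simp

lemma max_birkhoff_mono: "m \<le> n \<Longrightarrow> max_birkhoff T f m x \<le> max_birkhoff T f n x"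
  by (rule lift_Suc_mono_le[of "\<lambda>n. max_birkhoff T f n x"]) (auto intro: max_birkhoff_le_Suc simp del: max_birkhoff.simps)

lemma birkhoff_sum_le_max: "birkhoff_sum T f n x \<le> max_birkhoff T f n x"
proof (induction n arbitrary: x)
  case (Suc n)
  show ?case using Suc[of "T x"] by (simp add: birkhoff_sum_Suc)
qed simp

lemma max_birkhoff_attained: "\<exists>k\<le>n. max_birkhoff T f n x = birkhoff_sum T f k x"
proof (induction n arbitrary: x)
  case (Suc n)
  obtain k where k: "k \<le> n" "max_birkhoff T f n (T x) = birkhoff_sum T f k (T x)"
    using Suc by blast
  show ?case
  proof (cases "0 \<le> f x + max_birkhoff T f n (T x)")
    case True
    then show ?thesis
      using k by (intro exI[of _ "Suc k"]) (simp add: birkhoff_sum_Suc)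
  next
    case False
    then show ?thesis by (intro exI[of _ 0]) simp
  qed
qed auto

lemma max_birkhoff_pos_iff:
  "(\<exists>n. 0 < max_birkhoff T f n x) \<longleftrightarrow> (\<exists>n. 0 < birkhoff_sum T f n x)"
  by (metis birkhoff_sum_le_max max_birkhoff_attained order_less_le_trans)

locale measure_preserving = prob_space P for P :: "'a measure" +
  fixes T :: "'a \<Rightarrow> 'a"
  assumes T_measurable [measurable]: "T \<in> measurable P P"
    and T_preserves: "distr P P T = P"
begin

lemma integrable_T: "integrable P (f :: 'a \<Rightarrow> real) \<Longrightarrow> integrable P (\<lambda>x. f (T x))"
  using integrable_distr[of T P P f] T_preserves by simp

lemma integral_T: "(f :: 'a \<Rightarrow> real) \<in> borel_measurable P \<Longrightarrow> (\<integral>x. f (T x) \<partial>P) = (\<integral>x. f x \<partial>P)"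
  using integral_distr[of T P P f] T_preserves by simp

lemma integrable_max_birkhoff:
  assumes "integrable P f"
  shows "integrable P (max_birkhoff T f n)"
proof (induction n)
  case (Suc n)
  have "integrable P (\<lambda>x. max 0 (f x + max_birkhoff T f n (T x)))"
    using assms integrable_T[OF Suc] by (intro integrable_max) auto
  then show ?case by (simp cong: integrable_cong)
next
  case 0
  have "max_birkhoff T f 0 = (\<lambda>_. 0)" by auto
  then show ?case by simp
qed

lemma measurable_birkhoff_sum [measurable]:
  assumes [measurable]: "f \<in> borel_measurable P"
  shows "birkhoff_sum T f n \<in> borel_measurable P"
proof -
  have [measurable]: "T ^^ i \<in> measurable P P" for i
    by (induction i) (auto intro: measurable_comp)
  show ?thesis unfolding birkhoff_sum_def by measurable
qed

text \<open>Garsia's proof: where \<open>max_birkhoff T f (Suc n)\<close> is positive it equals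
  \<open>f + max_birkhoff T f n \<circ> T\<close>, so the integral below dominates a coboundary.\<close>

lemma maximal_ergodic_finite:
  assumes f: "integrable P f"
  shows "0 \<le> (\<integral>x. indicator {x. 0 < max_birkhoff T f n x} x * f x \<partial>P)"
proof (cases n)
  case (Suc k)
  have [measurable]: "max_birkhoff T f i \<in> borel_measurable P" for i
    using integrable_max_birkhoff[OF f, of i] by simp
  have [measurable]: "f \<in> borel_measurable P"
    using f by simp
  have i: "integrable P (max_birkhoff T f n)" "integrable P (\<lambda>x. max_birkhoff T f n (T x))"
    using integrable_max_birkhoff[OF f] integrable_T by auto
  have "0 = (\<integral>x. max_birkhoff T f n x - max_birkhoff T f n (T x) \<partial>P)"
    using i integral_T[of "max_birkhoff T f n"] by simp
  also have "\<dots> \<le> (\<integral>x. indicator {x. 0 < max_birkhoff T f n x} x * f x \<partial>P)"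
  proof (rule integral_mono)
    show "integrable P (\<lambda>x. indicator {x. 0 < max_birkhoff T f n x} x * f x)"
      by (rule Bochner_Integration.integrable_bound[OF f]) (auto simp: indicator_def)
    fix x
    have "max_birkhoff T f k (T x) \<le> max_birkhoff T f n (T x)"
      using Suc max_birkhoff_le_Suc by metis
    then show "max_birkhoff T f n x - max_birkhoff T f n (T x)
        \<le> indicator {x. 0 < max_birkhoff T f n x} x * f x"
      using max_birkhoff_nonneg[of T f n x] max_birkhoff_nonneg[of T f n "T x"]
      by (auto simp: indicator_def Suc max_def split: if_splits)
  qed (use i in auto)
  finally show ?thesis .
qed (simp add: indicator_def)

lemma maximal_ergodic:
  assumes f: "integrable P f"
  shows "0 \<le> (\<integral>x. indicator {x. \<exists>n. 0 < birkhoff_sum T f n x} x * f x \<partial>P)"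
proof -
  have [measurable]: "max_birkhoff T f i \<in> borel_measurable P" for i
    using integrable_max_birkhoff[OF f, of i] by simp
  have [measurable]: "f \<in> borel_measurable P"
    using f by simp
  have "(\<lambda>n. \<integral>x. indicator {x. 0 < max_birkhoff T f n x} x * f x \<partial>P)
    \<longlonglongrightarrow> (\<integral>x. indicator {x. \<exists>n. 0 < birkhoff_sum T f n x} x * f x \<partial>P)"
  proof (rule integral_dominated_convergence)
    show "integrable P (\<lambda>x. \<bar>f x\<bar>)" using f by simp
    show "AE x in P. (\<lambda>n. indicator {x. 0 < max_birkhoff T f n x} x * f x)
      \<longlonglongrightarrow> indicator {x. \<exists>n. 0 < birkhoff_sum T f n x} x * f x"
    proof (rule AE_I2)
      fix x
      have "eventually (\<lambda>n. indicator {x. 0 < max_birkhoff T f n x} x * f x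
          = indicator {x. \<exists>n. 0 < birkhoff_sum T f n x} x * f x) sequentially"
      proof (cases "\<exists>n. 0 < max_birkhoff T f n x")
        case True
        then obtain m where m: "0 < max_birkhoff T f m x" by blast
        have "0 < max_birkhoff T f n x" if "m \<le> n" for n
          using m max_birkhoff_mono[OF that, of T f x] by linarith
        then show ?thesis
          using True max_birkhoff_pos_iff[of T f x]
          by (auto simp: eventually_sequentially indicator_def intro!: exI[of _ m])
      next
        case False
        then show ?thesis using max_birkhoff_pos_iff[of T f x] by (auto simp: indicator_def)
      qed
      then show "(\<lambda>n. indicator {x. 0 < max_birkhoff T f n x} x * f x)
        \<longlonglongrightarrow> indicator {x. \<exists>n. 0 < birkhoff_sum T f n x} x * f x"
        by (rule tendsto_eventually)
    qed
  qed (auto simp: indicator_def)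
  then show ?thesis
    by (rule LIMSEQ_le_const) (use maximal_ergodic_finite[OF f] in auto)
qed

end

locale ergodic_transformation = measure_preserving +
  assumes ergodic: "A \<in> sets P \<Longrightarrow> T -` A \<inter> space P = A \<Longrightarrow> measure P A \<in> {0, 1}"
begin

lemma AE_birkhoff_upper:
  assumes f: "integrable P f" and c: "(\<integral>x. f x \<partial>P) < c"
  shows "AE x in P. \<not> (\<exists>a>c. \<exists>\<^sub>F n in sequentially. a * real n < birkhoff_sum T f n x)"
proof -
  define B where "B = {x \<in> space P. \<exists>a>c. \<exists>\<^sub>F n in sequentially. a * real n < birkhoff_sum T f n x}"
  have [measurable]: "f \<in> borel_measurable P"
    using f by simp
  have "B = {x \<in> space P. \<exists>k::nat. \<forall>N. \<exists>n\<ge>N. (c + inverse (real (Suc k))) * real n < birkhoff_sum T f n x}"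
  proof (intro equalityI subsetI)
    fix x assume "x \<in> B"
    then obtain a where a: "x \<in> space P" "c < a" "\<exists>\<^sub>F n in sequentially. a * real n < birkhoff_sum T f n x"
      by (auto simp: B_def)
    obtain k where "inverse (real (Suc k)) < a - c"
      using reals_Archimedean[of "a - c"] a by auto
    then have k: "c + inverse (real (Suc k)) \<le> a"
      by linarith
    have "\<exists>n\<ge>N. (c + inverse (real (Suc k))) * real n < birkhoff_sum T f n x" for N
    proof -
      obtain n where "n \<ge> N" "a * real n < birkhoff_sum T f n x"
        using a(3) by (auto simp: frequently_sequentially)
      then show ?thesis
        using mult_right_mono[OF k, of "real n"] by (intro exI[of _ n]) auto
    qed
    then show "x \<in> {x \<in> space P. \<exists>k::nat. \<forall>N. \<exists>n\<ge>N. (c + inverse (real (Suc k))) * real n < birkhoff_sum T f n x}"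
      using a by auto
  next
    fix x assume "x \<in> {x \<in> space P. \<exists>k::nat. \<forall>N. \<exists>n\<ge>N. (c + inverse (real (Suc k))) * real n < birkhoff_sum T f n x}"
    then obtain k :: nat where "x \<in> space P"
      "\<forall>N. \<exists>n\<ge>N. (c + inverse (real (Suc k))) * real n < birkhoff_sum T f n x"
      by auto
    then show "x \<in> B"
      unfolding B_def frequently_sequentially by (intro CollectI conjI exI[of _ "c + inverse (real (Suc k))"]) auto
  qed
  then have B[measurable]: "B \<in> sets P"
    by simp
  have shift: "(\<exists>a>c. \<exists>\<^sub>F n in sequentially. a * real n < birkhoff_sum T f n (T x)) \<longleftrightarrow>
      (\<exists>a>c. \<exists>\<^sub>F n in sequentially. a * real n < birkhoff_sum T f n x)" for x
  proof
    assume "\<exists>a>c. \<exists>\<^sub>F n in sequentially. a * real n < birkhoff_sum T f n (T x)"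
    then obtain a where a: "a > c" "\<exists>\<^sub>F n in sequentially. a * real n < birkhoff_sum T f n (T x)"
      by blast
    define b where "b = (a + c) / 2"
    have "filterlim (\<lambda>n. (a - b) * real n) at_top sequentially"
      using a by (intro filterlim_tendsto_pos_mult_at_top[OF tendsto_const] filterlim_real_sequentially)
        (auto simp: b_def field_simps)
    then have "\<forall>\<^sub>F n in sequentially. b - f x \<le> (a - b) * real n"
      by (auto simp: filterlim_at_top)
    with a(2) have "\<exists>\<^sub>F n in sequentially. b * real (Suc n) < birkhoff_sum T f (Suc n) x"
      by (rule frequently_elim1[OF frequently_eventually_frequently]) (auto simp: birkhoff_sum_Suc algebra_simps)
    then have "\<exists>\<^sub>F n in sequentially. b * real n < birkhoff_sum T f n x"
      unfolding frequently_sequentially by (meson Suc_le_D le_Suc_eq Suc_leD le_SucI)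
    then show "\<exists>a>c. \<exists>\<^sub>F n in sequentially. a * real n < birkhoff_sum T f n x"
      using a by (intro exI[of _ b]) (auto simp: b_def)
  next
    assume "\<exists>a>c. \<exists>\<^sub>F n in sequentially. a * real n < birkhoff_sum T f n x"
    then obtain a where a: "a > c" "\<exists>\<^sub>F n in sequentially. a * real n < birkhoff_sum T f n x"
      by blast
    define b where "b = (a + c) / 2"
    have "filterlim (\<lambda>n. (a - b) * real n) at_top sequentially"
      using a by (intro filterlim_tendsto_pos_mult_at_top[OF tendsto_const] filterlim_real_sequentially)
        (auto simp: b_def field_simps)
    then have ev: "\<forall>\<^sub>F n in sequentially. f x - a \<le> (a - b) * real n"
      by (auto simp: filterlim_at_top)
    have "\<exists>\<^sub>F n in sequentially. a * real (Suc n) < birkhoff_sum T f (Suc n) x"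
      unfolding frequently_sequentially
    proof
      fix N
      obtain n where "n \<ge> Suc N" "a * real n < birkhoff_sum T f n x"
        using a(2) unfolding frequently_sequentially by blast
      then show "\<exists>n\<ge>N. a * real (Suc n) < birkhoff_sum T f (Suc n) x"
        by (cases n) auto
    qed
    from this ev have "\<exists>\<^sub>F n in sequentially. b * real n < birkhoff_sum T f n (T x)"
      by (rule frequently_elim1[OF frequently_eventually_frequently]) (auto simp: birkhoff_sum_Suc algebra_simps)
    then show "\<exists>a>c. \<exists>\<^sub>F n in sequentially. a * real n < birkhoff_sum T f n (T x)"
      using a by (intro exI[of _ b]) (auto simp: b_def)
  qed
  have TB: "T x \<in> B \<longleftrightarrow> x \<in> B" if "x \<in> space P" for x
    using that shift[of x] measurable_space[OF T_measurable that] by (auto simp: B_def)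
  define F where "F x = indicator B x * (f x - c)" for x
  have F: "integrable P F"
    unfolding F_def by (rule Bochner_Integration.integrable_bound[of _ "\<lambda>x. \<bar>f x\<bar> + \<bar>c\<bar>"])
      (use f in \<open>auto simp: indicator_def intro!: AE_I2\<close>)
  have SF: "birkhoff_sum T F n x = indicator B x * (birkhoff_sum T f n x - c * real n)" if "x \<in> space P" for n x
    using that
  proof (induction n arbitrary: x)
    case (Suc n)
    show ?case
      using Suc.IH[of "T x"] Suc.prems measurable_space[OF T_measurable] TB[OF Suc.prems]
      by (auto simp: birkhoff_sum_Suc F_def indicator_def algebra_simps)
  qed simp
  have "(\<exists>n. 0 < birkhoff_sum T F n x) \<longleftrightarrow> x \<in> B" if x: "x \<in> space P" for x
  proof
    assume "x \<in> B"
    then obtain a where a: "a > c" "\<exists>\<^sub>F n in sequentially. a * real n < birkhoff_sum T f n x"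
      by (auto simp: B_def)
    then obtain n where n: "n \<ge> 1" "a * real n < birkhoff_sum T f n x"
      by (auto simp: frequently_sequentially)
    have "c * real n \<le> a * real n"
      using a by (intro mult_right_mono) auto
    then have "0 < birkhoff_sum T f n x - c * real n"
      using n by linarith
    then show "\<exists>n. 0 < birkhoff_sum T F n x"
      using \<open>x \<in> B\<close> SF[OF x, of n] by (intro exI[of _ n]) simp
  qed (use SF[OF x] in \<open>auto simp: indicator_def of_bool_def split: if_splits\<close>)
  then have "(\<integral>x. indicator {x. \<exists>n. 0 < birkhoff_sum T F n x} x * F x \<partial>P) = (\<integral>x. F x \<partial>P)"
    by (intro Bochner_Integration.integral_cong) (auto simp: F_def indicator_def)
  then have nonneg: "0 \<le> (\<integral>x. F x \<partial>P)"
    using maximal_ergodic[OF F] by simp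
  have "T -` B \<inter> space P = B"
    using TB B sets.sets_into_space by blast
  then have "prob B = 0 \<or> prob B = 1"
    using ergodic[OF B] by auto
  moreover have "prob B \<noteq> 1"
  proof
    assume "prob B = 1"
    then have "AE x in P. x \<in> B"
      by (simp add: prob_eq_1 Collect_mem_eq Int_absorb2)
    then have "(\<integral>x. F x \<partial>P) = (\<integral>x. f x - c \<partial>P)"
      by (intro integral_cong_AE) (auto simp: F_def)
    also have "\<dots> < 0"
      using f c by (simp add: prob_space)
    finally show False using nonneg by simp
  qed
  ultimately have "AE x in P. x \<notin> B"
    using B by (simp add: AE_iff_measurable[OF B] prob_eq_0)
  then show ?thesis
    by (rule AE_mp) (auto simp: B_def intro!: AE_I2)
qed

theorem birkhoff:
  assumes f: "integrable P f"
  shows "AE x in P. (\<lambda>n. birkhoff_sum T f n x / real n) \<longlonglongrightarrow> (\<integral>x. f x \<partial>P)"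
proof -
  have upper: "AE x in P. \<forall>k::nat. \<forall>\<^sub>F n in sequentially.
      birkhoff_sum T f n x \<le> ((\<integral>x. f x \<partial>P) + 2 * inverse (real (Suc k))) * real n"
    if f: "integrable P f" for f
    unfolding AE_all_countable
  proof
    fix k :: nat
    have p: "0 < inverse (real (Suc k))" by simp
    show "AE x in P. \<forall>\<^sub>F n in sequentially.
        birkhoff_sum T f n x \<le> ((\<integral>x. f x \<partial>P) + 2 * inverse (real (Suc k))) * real n"
      using AE_birkhoff_upper[OF f, of "(\<integral>x. f x \<partial>P) + inverse (real (Suc k))", OF less_add_same_cancel1[THEN iffD2, OF p]]
    proof eventually_elim
      case (elim x)
      have "(\<integral>x. f x \<partial>P) + inverse (real (Suc k)) < (\<integral>x. f x \<partial>P) + 2 * inverse (real (Suc k))"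
        using p by linarith
      then have "\<not> (\<exists>\<^sub>F n in sequentially. ((\<integral>x. f x \<partial>P) + 2 * inverse (real (Suc k))) * real n < birkhoff_sum T f n x)"
        using elim by blast
      then show ?case
        by (simp only: not_frequently not_less)
    qed
  qed
  have neg: "birkhoff_sum T (\<lambda>x. - f x) n x = - birkhoff_sum T f n x" for n x
    by (simp add: birkhoff_sum_def sum_negf)
  have lower: "AE x in P. \<forall>k::nat. \<forall>\<^sub>F n in sequentially.
      - birkhoff_sum T f n x \<le> (- (\<integral>x. f x \<partial>P) + 2 * inverse (real (Suc k))) * real n"
    using upper[of "\<lambda>x. - f x"] f by (simp add: neg)
  show ?thesis
    using upper[OF f] lower
  proof eventually_elim
    case (elim x)
    show ?case
    proof (rule LIMSEQ_I)
      fix r :: real assume "0 < r"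
      then obtain k where k: "inverse (real (Suc k)) < r / 2"
        using reals_Archimedean[of "r / 2"] by auto
      have "\<forall>\<^sub>F n in sequentially. norm (birkhoff_sum T f n x / real n - (\<integral>x. f x \<partial>P)) < r"
        using elim(1)[rule_format, of k] elim(2)[rule_format, of k] eventually_gt_at_top[of 0]
      proof eventually_elim
        case (elim n)
        have "birkhoff_sum T f n x / real n \<le> (\<integral>x. f x \<partial>P) + 2 * inverse (real (Suc k))"
          using elim by (simp add: divide_le_eq)
        moreover have "(\<integral>x. f x \<partial>P) - 2 * inverse (real (Suc k)) \<le> birkhoff_sum T f n x / real n"
          using elim by (simp add: le_divide_eq algebra_simps)
        ultimately show ?case using k by (simp only: real_norm_def abs_less_iff) linarith
      qed
      then show "\<exists>N. \<forall>n\<ge>N. norm (birkhoff_sum T f n x / real n - (\<integral>x. f x \<partial>P)) < r"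
        by (simp add: eventually_sequentially)
    qed
  qed
qed

end

section \<open>Convergence in probability as convergence along a filter\<close>

definition prob_filter :: "'w measure \<Rightarrow> (nat \<times> 'w) filter" where
  "prob_filter M = Abs_filter (\<lambda>P. \<forall>\<delta>>0. \<forall>\<^sub>F n in sequentially.
     \<exists>A\<in>sets M. 1 - \<delta> \<le> measure M A \<and> (\<forall>w\<in>A. P (n, w)))"

definition tight_seq :: "'w measure \<Rightarrow> (nat \<Rightarrow> 'w \<Rightarrow> 'b::real_normed_vector) \<Rightarrow> bool" where
  "tight_seq M W \<longleftrightarrow> (\<forall>\<delta>>0. \<exists>B. \<forall>\<^sub>F n in sequentially.
     \<exists>A\<in>sets M. 1 - \<delta> \<le> measure M A \<and> (\<forall>w\<in>A. norm (W n w) \<le> B))"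

context prob_space
begin

lemma prob_Int_ge:
  assumes "A \<in> sets M" "B \<in> sets M" "1 - a \<le> prob A" "1 - b \<le> prob B"
  shows "1 - (a + b) \<le> prob (A \<inter> B)"
proof -
  have "prob (space M - A \<inter> B) \<le> prob ((space M - A) \<union> (space M - B))"
    using assms by (intro finite_measure_mono) auto
  also have "\<dots> \<le> prob (space M - A) + prob (space M - B)"
    using assms by (intro measure_Un_le) auto
  finally show ?thesis
    using assms by (simp add: prob_compl)
qed

lemma eventually_prob_filter:
  "eventually P (prob_filter M) \<longleftrightarrow> (\<forall>\<delta>>0. \<forall>\<^sub>F n in sequentially.
     \<exists>A\<in>sets M. 1 - \<delta> \<le> prob A \<and> (\<forall>w\<in>A. P (n, w)))"
  unfolding prob_filter_def
proof (rule eventually_Abs_filter, rule is_filter.intro)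
  show "\<forall>\<delta>>0. \<forall>\<^sub>F n in sequentially. \<exists>A\<in>sets M. 1 - \<delta> \<le> prob A \<and> (\<forall>w\<in>A. True)"
    by (auto intro!: always_eventually bexI[of _ "space M"] simp: prob_space)
next
  fix P Q :: "nat \<times> 'a \<Rightarrow> bool"
  assume P: "\<forall>\<delta>>0. \<forall>\<^sub>F n in sequentially. \<exists>A\<in>sets M. 1 - \<delta> \<le> prob A \<and> (\<forall>w\<in>A. P (n, w))"
    and Q: "\<forall>\<delta>>0. \<forall>\<^sub>F n in sequentially. \<exists>A\<in>sets M. 1 - \<delta> \<le> prob A \<and> (\<forall>w\<in>A. Q (n, w))"
  show "\<forall>\<delta>>0. \<forall>\<^sub>F n in sequentially. \<exists>A\<in>sets M. 1 - \<delta> \<le> prob A \<and> (\<forall>w\<in>A. P (n, w) \<and> Q (n, w))"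
  proof (intro allI impI)
    fix \<delta> :: real assume "\<delta> > 0"
    then have "\<delta> / 2 > 0" by simp
    show "\<forall>\<^sub>F n in sequentially. \<exists>A\<in>sets M. 1 - \<delta> \<le> prob A \<and> (\<forall>w\<in>A. P (n, w) \<and> Q (n, w))"
      using P[rule_format, OF \<open>\<delta> / 2 > 0\<close>] Q[rule_format, OF \<open>\<delta> / 2 > 0\<close>]
    proof eventually_elim
      case (elim n)
      then obtain A B where "A \<in> sets M" "1 - \<delta> / 2 \<le> prob A" "\<forall>w\<in>A. P (n, w)"
        "B \<in> sets M" "1 - \<delta> / 2 \<le> prob B" "\<forall>w\<in>B. Q (n, w)"
        by auto
      then show ?case
        using prob_Int_ge[of A B "\<delta> / 2" "\<delta> / 2"] by (intro bexI[of _ "A \<inter> B"]) auto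
    qed
  qed
next
  fix P Q :: "nat \<times> 'a \<Rightarrow> bool"
  assume "\<forall>x. P x \<longrightarrow> Q x"
    and P: "\<forall>\<delta>>0. \<forall>\<^sub>F n in sequentially. \<exists>A\<in>sets M. 1 - \<delta> \<le> prob A \<and> (\<forall>w\<in>A. P (n, w))"
  then show "\<forall>\<delta>>0. \<forall>\<^sub>F n in sequentially. \<exists>A\<in>sets M. 1 - \<delta> \<le> prob A \<and> (\<forall>w\<in>A. Q (n, w))"
    by (blast intro: eventually_mono)
qed

lemma filterlim_fst_prob_filter: "filterlim fst sequentially (prob_filter M)"
  unfolding filterlim_iff eventually_prob_filter
  by (auto elim!: eventually_mono intro!: bexI[of _ "space M"] simp: prob_space)

lemma tendsto_prob_filter_deterministic:
  "(a \<longlongrightarrow> l) sequentially \<Longrightarrow> ((\<lambda>(n, w). a n) \<longlongrightarrow> l) (prob_filter M)"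
  using filterlim_compose[OF _ filterlim_fst_prob_filter, of a] by (simp add: case_prod_unfold)

lemma eventually_prob_filter_space: "\<forall>\<^sub>F (n, w) in prob_filter M. w \<in> space M"
  unfolding eventually_prob_filter
  by (auto intro!: always_eventually bexI[of _ "space M"] simp: prob_space)

lemma eventually_prob_filter_deterministic:
  "eventually P sequentially \<Longrightarrow> \<forall>\<^sub>F (n, w) in prob_filter M. P n"
  using filterlim_fst_prob_filter unfolding filterlim_iff by (simp add: case_prod_unfold)

lemma AE_tendsto_imp_prob_filter:
  fixes X :: "nat \<Rightarrow> 'a \<Rightarrow> 'b::{metric_space, second_countable_topology}"
  assumes [measurable]: "\<And>n. X n \<in> borel_measurable M"
    and lim: "AE w in M. (\<lambda>n. X n w) \<longlonglongrightarrow> l"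
  shows "((\<lambda>(n, w). X n w) \<longlongrightarrow> l) (prob_filter M)"
  unfolding tendsto_iff eventually_prob_filter
proof (intro allI impI)
  fix e \<delta> :: real assume e: "e > 0" and \<delta>: "\<delta> > 0"
  have "(\<lambda>n. \<integral>w. indicator {w. dist (X n w) l < e} w \<partial>M) \<longlonglongrightarrow> (\<integral>w. (1::real) \<partial>M)"
  proof (rule integral_dominated_convergence)
    show "AE w in M. (\<lambda>n. indicator {w. dist (X n w) l < e} w) \<longlonglongrightarrow> (1::real)"
      using lim
    proof eventually_elim
      case (elim w)
      then have "\<forall>\<^sub>F n in sequentially. dist (X n w) l < e"
        using e by (simp add: tendsto_iff)
      then show ?case
        by (intro tendsto_eventually) (auto elim!: eventually_mono)
    qed
  qed (auto simp: indicator_def)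
  moreover have "(\<integral>w. indicator {w. dist (X n w) l < e} w \<partial>M) = prob {w \<in> space M. dist (X n w) l < e}" for n
    by (subst Bochner_Integration.integral_indicator) (auto intro!: arg_cong[of _ _ prob] simp: Collect_conj_eq Int_commute)
  ultimately have "(\<lambda>n. prob {w \<in> space M. dist (X n w) l < e}) \<longlonglongrightarrow> 1"
    by (simp add: prob_space)
  then have "\<forall>\<^sub>F n in sequentially. 1 - \<delta> < prob {w \<in> space M. dist (X n w) l < e}"
    using \<delta> by (intro order_tendstoD) auto
  then show "\<forall>\<^sub>F n in sequentially. \<exists>A\<in>sets M. 1 - \<delta> \<le> prob A \<and>
      (\<forall>w\<in>A. dist (case (n, w) of (n, w) \<Rightarrow> X n w) l < e)"
    by eventually_elim (force intro!: bexI[of _ "{w \<in> space M. dist (X _ w) l < e}"])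
qed

lemma prob_norm_le_ge:
  fixes X :: "'a \<Rightarrow> 'b::{real_normed_vector, second_countable_topology}"
  assumes [measurable]: "X \<in> borel_measurable M"
    and i: "integrable M (\<lambda>w. (norm (X w))\<^sup>2)" and e: "e > 0"
  shows "1 - (\<integral>w. (norm (X w))\<^sup>2 \<partial>M) / e\<^sup>2 \<le> prob {w \<in> space M. norm (X w) < e}"
proof -
  have eq: "e \<le> norm (X w) \<longleftrightarrow> e\<^sup>2 \<le> (norm (X w))\<^sup>2" for w
    using e abs_le_square_iff[of e "norm (X w)"] by simp
  have "prob {w \<in> space M. e\<^sup>2 \<le> (norm (X w))\<^sup>2} \<le> (\<integral>w. (norm (X w))\<^sup>2 \<partial>M) / e\<^sup>2"
    using e by (intro integral_Markov_inequality_measure[OF i, where A="{}" and c="e\<^sup>2", simplified]) auto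
  moreover have "{w \<in> space M. norm (X w) < e} = space M - {w \<in> space M. e\<^sup>2 \<le> (norm (X w))\<^sup>2}"
    by (auto simp flip: eq)
  ultimately show ?thesis
    by (simp add: prob_compl)
qed

lemma tight_seq_L2_bounded:
  fixes X :: "nat \<Rightarrow> 'a \<Rightarrow> 'b::{real_normed_vector, second_countable_topology}"
  assumes [measurable]: "\<And>n. X n \<in> borel_measurable M"
    and le: "\<forall>\<^sub>F n in sequentially. integrable M (\<lambda>w. (norm (X n w))\<^sup>2) \<and> (\<integral>w. (norm (X n w))\<^sup>2 \<partial>M) \<le> C"
  shows "tight_seq M X"
  unfolding tight_seq_def
proof (intro allI impI)
  fix \<delta> :: real assume \<delta>: "\<delta> > 0"
  define B where "B = sqrt ((\<bar>C\<bar> + 1) / \<delta>)"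
  have B: "B > 0" "B\<^sup>2 = (\<bar>C\<bar> + 1) / \<delta>"
    using \<delta> by (auto simp: B_def intro!: divide_pos_pos)
  from le have "\<forall>\<^sub>F n in sequentially. \<exists>A\<in>sets M. 1 - \<delta> \<le> prob A \<and> (\<forall>w\<in>A. norm (X n w) \<le> B)"
  proof eventually_elim
    case (elim n)
    then have i: "integrable M (\<lambda>w. (norm (X n w))\<^sup>2)" and "(\<integral>w. (norm (X n w))\<^sup>2 \<partial>M) \<le> \<bar>C\<bar> + 1"
      by auto
    then have "(\<integral>w. (norm (X n w))\<^sup>2 \<partial>M) / B\<^sup>2 \<le> \<delta>"
      unfolding B(2) using \<delta> by (simp add: divide_le_eq)
    then show ?case
      using prob_norm_le_ge[OF _ i \<open>B > 0\<close>] by (intro bexI[of _ "{w \<in> space M. norm (X n w) < B}"]) auto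
  qed
  then show "\<exists>B. \<forall>\<^sub>F n in sequentially. \<exists>A\<in>sets M. 1 - \<delta> \<le> prob A \<and> (\<forall>w\<in>A. norm (X n w) \<le> B)" ..
qed

lemma slutsky:
  fixes W :: "nat \<Rightarrow> 'a \<Rightarrow> 'b::euclidean_space"
    and \<eta> :: "nat \<times> 'a \<Rightarrow> 'c::euclidean_space"
    and F :: "'b \<Rightarrow> 'c \<Rightarrow> 'd::real_normed_vector"
  assumes F: "continuous_on UNIV (\<lambda>(x, y). F x y)"
    and W: "tight_seq M W"
    and \<eta>: "(\<eta> \<longlongrightarrow> y) (prob_filter M)"
  shows "((\<lambda>(n, w). F (W n w) (\<eta> (n, w)) - F (W n w) y) \<longlongrightarrow> 0) (prob_filter M)"
  unfolding tendsto_iff eventually_prob_filter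
proof (intro allI impI)
  fix e \<delta> :: real assume e: "e > 0" and \<delta>: "\<delta> > 0"
  then have \<delta>2: "\<delta> / 2 > 0" by simp
  from W \<delta>2 obtain B where B: "\<forall>\<^sub>F n in sequentially. \<exists>A\<in>sets M. 1 - \<delta> / 2 \<le> prob A \<and> (\<forall>w\<in>A. norm (W n w) \<le> B)"
    unfolding tight_seq_def by blast
  have "uniformly_continuous_on (cball 0 B \<times> cball y 1) (\<lambda>(x, y). F x y)"
    by (intro compact_uniformly_continuous continuous_on_subset[OF F] compact_Times compact_cball) auto
  then obtain d where d: "d > 0" "\<And>p q. p \<in> cball 0 B \<times> cball y 1 \<Longrightarrow> q \<in> cball 0 B \<times> cball y 1 \<Longrightarrow>
      dist q p < d \<Longrightarrow> dist ((\<lambda>(x, y). F x y) q) ((\<lambda>(x, y). F x y) p) < e"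
    unfolding uniformly_continuous_on_def using e by metis
  have "\<forall>\<^sub>F p in prob_filter M. dist (\<eta> p) y < min d 1"
    using \<eta>[unfolded tendsto_iff, rule_format, of "min d 1"] d(1) by simp
  then have "\<forall>\<^sub>F n in sequentially. \<exists>A\<in>sets M. 1 - \<delta> / 2 \<le> prob A \<and> (\<forall>w\<in>A. dist (\<eta> (n, w)) y < min d 1)"
    using \<delta>2 unfolding eventually_prob_filter by blast
  with B show "\<forall>\<^sub>F n in sequentially. \<exists>A\<in>sets M. 1 - \<delta> \<le> prob A \<and>
      (\<forall>w\<in>A. dist (case (n, w) of (n, w) \<Rightarrow> F (W n w) (\<eta> (n, w)) - F (W n w) y) 0 < e)"
  proof eventually_elim
    case (elim n)
    then obtain A A' where A: "A \<in> sets M" "1 - \<delta> / 2 \<le> prob A" "\<forall>w\<in>A. norm (W n w) \<le> B"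
      and A': "A' \<in> sets M" "1 - \<delta> / 2 \<le> prob A'" "\<forall>w\<in>A'. dist (\<eta> (n, w)) y < min d 1"
      by auto
    have "dist (F (W n w) (\<eta> (n, w)) - F (W n w) y) 0 < e" if "w \<in> A \<inter> A'" for w
      using d(2)[of "(W n w, y)" "(W n w, \<eta> (n, w))"] A(3) A'(3) that
      by (auto simp: dist_Pair_Pair dist_norm norm_minus_commute)
    then show ?case
      using prob_Int_ge[OF A(1) A'(1) A(2) A'(2)] A A' by (intro bexI[of _ "A \<inter> A'"]) auto
  qed
qed

lemma prob_tendsto_of_close:
  assumes lim: "\<And>c. (\<lambda>n. prob {w \<in> space M. Z n w \<le> c}) \<longlonglongrightarrow> F c"
    and F: "isCont F c"
    and [measurable]: "\<And>n. Z n \<in> borel_measurable M" and E: "\<And>n. E n \<in> sets M"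
    and ev: "\<forall>\<^sub>F (n, w) in prob_filter M. w \<in> E n \<longleftrightarrow> Q n w \<le> (c :: real)"
    and close: "((\<lambda>(n, w). Q n w - Z n w) \<longlongrightarrow> 0) (prob_filter M)"
  shows "(\<lambda>n. prob (E n)) \<longlonglongrightarrow> F c"
proof (rule LIMSEQ_I)
  fix r :: real assume r: "0 < r"
  obtain d where d: "d > 0" "\<And>x. \<bar>x - c\<bar> < d \<Longrightarrow> \<bar>F x - F c\<bar> < r / 3"
    using F[unfolded continuous_at_eps_delta, rule_format, of "r / 3"] r by (auto simp: dist_real_def)
  define e where "e = d / 2"
  have e: "e > 0" "\<bar>F (c + e) - F c\<bar> < r / 3" "\<bar>F (c - e) - F c\<bar> < r / 3"
    using d by (auto simp: e_def)
  have "\<forall>\<^sub>F (n, w) in prob_filter M. w \<in> space M \<and> (w \<in> E n \<longleftrightarrow> Q n w \<le> c) \<and> \<bar>Q n w - Z n w\<bar> < e"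
    using ev eventually_prob_filter_space close[unfolded tendsto_iff, rule_format, OF e(1)]
    by eventually_elim (auto simp: dist_real_def)
  then have "\<forall>\<^sub>F n in sequentially. \<exists>A\<in>sets M. 1 - r / 3 \<le> prob A \<and>
      (\<forall>w\<in>A. w \<in> space M \<and> (w \<in> E n \<longleftrightarrow> Q n w \<le> c) \<and> \<bar>Q n w - Z n w\<bar> < e)"
    using r unfolding eventually_prob_filter by auto
  moreover have "\<forall>\<^sub>F n in sequentially. \<bar>prob {w \<in> space M. Z n w \<le> c + e} - F (c + e)\<bar> < r / 3"
    using lim[of "c + e", unfolded tendsto_iff, rule_format, of "r / 3"] r by (simp add: dist_real_def)
  moreover have "\<forall>\<^sub>F n in sequentially. \<bar>prob {w \<in> space M. Z n w \<le> c - e} - F (c - e)\<bar> < r / 3"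
    using lim[of "c - e", unfolded tendsto_iff, rule_format, of "r / 3"] r by (simp add: dist_real_def)
  ultimately have "\<forall>\<^sub>F n in sequentially. norm (prob (E n) - F c) < r"
  proof eventually_elim
    case (elim n)
    then obtain A where A[measurable]: "A \<in> sets M" and A1: "1 - r / 3 \<le> prob A"
      and A2: "\<And>w. w \<in> A \<Longrightarrow> w \<in> space M \<and> (w \<in> E n \<longleftrightarrow> Q n w \<le> c) \<and> \<bar>Q n w - Z n w\<bar> < e"
      by auto
    have [measurable]: "E n \<in> sets M" by (rule E)
    have sub: "E n \<subseteq> space M" using E sets.sets_into_space by blast
    have c: "prob (space M - A) \<le> r / 3"
      using A1 by (simp add: prob_compl)
    have "prob (E n) \<le> prob ({w \<in> space M. Z n w \<le> c + e} \<union> (space M - A))"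
      using A2 sub by (intro finite_measure_mono) force+
    also have "\<dots> \<le> prob {w \<in> space M. Z n w \<le> c + e} + prob (space M - A)"
      by (intro measure_Un_le) auto
    finally have 1: "prob (E n) \<le> prob {w \<in> space M. Z n w \<le> c + e} + r / 3"
      using c by simp
    have "prob {w \<in> space M. Z n w \<le> c - e} \<le> prob (E n \<union> (space M - A))"
      using A2 sub by (intro finite_measure_mono) force+
    also have "\<dots> \<le> prob (E n) + prob (space M - A)"
      by (intro measure_Un_le) auto
    finally have 2: "prob {w \<in> space M. Z n w \<le> c - e} \<le> prob (E n) + r / 3"
      using c by simp
    show ?case
      using 1 2 e elim by (simp only: real_norm_def abs_less_iff) linarith
  qed
  then show "\<exists>N. \<forall>n\<ge>N. norm (prob (E n) - F c) < r"
    by (simp add: eventually_sequentially)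
qed

end

section \<open>Chi-square limits from characteristic functions\<close>

abbreviation gauss_pow :: "nat \<Rightarrow> (nat \<Rightarrow> real) measure" where
  "gauss_pow k \<equiv> \<Pi>\<^sub>M i\<in>{..<k}. std_normal_distribution"

interpretation std_normal: prob_space std_normal_distribution
  using real_dist_normal_dist unfolding real_distribution_def by blast

interpretation std_normal_prod: product_sigma_finite "\<lambda>i::nat. std_normal_distribution"
  by standard

lemma prob_space_gauss_pow: "prob_space (gauss_pow k)"
  by (intro prob_space_PiM std_normal.prob_space_axioms)

lemma gauss_pow_component_measurable [measurable]:
  "i < k \<Longrightarrow> (\<lambda>x. x i) \<in> borel_measurable (gauss_pow k)"
  using measurable_component_singleton[of i "{..<k}" "\<lambda>_. std_normal_distribution"] by simp

lemma real_distribution_chi_square: "real_distribution (chi_square k)"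
proof -
  interpret prob_space "gauss_pow k" by (rule prob_space_gauss_pow)
  show ?thesis unfolding chi_square_def by (rule real_distribution_distr) measurable
qed

lemma cdf_chi_square: "cdf (chi_square k) c = measure (gauss_pow k) {x \<in> space (gauss_pow k). (\<Sum>i<k. (x i)\<^sup>2) \<le> c}"
proof -
  have "(\<lambda>z. \<Sum>i<k. (z i)\<^sup>2) \<in> borel_measurable (gauss_pow k)"
    by measurable
  then show ?thesis
    unfolding cdf_def chi_square_def by (subst measure_distr) (auto intro!: arg_cong[of _ _ "measure _"])
qed

lemma emeasure_std_normal_finite: "finite A \<Longrightarrow> emeasure std_normal_distribution A = 0"
proof -
  assume "finite A"
  then have N: "A \<in> null_sets lborel" by (rule finite_imp_null_set_lborel)
  then have [measurable]: "A \<in> sets borel" by auto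
  have "(\<integral>\<^sup>+x. ennreal (std_normal_density x) * indicator A x \<partial>lborel) = (\<integral>\<^sup>+x. 0 \<partial>(lborel :: real measure))"
    using AE_not_in[OF N] by (intro nn_integral_cong_AE) (auto elim!: eventually_mono simp: indicator_def)
  then show ?thesis by (simp add: emeasure_density)
qed

lemma chi_square_no_atoms:
  assumes "k > 0"
  shows "measure (chi_square k) {c} = 0"
proof -
  obtain m where k: "k = Suc m" using assms gr0_implies_Suc by blast
  have ins: "insert m {..<m} = {..<k}" by (auto simp: k)
  define f :: "(nat \<Rightarrow> real) \<Rightarrow> ennreal" where "f = (\<lambda>x. indicator {c} (\<Sum>i<k. (x i)\<^sup>2))"
  have f: "f \<in> borel_measurable (gauss_pow k)"
    unfolding f_def by measurable
  have fin: "finite {y::real. y\<^sup>2 = r}" for r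
  proof -
    have "{y::real. y\<^sup>2 = r} \<subseteq> {sqrt r, - sqrt r}"
      by (auto simp: real_sqrt_abs)
    then show ?thesis by (rule finite_subset) simp
  qed
  have "(\<integral>\<^sup>+x. f x \<partial>gauss_pow k) = (\<integral>\<^sup>+ x. (\<integral>\<^sup>+ y. f (x(m := y)) \<partial>std_normal_distribution) \<partial>gauss_pow m)"
    using std_normal_prod.product_nn_integral_insert[of "{..<m}" m f] f by (simp add: ins)
  also have "\<dots> = (\<integral>\<^sup>+ x. 0 \<partial>gauss_pow m)"
  proof (rule nn_integral_cong)
    fix x :: "nat \<Rightarrow> real"
    have "f (x(m := y)) = indicator {y. y\<^sup>2 = c - (\<Sum>i<m. (x i)\<^sup>2)} y" for y
      by (auto simp: f_def k indicator_def algebra_simps)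
    then show "(\<integral>\<^sup>+ y. f (x(m := y)) \<partial>std_normal_distribution) = 0"
      using fin[of "c - (\<Sum>i<m. (x i)\<^sup>2)"] by (simp add: emeasure_std_normal_finite)
  qed
  finally have "(\<integral>\<^sup>+x. f x \<partial>gauss_pow k) = 0" by simp
  moreover have "emeasure (chi_square k) {c} = (\<integral>\<^sup>+x. f x \<partial>gauss_pow k)"
    unfolding chi_square_def f_def
    by (subst nn_integral_distr[symmetric]) (auto simp flip: nn_integral_indicator)
  ultimately show ?thesis by (simp add: measure_def)
qed

lemma isCont_cdf_chi_square: "k > 0 \<Longrightarrow> isCont (cdf (chi_square k)) c"
proof -
  assume "k > 0"
  interpret real_distribution "chi_square k" by (rule real_distribution_chi_square)
  show ?thesis using \<open>k > 0\<close> by (simp add: isCont_cdf chi_square_no_atoms)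
qed

lemma (in real_distribution) cdf_quantile:
  assumes cont: "isCont (cdf M) (quantile M t)" and t: "0 < t" "t < 1"
  shows "cdf M (quantile M t) = t"
proof -
  have rc: "right_continuous_mono (cdf M) 0 1"
    by (rule right_continuous_mono.intro[OF cdf_is_right_cont monoI cdf_lim_at_bot cdf_lim_at_top_prob])
      (rule cdf_nondecreasing)
  have iff: "t \<le> cdf M x \<longleftrightarrow> quantile M t \<le> x" for x
    unfolding quantile_def by (rule right_continuous_mono.pseudoinverse[OF rc t])
  have lim: "(cdf M \<longlongrightarrow> cdf M (quantile M t)) (at_left (quantile M t))"
    using cont unfolding continuous_within by (rule tendsto_within_subset) simp
  have "cdf M x \<le> t" if "x < quantile M t" for x
    using iff[of x] that by linarith
  then have ev: "\<forall>\<^sub>F x in at_left (quantile M t). cdf M x \<le> t"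
    by (simp add: eventually_at_filter)
  have "cdf M (quantile M t) \<le> t"
    by (rule tendsto_upperbound[OF lim ev]) simp
  moreover have "t \<le> cdf M (quantile M t)"
    unfolding iff ..
  ultimately show ?thesis by simp
qed

lemma cdf_chi_square_quantile:
  "k > 0 \<Longrightarrow> 0 < t \<Longrightarrow> t < 1 \<Longrightarrow> cdf (chi_square k) (quantile (chi_square k) t) = t"
  by (intro real_distribution.cdf_quantile real_distribution_chi_square isCont_cdf_chi_square)

lemma std_normal_no_atoms: "isCont (cdf std_normal_distribution) x"
proof -
  interpret real_distribution std_normal_distribution by (rule real_dist_normal_dist)
  show ?thesis by (simp add: isCont_cdf measure_def emeasure_std_normal_finite)
qed

lemma std_normal_symmetric: "distr std_normal_distribution borel uminus = std_normal_distribution"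
proof (rule Levy_uniqueness)
  interpret real_distribution std_normal_distribution by (rule real_dist_normal_dist)
  show "real_distribution (distr std_normal_distribution borel uminus)"
    by (intro std_normal.real_distribution_distr) simp
  show "real_distribution std_normal_distribution" by (rule real_dist_normal_dist)
  show "char (distr std_normal_distribution borel uminus) = char std_normal_distribution"
  proof
    fix t
    have "char (distr std_normal_distribution borel uminus) t = char std_normal_distribution (- t)"
      unfolding char_def by (subst integral_distr) auto
    then show "char (distr std_normal_distribution borel uminus) t = char std_normal_distribution t"
      by (simp add: char_std_normal_distribution)
  qed
qed

lemma std_normal_quantile_square:
  assumes "0 < a" "a < 1"
  defines "z \<equiv> quantile std_normal_distribution (1 - a / 2)"
  shows "0 < z" "cdf (chi_square 1) (z\<^sup>2) = 1 - a"
proof -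
  interpret real_distribution std_normal_distribution by (rule real_dist_normal_dist)
  let ?N = "std_normal_distribution"
  have c: "cdf ?N z = 1 - a / 2"
    unfolding z_def using assms by (intro cdf_quantile std_normal_no_atoms) auto
  have atom: "measure ?N {x} = 0" for x
    by (simp add: measure_def emeasure_std_normal_finite)
  have sym: "cdf ?N (- x) = 1 - cdf ?N x" for x
  proof -
    have "cdf ?N (- x) = measure (distr ?N borel uminus) {..- x}"
      by (simp add: std_normal_symmetric cdf_def)
    also have "\<dots> = measure ?N {x..}"
      by (subst measure_distr) (auto intro!: arg_cong[of _ _ "measure _"])
    also have "{x..} = {x} \<union> (UNIV - {..x})" by auto
    also have "measure ?N \<dots> = measure ?N {x} + measure ?N (UNIV - {..x})"
      by (rule std_normal.finite_measure_Union) auto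
    also have "measure ?N (UNIV - {..x}) = 1 - cdf ?N x"
      using std_normal.prob_compl[of "{..x}"] by (simp add: cdf_def)
    finally show ?thesis using atom by simp
  qed
  have "cdf ?N 0 = 1 / 2" using sym[of 0] by simp
  then show z: "0 < z"
    using c assms cdf_nondecreasing[of z 0] by (cases "0 < z") auto
  have "cdf (chi_square 1) (z\<^sup>2) = measure (gauss_pow 1) ((\<lambda>x. x 0) -` {- z..z} \<inter> space (gauss_pow 1))"
    unfolding cdf_chi_square using z
    by (intro arg_cong[of _ _ "measure _"])
      (auto simp: lessThan_Suc abs_le_square_iff[symmetric] power2_le_iff_abs_le abs_le_iff)
  also have "\<dots> = measure (distr (gauss_pow 1) ?N (\<lambda>x. x 0)) {- z..z}"
    by (rule measure_distr[symmetric]) auto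
  also have "distr (gauss_pow 1) ?N (\<lambda>x. x 0) = ?N"
    by (rule distr_PiM_component) (auto intro: std_normal.prob_space_axioms)
  also have "measure ?N {- z..z} = measure ?N ({- z} \<union> {- z<..z})"
    using z by (intro arg_cong[of _ _ "measure _"]) auto
  also have "\<dots> = measure ?N {- z} + measure ?N {- z<..z}"
    by (rule std_normal.finite_measure_Union) auto
  also have "\<dots> = cdf ?N z - cdf ?N (- z)"
    using z by (simp add: atom cdf_diff_eq)
  also have "\<dots> = 1 - a" by (simp add: sym c)
  finally show "cdf (chi_square 1) (z\<^sup>2) = 1 - a" .
qed

lemma iexp_sum: "finite I \<Longrightarrow> iexp (\<Sum>i\<in>I. f i) = (\<Prod>i\<in>I. iexp (f i))"
  by (simp add: sum_distrib_left exp_sum)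

lemma integral_gauss_pow_iexp:
  "(\<integral>x. iexp (\<Sum>i<k. c i * x i) \<partial>gauss_pow k) = of_real (exp (- (\<Sum>i<k. (c i)\<^sup>2) / 2))"
proof -
  have "(\<integral>x. iexp (\<Sum>i<k. c i * x i) \<partial>gauss_pow k) = (\<integral>x. (\<Prod>i<k. iexp (c i * x i)) \<partial>gauss_pow k)"
    by (subst iexp_sum) auto
  also have "\<dots> = (\<Prod>i<k. \<integral>y. iexp (c i * y) \<partial>std_normal_distribution)"
    by (rule std_normal_prod.product_integral_prod) (auto intro!: std_normal.integrable_iexp)
  also have "\<dots> = (\<Prod>i<k. char std_normal_distribution (c i))"
    by (simp add: char_def)
  also have "\<dots> = of_real (exp (- (\<Sum>i<k. (c i)\<^sup>2) / 2))"
    by (simp add: char_std_normal_distribution exp_sum[symmetric] sum_negf sum_divide_distrib flip: of_real_prod)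
  finally show ?thesis .
qed

lemma (in prob_space) tendsto_integral_exp_square:
  fixes W :: "nat \<Rightarrow> 'a \<Rightarrow> 'b::euclidean_space"
  assumes W [measurable]: "\<And>n. W n \<in> borel_measurable M"
    and lim: "\<And>t. (\<lambda>n. \<integral>w. iexp (t \<bullet> W n w) \<partial>M) \<longlonglongrightarrow> of_real (exp (- (norm t)\<^sup>2 / 2))"
  shows "(\<lambda>n. \<integral>w. exp (- (norm (W n w))\<^sup>2 / 2) ^ j \<partial>M) \<longlonglongrightarrow>
    (\<integral>x. exp (- (\<Sum>i<DIM('b). (x i)\<^sup>2) / 2) ^ j \<partial>gauss_pow DIM('b))"
proof -
  let ?k = "DIM('b)"
  obtain e where e: "bij_betw e {..<?k} (Basis :: 'b set)"
    using ex_bij_betw_nat_finite[of "Basis :: 'b set"] by (auto simp: lessThan_atLeast0)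
  have eB: "e i \<in> Basis" if "i < ?k" for i
    using e that by (auto simp: bij_betw_def)
  have inj: "e i = e l \<longleftrightarrow> i = l" if "i < ?k" "l < ?k" for i l
    using e that by (auto simp: bij_betw_def inj_on_def)
  define G where "G x = (\<Sum>i<?k. x i *\<^sub>R e i)" for x :: "nat \<Rightarrow> real"
  have G_inner: "G x \<bullet> v = (\<Sum>i<?k. x i * (e i \<bullet> v))" for x v
    by (simp add: G_def inner_sum_left)
  have G_norm: "(norm (G x))\<^sup>2 = (\<Sum>i<?k. (x i)\<^sup>2)" for x
  proof -
    have "e i \<bullet> G x = x i" if "i < ?k" for i
    proof -
      have "e i \<bullet> G x = (\<Sum>l<?k. if l = i then x i else 0)"
        unfolding G_def inner_sum_right
        by (intro sum.cong) (auto simp: inner_Basis eB inj that)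
      then show ?thesis using that by simp
    qed
    then have "(\<Sum>i<?k. x i * (e i \<bullet> G x)) = (\<Sum>i<?k. (x i)\<^sup>2)"
      by (intro sum.cong) (auto simp: power2_eq_square)
    then show ?thesis
      unfolding power2_norm_eq_inner G_inner[of x "G x"] .
  qed
  have v_norm: "(\<Sum>i<?k. (e i \<bullet> v)\<^sup>2) = (norm v)\<^sup>2" for v
  proof -
    have "(norm v)\<^sup>2 = (\<Sum>b\<in>Basis. (b \<bullet> v)\<^sup>2)"
      unfolding power2_norm_eq_inner euclidean_inner[of v v] by (simp add: power2_eq_square inner_commute)
    then show ?thesis
      using sum.reindex_bij_betw[OF e, of "\<lambda>b. (b \<bullet> v)\<^sup>2"] by simp
  qed
  have G_meas [measurable]: "G \<in> borel_measurable (gauss_pow ?k)"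
    unfolding G_def by measurable
  let ?s = "sqrt (real j)"
  have M1: "prob (space M) = 1" by (rule prob_space)
  interpret N: prob_space "gauss_pow ?k" by (rule prob_space_gauss_pow)
  interpret pair_prob_space "gauss_pow ?k" M ..
  have rand: "(\<integral>x. iexp ((?s *\<^sub>R G x) \<bullet> v) \<partial>gauss_pow ?k) = of_real (exp (- (norm v)\<^sup>2 / 2) ^ j)" for v
  proof -
    have "(?s *\<^sub>R G x) \<bullet> v = (\<Sum>i<?k. (?s * (e i \<bullet> v)) * x i)" for x
      by (simp add: G_inner sum_distrib_left mult_ac)
    then have "(\<integral>x. iexp ((?s *\<^sub>R G x) \<bullet> v) \<partial>gauss_pow ?k) = of_real (exp (- (\<Sum>i<?k. (?s * (e i \<bullet> v))\<^sup>2) / 2))"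
      using integral_gauss_pow_iexp[of ?k "\<lambda>i. ?s * (e i \<bullet> v)"] by simp
    also have "(\<Sum>i<?k. (?s * (e i \<bullet> v))\<^sup>2) = real j * (norm v)\<^sup>2"
      by (simp add: power_mult_distrib v_norm flip: sum_distrib_left)
    finally show ?thesis by (simp add: exp_of_nat_mult[symmetric])
  qed
  have swap: "of_real (\<integral>w. exp (- (norm (W n w))\<^sup>2 / 2) ^ j \<partial>M)
      = (\<integral>x. (\<integral>w. iexp ((?s *\<^sub>R G x) \<bullet> W n w) \<partial>M) \<partial>gauss_pow ?k)" for n
  proof -
    have "of_real (\<integral>w. exp (- (norm (W n w))\<^sup>2 / 2) ^ j \<partial>M)
        = (\<integral>w. (\<integral>x. iexp ((?s *\<^sub>R G x) \<bullet> W n w) \<partial>gauss_pow ?k) \<partial>M)"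
      unfolding rand by (rule integral_complex_of_real[symmetric])
    also have "\<dots> = (\<integral>x. (\<integral>w. iexp ((?s *\<^sub>R G x) \<bullet> W n w) \<partial>M) \<partial>gauss_pow ?k)"
      by (rule Fubini_integral) (auto intro!: P.integrable_const_bound[of _ 1] simp: case_prod_unfold)
    finally show ?thesis .
  qed
  have "(\<lambda>n. \<integral>x. (\<integral>w. iexp ((?s *\<^sub>R G x) \<bullet> W n w) \<partial>M) \<partial>gauss_pow ?k)
      \<longlonglongrightarrow> (\<integral>x. of_real (exp (- (norm (?s *\<^sub>R G x))\<^sup>2 / 2)) \<partial>gauss_pow ?k)"
  proof (rule integral_dominated_convergence[where w="\<lambda>_. 1"])
    show "AE x in gauss_pow ?k. norm (\<integral>w. iexp ((?s *\<^sub>R G x) \<bullet> W n w) \<partial>M) \<le> 1" for n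
    proof (rule AE_I2)
      fix x
      have "norm (\<integral>w. iexp ((?s *\<^sub>R G x) \<bullet> W n w) \<partial>M) \<le> (\<integral>w. norm (iexp ((?s *\<^sub>R G x) \<bullet> W n w)) \<partial>M)"
        by (rule integral_norm_bound)
      then show "norm (\<integral>w. iexp ((?s *\<^sub>R G x) \<bullet> W n w) \<partial>M) \<le> 1"
        by (simp add: M1)
    qed
    show "AE x in gauss_pow ?k. (\<lambda>n. \<integral>w. iexp ((?s *\<^sub>R G x) \<bullet> W n w) \<partial>M)
        \<longlonglongrightarrow> of_real (exp (- (norm (?s *\<^sub>R G x))\<^sup>2 / 2))"
      by (intro AE_I2 lim)
  qed simp_all
  also have "(\<lambda>x. exp (- (norm (?s *\<^sub>R G x))\<^sup>2 / 2)) = (\<lambda>x. exp (- (\<Sum>i<?k. (x i)\<^sup>2) / 2) ^ j)"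
    by (simp add: power_mult_distrib G_norm fun_eq_iff flip: exp_of_nat_mult)
  finally show ?thesis
    unfolding swap[symmetric] integral_complex_of_real tendsto_of_real_iff .
qed

theorem (in prob_space) tendsto_cdf_chi_square:
  fixes W :: "nat \<Rightarrow> 'a \<Rightarrow> 'b::euclidean_space"
  assumes W [measurable]: "\<And>n. W n \<in> borel_measurable M"
    and lim: "\<And>t. (\<lambda>n. \<integral>w. iexp (t \<bullet> W n w) \<partial>M) \<longlonglongrightarrow> of_real (exp (- (norm t)\<^sup>2 / 2))"
  shows "(\<lambda>n. prob {w \<in> space M. (norm (W n w))\<^sup>2 \<le> c}) \<longlonglongrightarrow> cdf (chi_square DIM('b)) c"
proof -
  let ?k = "DIM('b)"
  let ?N = "gauss_pow ?k"
  interpret N: prob_space ?N by (rule prob_space_gauss_pow)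
  define E where "E n w = exp (- (norm (W n w))\<^sup>2 / 2)" for n w
  define H where "H x = exp (- (\<Sum>i<?k. (x i)\<^sup>2) / 2)" for x :: "nat \<Rightarrow> real"
  have [measurable]: "E n \<in> borel_measurable M" for n
    unfolding E_def by measurable
  have [measurable]: "H \<in> borel_measurable ?N"
    unfolding H_def by measurable
  have E01: "E n w \<in> {0..1}" and H01: "H x \<in> {0..1}" for n w x
    by (auto simp: E_def H_def sum_nonneg)
  have moments: "(\<lambda>n. \<integral>w. E n w ^ j \<partial>M) \<longlonglongrightarrow> (\<integral>x. H x ^ j \<partial>?N)" for j
    using tendsto_integral_exp_square[OF W lim, of j] by (simp add: E_def H_def)
  have int_E: "integrable M (\<lambda>w. \<phi> (E n w))" and int_H: "integrable ?N (\<lambda>x. \<phi> (H x))"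
    if "continuous_on UNIV \<phi>" for \<phi> :: "real \<Rightarrow> real" and n
  proof -
    have [measurable]: "\<phi> \<in> borel_measurable borel"
      using that by (rule borel_measurable_continuous_onI)
    have "bounded (\<phi> ` {0..1})"
      by (intro compact_imp_bounded compact_continuous_image continuous_on_subset[OF that]) auto
    then obtain B where "\<And>y. y \<in> {0..1} \<Longrightarrow> norm (\<phi> y) \<le> B"
      unfolding bounded_iff by blast
    then show "integrable M (\<lambda>w. \<phi> (E n w))" "integrable ?N (\<lambda>x. \<phi> (H x))"
      using E01 H01 by (auto intro!: integrable_const_bound[of _ B] N.integrable_const_bound[of _ B])
  qed
  have poly: "(\<lambda>n. \<integral>w. (\<Sum>j\<le>m. a j * E n w ^ j) \<partial>M) \<longlonglongrightarrow> (\<integral>x. (\<Sum>j\<le>m. a j * H x ^ j) \<partial>?N)"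
    for a :: "nat \<Rightarrow> real" and m
  proof -
    have "(\<integral>w. (\<Sum>j\<le>m. a j * E n w ^ j) \<partial>M) = (\<Sum>j\<le>m. a j * (\<integral>w. E n w ^ j \<partial>M))" for n
      by (subst Bochner_Integration.integral_sum) (auto intro!: int_E continuous_intros)
    moreover have "(\<integral>x. (\<Sum>j\<le>m. a j * H x ^ j) \<partial>?N) = (\<Sum>j\<le>m. a j * (\<integral>x. H x ^ j \<partial>?N))"
      by (subst Bochner_Integration.integral_sum) (auto intro!: int_H continuous_intros)
    ultimately show ?thesis
      by (auto intro!: tendsto_intros moments)
  qed
  have cont: "(\<lambda>n. \<integral>w. \<phi> (E n w) \<partial>M) \<longlonglongrightarrow> (\<integral>x. \<phi> (H x) \<partial>?N)"
    if \<phi>: "continuous_on UNIV \<phi>" for \<phi> :: "real \<Rightarrow> real"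
  proof (rule LIMSEQ_I)
    fix r :: real assume r: "0 < r"
    obtain p where p: "real_polynomial_function p" "\<And>y. y \<in> {0..1} \<Longrightarrow> \<bar>\<phi> y - p y\<bar> < r / 3"
      using Stone_Weierstrass_real_polynomial_function[of "{0..1}" \<phi> "r / 3"] continuous_on_subset[OF \<phi>] r by auto
    obtain a m where pa: "p = (\<lambda>y. \<Sum>j\<le>m. a j * y ^ j)"
      using p(1) real_polynomial_function_iff_sum by auto
    have pc: "continuous_on UNIV p"
      unfolding pa by (intro continuous_intros)
    have 1: "\<bar>(\<integral>w. \<phi> (E n w) \<partial>M) - (\<integral>w. p (E n w) \<partial>M)\<bar> \<le> r / 3" for n
    proof -
      have "\<bar>\<integral>w. \<phi> (E n w) - p (E n w) \<partial>M\<bar> \<le> (\<integral>w. \<bar>\<phi> (E n w) - p (E n w)\<bar> \<partial>M)"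
        by (rule integral_abs_bound)
      also have "\<dots> \<le> (\<integral>w. r / 3 \<partial>M)"
        by (rule integral_mono) (use p(2)[OF E01] in \<open>auto intro!: int_E continuous_intros \<phi> pc less_imp_le\<close>)
      finally show ?thesis
        using int_E[OF \<phi>] int_E[OF pc] by (simp add: prob_space)
    qed
    have 2: "\<bar>(\<integral>w. \<phi> (H w) \<partial>?N) - (\<integral>w. p (H w) \<partial>?N)\<bar> \<le> r / 3"
    proof -
      have "\<bar>\<integral>w. \<phi> (H w) - p (H w) \<partial>?N\<bar> \<le> (\<integral>w. \<bar>\<phi> (H w) - p (H w)\<bar> \<partial>?N)"
        by (rule integral_abs_bound)
      also have "\<dots> \<le> (\<integral>w. r / 3 \<partial>?N)"
        by (rule integral_mono) (use p(2)[OF H01] in \<open>auto intro!: int_H continuous_intros \<phi> pc less_imp_le\<close>)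
      finally show ?thesis
        using int_H[OF \<phi>] int_H[OF pc] by (simp add: N.prob_space)
    qed
    have "\<forall>\<^sub>F n in sequentially. \<bar>(\<integral>w. p (E n w) \<partial>M) - (\<integral>x. p (H x) \<partial>?N)\<bar> < r / 3"
      using poly[of a m, unfolded tendsto_iff, rule_format, of "r / 3"] r
      by (simp add: dist_real_def pa)
    then have "\<forall>\<^sub>F n in sequentially. norm ((\<integral>w. \<phi> (E n w) \<partial>M) - (\<integral>x. \<phi> (H x) \<partial>?N)) < r"
    proof eventually_elim
      case (elim n)
      show ?case using elim 1[of n] 2 by (simp only: real_norm_def)
    qed
    then show "\<exists>N. \<forall>n\<ge>N. norm ((\<integral>w. \<phi> (E n w) \<partial>M) - (\<integral>x. \<phi> (H x) \<partial>?N)) < r"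
      by (simp add: eventually_sequentially)
  qed
  let ?Mn = "\<lambda>n. distr M borel (\<lambda>w. - E n w)" and ?Ml = "distr ?N borel (\<lambda>x. - H x)"
  have "weak_conv_m ?Mn ?Ml"
  proof (rule integral_cts_step_conv_imp_weak_conv)
    fix x y :: real assume "x < y"
    then have c: "continuous_on UNIV (cts_step x y)"
      by (intro uniformly_continuous_imp_continuous cts_step_uniformly_continuous)
    then have [measurable]: "cts_step x y \<in> borel_measurable borel"
      by (rule borel_measurable_continuous_onI)
    have "continuous_on UNIV (\<lambda>v. cts_step x y (- v))"
      by (intro continuous_on_compose2[OF c] continuous_intros) auto
    from cont[OF this]
    show "(\<lambda>n. integral\<^sup>L (?Mn n) (cts_step x y)) \<longlonglongrightarrow> integral\<^sup>L ?Ml (cts_step x y)"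
      by (simp add: integral_distr)
  qed (auto intro!: real_distribution_distr N.real_distribution_distr)
  moreover
  interpret L: real_distribution ?Ml by (intro N.real_distribution_distr) simp
  interpret chi: real_distribution "chi_square ?k" by (rule real_distribution_chi_square)
  have Mn: "cdf (?Mn n) (- exp (- c / 2)) = prob {w \<in> space M. (norm (W n w))\<^sup>2 \<le> c}" for n
    unfolding cdf_def by (subst measure_distr) (auto intro!: arg_cong[of _ _ prob] simp: E_def)
  have Ml: "cdf ?Ml (- exp (- c / 2)) = cdf (chi_square ?k) c"
    unfolding cdf_chi_square unfolding cdf_def
    by (subst measure_distr) (auto intro!: arg_cong[of _ _ "measure ?N"] simp: H_def)
  have "measure ?Ml {- exp (- c / 2)} = measure (chi_square ?k) {c}"
    unfolding chi_square_def
    by (subst (1 2) measure_distr) (auto intro!: arg_cong[of _ _ "measure ?N"] simp: H_def)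
  then have "isCont (cdf ?Ml) (- exp (- c / 2))"
    by (simp add: L.isCont_cdf chi_square_no_atoms)
  ultimately show ?thesis
    unfolding weak_conv_m_def weak_conv_def Mn[symmetric] Ml[symmetric] by blast
qed

section \<open>Matrices\<close>

lemma tendsto_det:
  fixes A :: "'b \<Rightarrow> real ^ 'n ^ 'n"
  shows "(A \<longlongrightarrow> L) F \<Longrightarrow> ((\<lambda>x. det (A x)) \<longlongrightarrow> det L) F"
  unfolding det_def by (intro tendsto_intros)

lemma tendsto_matrix_vector_mult [tendsto_intros]:
  fixes A :: "'b \<Rightarrow> real ^ 'n ^ 'm"
  assumes "(A \<longlongrightarrow> L) F" "(v \<longlongrightarrow> l) F"
  shows "((\<lambda>x. A x *v v x) \<longlongrightarrow> L *v l) F"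
  unfolding matrix_vector_mult_def by (intro vec_tendstoI) (simp, intro tendsto_intros assms)

lemma tendsto_matrix_matrix_mult [tendsto_intros]:
  fixes A :: "'b \<Rightarrow> real ^ 'n ^ 'm" and B :: "'b \<Rightarrow> real ^ 'k ^ 'n"
  assumes "(A \<longlongrightarrow> L) F" "(B \<longlongrightarrow> N) F"
  shows "((\<lambda>x. A x ** B x) \<longlongrightarrow> L ** N) F"
  unfolding matrix_matrix_mult_def by (intro vec_tendstoI) (simp, intro tendsto_intros assms)

lemma tendsto_transpose [tendsto_intros]:
  fixes A :: "'b \<Rightarrow> real ^ 'n ^ 'm"
  assumes "(A \<longlongrightarrow> L) F"
  shows "((\<lambda>x. transpose (A x)) \<longlongrightarrow> transpose L) F"
  unfolding transpose_def by (intro vec_tendstoI) (simp, intro tendsto_intros assms)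

lemma matrix_inv_inverse:
  fixes A :: "real ^ 'n ^ 'n"
  assumes "invertible A"
  shows "A ** matrix_inv A = mat 1" "matrix_inv A ** A = mat 1"
proof -
  have "A ** matrix_inv A = mat 1 \<and> matrix_inv A ** A = mat 1"
    using assms unfolding invertible_def matrix_inv_def by (rule someI_ex)
  then show "A ** matrix_inv A = mat 1" "matrix_inv A ** A = mat 1" by auto
qed

lemma matrix_inv_unique:
  fixes A B :: "real ^ 'n ^ 'n"
  assumes "A ** B = mat 1"
  shows "matrix_inv A = B"
proof -
  have "B ** A = mat 1" using assms by (rule matrix_left_right_inverse[THEN iffD1])
  then have "invertible A" using assms unfolding invertible_def by blast
  then have "matrix_inv A ** A = mat 1" by (rule matrix_inv_inverse)
  then have "(matrix_inv A ** A) ** B = B" by simp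
  then show ?thesis by (simp add: assms flip: matrix_mul_assoc)
qed

lemma matrix_inv_mult_vec:
  fixes A :: "real ^ 'n ^ 'n"
  assumes "det A \<noteq> 0"
  shows "A *v (matrix_inv A *v b) = b" "matrix_inv A *v (A *v b) = b"
  using assms by (simp_all add: matrix_vector_mul_assoc matrix_inv_inverse flip: invertible_det_nz)

lemma matrix_inv_cramer:
  fixes A :: "real ^ 'n ^ 'n"
  assumes "det A \<noteq> 0"
  shows "matrix_inv A $ k $ l = det (\<chi> i j. if j = k then axis l 1 $ i else A $ i $ j) / det A"
proof -
  have "matrix_inv A *v axis l 1 = (\<chi> k. det (\<chi> i j. if j = k then axis l 1 $ i else A $ i $ j) / det A)"
    using cramer[OF assms, of "matrix_inv A *v axis l 1" "axis l 1"] matrix_inv_mult_vec(1)[OF assms] by simp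
  then have "(matrix_inv A *v axis l 1) $ k = det (\<chi> i j. if j = k then axis l 1 $ i else A $ i $ j) / det A"
    by simp
  then show ?thesis
    by (simp add: matrix_vector_mult_basis column_def)
qed

lemma tendsto_matrix_inv:
  fixes A :: "'b \<Rightarrow> real ^ 'n ^ 'n"
  assumes A: "(A \<longlongrightarrow> L) F" and L: "det L \<noteq> 0"
  shows "((\<lambda>x. matrix_inv (A x)) \<longlongrightarrow> matrix_inv L) F"
proof (intro vec_tendstoI)
  fix k l
  have "((\<lambda>x. det (\<chi> i j. if j = k then axis l 1 $ i else A x $ i $ j) / det (A x)) \<longlongrightarrow>
      det (\<chi> i j. if j = k then axis l 1 $ i else L $ i $ j) / det L) F"
  proof (intro tendsto_divide tendsto_det A L vec_tendstoI)
    fix i j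
    show "((\<lambda>x. (\<chi> i j. if j = k then axis l 1 $ i else A x $ i $ j) $ i $ j) \<longlongrightarrow>
        (\<chi> i j. if j = k then axis l 1 $ i else L $ i $ j) $ i $ j) F"
      by (cases "j = k") (auto intro!: tendsto_intros A)
  qed
  moreover have "\<forall>\<^sub>F x in F. det (A x) \<noteq> 0"
    by (rule tendsto_imp_eventually_ne[OF tendsto_det[OF A] L])
  then have "\<forall>\<^sub>F x in F. det (\<chi> i j. if j = k then axis l 1 $ i else A x $ i $ j) / det (A x) = matrix_inv (A x) $ k $ l"
    by eventually_elim (simp add: matrix_inv_cramer)
  ultimately show "((\<lambda>x. matrix_inv (A x) $ k $ l) \<longlongrightarrow> matrix_inv L $ k $ l) F"
    unfolding matrix_inv_cramer[OF L] by (rule Lim_transform_eventually)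
qed

lemma eventually_invertible:
  fixes A :: "'b \<Rightarrow> real ^ 'n ^ 'n"
  assumes "(A \<longlongrightarrow> L) F" "det L \<noteq> 0"
  shows "\<forall>\<^sub>F x in F. invertible (A x)"
  unfolding invertible_det_nz by (rule tendsto_imp_eventually_ne[OF tendsto_det]) (use assms in auto)

lemma norm_matrix_vector_mult_le:
  fixes A :: "real ^ 'n ^ 'm"
  shows "norm (A *v v) \<le> norm A * norm v"
proof -
  have "norm (A *v v) \<le> L2_set (\<lambda>i. norm (A $ i) * norm v) UNIV"
    unfolding norm_vec_def[of "A *v v"]
    by (rule L2_set_mono) (auto simp: matrix_vector_mul_component Cauchy_Schwarz_ineq2)
  also have "\<dots> = norm A * norm v"
    by (simp add: L2_set_left_distrib norm_vec_def[of A])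
  finally show ?thesis .
qed

lemma inner_symmetric_matrix:
  fixes S :: "real ^ 'n ^ 'n"
  assumes "transpose S = S"
  shows "u \<bullet> (S *v v) = v \<bullet> (S *v u)"
proof -
  have "u \<bullet> (S *v v) = (transpose S *v u) \<bullet> v"
    by (simp add: dot_lmul_matrix)
  then show ?thesis by (simp add: assms inner_commute)
qed

lemma orthonormalizing_matrix:
  fixes S :: "real ^ 'n ^ 'n"
  assumes sym: "transpose S = S" and pos: "\<And>v. v \<noteq> 0 \<Longrightarrow> 0 < v \<bullet> (S *v v)"
  obtains C :: "real ^ 'n ^ 'n" where "C ** S ** transpose C = mat 1"
proof -
  have symm: "u \<bullet> (S *v v) = v \<bullet> (S *v u)" for u v
    by (rule inner_symmetric_matrix[OF sym])
  have ex: "\<exists>c::'n \<Rightarrow> real ^ 'n. \<forall>i\<in>A. \<forall>j\<in>A. c i \<bullet> (S *v c j) = (if i = j then 1 else 0)" for A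
    using finite[of A]
  proof (induction A rule: finite_induct)
    case (insert a A)
    then obtain c :: "'n \<Rightarrow> real ^ 'n" where c: "\<And>i j. i \<in> A \<Longrightarrow> j \<in> A \<Longrightarrow> c i \<bullet> (S *v c j) = (if i = j then 1 else 0)"
      by blast
    have "card (c ` A) < CARD('n)"
    proof -
      have "card (c ` A) \<le> card A" by (rule card_image_le) simp
      also have "\<dots> < CARD('n)" using insert by (intro psubset_card_mono) auto
      finally show ?thesis .
    qed
    moreover have "dim (c ` A) \<le> card (c ` A)" by (rule dim_le_card') simp
    ultimately have "dim (span (c ` A)) < DIM(real ^ 'n)"
      by simp
    then have "span (c ` A) \<noteq> UNIV"
      by (metis dim_UNIV less_irrefl)
    then obtain x where x: "x \<notin> span (c ` A)" by blast
    define y where "y = x - (\<Sum>i\<in>A. (x \<bullet> (S *v c i)) *\<^sub>R c i)"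
    have "y \<noteq> 0"
    proof
      assume "y = 0"
      then have "x = (\<Sum>i\<in>A. (x \<bullet> (S *v c i)) *\<^sub>R c i)" by (simp add: y_def)
      also have "\<dots> \<in> span (c ` A)" by (intro span_sum span_scale span_base) auto
      finally show False using x by simp
    qed
    then have ypos: "0 < y \<bullet> (S *v y)" by (rule pos)
    have yc: "y \<bullet> (S *v c j) = 0" if j: "j \<in> A" for j
    proof -
      have "(\<Sum>i\<in>A. (x \<bullet> (S *v c i)) *\<^sub>R c i) \<bullet> (S *v c j) = (\<Sum>i\<in>A. if i = j then x \<bullet> (S *v c j) else 0)"
        unfolding inner_sum_left by (intro sum.cong) (auto simp: c j)
      then show ?thesis using j by (simp add: y_def inner_diff_left)
    qed
    define z where "z = (1 / sqrt (y \<bullet> (S *v y))) *\<^sub>R y"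
    have zz: "z \<bullet> (S *v z) = 1"
      using ypos by (simp add: z_def matrix_vector_mult_scaleR power2_eq_square[symmetric] field_simps)
    have zc: "z \<bullet> (S *v c j) = 0" "c j \<bullet> (S *v z) = 0" if "j \<in> A" for j
      using yc[OF that] symm[of "c j" z] by (auto simp: z_def)
    show ?case
      by (rule exI[of _ "c(a := z)"]) (use insert(2) in \<open>auto simp: c zz zc\<close>)
  qed simp
  from ex[of UNIV] obtain c :: "'n \<Rightarrow> real ^ 'n" where c: "\<And>i j. c i \<bullet> (S *v c j) = (if i = j then 1 else 0)"
    by blast
  define C :: "real ^ 'n ^ 'n" where "C = (\<chi> i. c i)"
  have "(C ** S ** transpose C) $ i $ j = mat 1 $ i $ j" for i j
  proof -
    have "(C ** S ** transpose C) $ i $ j = ((C ** S ** transpose C) *v axis j 1) $ i"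
      by (simp add: matrix_vector_mult_basis column_def)
    also have "\<dots> = (C *v (S *v (transpose C *v axis j 1))) $ i"
      by (simp only: matrix_vector_mul_assoc matrix_mul_assoc)
    also have "transpose C *v axis j 1 = c j"
      by (simp only: matrix_vector_mult_basis column_transpose) (simp add: row_def C_def)
    also have "(C *v (S *v c j)) $ i = c i \<bullet> (S *v c j)"
      by (simp add: matrix_vector_mul_component C_def)
    finally have "(C ** S ** transpose C) $ i $ j = c i \<bullet> (S *v c j)" .
    then show ?thesis by (simp add: c mat_def)
  qed
  then have "C ** S ** transpose C = mat 1" by (simp add: vec_eq_iff)
  then show ?thesis by (rule that)
qed

lemma quadratic_form_matrix_inv:
  fixes S C :: "real ^ 'n ^ 'n"
  assumes "C ** S ** transpose C = mat 1"
  shows "det S \<noteq> 0" "v \<bullet> (matrix_inv S *v v) = (norm (C *v v))\<^sup>2"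
proof -
  have "(S ** transpose C) ** C = mat 1"
    using assms matrix_left_right_inverse[of C "S ** transpose C"] by (simp add: matrix_mul_assoc)
  then have S: "S ** (transpose C ** C) = mat 1"
    by (simp add: matrix_mul_assoc)
  then show "det S \<noteq> 0"
    using invertible_right_inverse invertible_det_nz by blast
  have "v \<bullet> (matrix_inv S *v v) = v \<bullet> (transpose C *v (C *v v))"
    by (simp add: matrix_inv_unique[OF S] matrix_vector_mul_assoc)
  also have "\<dots> = (norm (C *v v))\<^sup>2"
    unfolding power2_norm_eq_inner by (simp add: dot_lmul_matrix inner_commute[of v])
  finally show "v \<bullet> (matrix_inv S *v v) = (norm (C *v v))\<^sup>2" .
qed

lemma finite_symmetric_eigenvalues:
  fixes S :: "real ^ 'n ^ 'n"
  assumes sym: "transpose S = S"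
  shows "finite {l. \<exists>v. v \<noteq> 0 \<and> S *v v = l *\<^sub>R v}" (is "finite ?E")
proof -
  have symm: "u \<bullet> (S *v v) = v \<bullet> (S *v u)" for u v
    by (rule inner_symmetric_matrix[OF sym])
  define e where "e l = (SOME v. v \<noteq> 0 \<and> S *v v = l *\<^sub>R v)" for l :: real
  have e: "e l \<noteq> 0" "S *v e l = l *\<^sub>R e l" if "l \<in> ?E" for l
    using that someI_ex[of "\<lambda>v. v \<noteq> 0 \<and> S *v v = l *\<^sub>R v"] by (auto simp: e_def)
  have orth: "e l \<bullet> e m = 0" if "l \<in> ?E" "m \<in> ?E" "l \<noteq> m" for l m
    using symm[of "e l" "e m"] e that by (simp add: inner_commute)
  have "inj_on e ?E"
  proof (rule inj_onI)
    fix l m assume "l \<in> ?E" "m \<in> ?E" "e l = e m"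
    then have "e l \<bullet> e m \<noteq> 0" using e(1) by auto
    then show "l = m" using orth \<open>l \<in> ?E\<close> \<open>m \<in> ?E\<close> by blast
  qed
  moreover have "independent (e ` ?E)"
  proof (rule pairwise_orthogonal_independent)
    show "pairwise orthogonal (e ` ?E)"
      using orth by (intro pairwise_imageI) (simp add: orthogonal_def)
    show "0 \<notin> e ` ?E"
    proof
      assume "0 \<in> e ` ?E"
      then obtain l where "l \<in> ?E" "e l = 0" by (rule imageE) simp
      then show False using e(1)[OF \<open>l \<in> ?E\<close>] by simp
    qed
  qed
  then have "finite (e ` ?E)" by (rule independent_imp_finite)
  ultimately show ?thesis by (rule finite_imageD[rotated])
qed

lemma quadratic_form_le_lambda_max:
  fixes S :: "real ^ 'n ^ 'n"
  assumes sym: "transpose S = S"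
  shows "v \<bullet> (S *v v) \<le> lambda_max S * (norm v)\<^sup>2"
proof -
  have symm: "u \<bullet> (S *v v) = v \<bullet> (S *v u)" for u v
    by (rule inner_symmetric_matrix[OF sym])
  have "continuous_on (sphere 0 1) (\<lambda>v. v \<bullet> (S *v v))"
    by (intro continuous_on_inner continuous_on_id linear_continuous_on matrix_vector_mul_bounded_linear)
  moreover have "sphere (0 :: real ^ 'n) 1 \<noteq> {}" by simp
  ultimately obtain u where u: "norm u = 1" and max: "\<And>v. norm v = 1 \<Longrightarrow> v \<bullet> (S *v v) \<le> u \<bullet> (S *v u)"
    using continuous_attains_sup[of "sphere (0 :: real ^ 'n) 1" "\<lambda>v. v \<bullet> (S *v v)"] by auto
  define l where "l = u \<bullet> (S *v u)"
  have le: "v \<bullet> (S *v v) \<le> l * (norm v)\<^sup>2" for v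
  proof (cases "v = 0")
    case False
    then have "(1 / norm v) *\<^sub>R v \<bullet> (S *v ((1 / norm v) *\<^sub>R v)) \<le> l"
      unfolding l_def by (intro max) simp
    then show ?thesis using False
      by (simp add: matrix_vector_mult_scaleR field_simps power2_eq_square)
  qed simp
  \<comment> \<open>The form \<open>l (norm v)\<^sup>2 - v \<bullet> S v\<close> is nonnegative and vanishes at \<open>u\<close>, so its derivative vanishes there.\<close>
  have "S *v u = l *\<^sub>R u"
  proof (rule ccontr)
    define r where "r = S *v u - l *\<^sub>R u"
    assume "S *v u \<noteq> l *\<^sub>R u"
    then have r: "r \<bullet> r > 0" by (simp add: r_def)
    define a where "a = l * (r \<bullet> r) - r \<bullet> (S *v r)"
    have ineq: "2 * t * (r \<bullet> r) \<le> t\<^sup>2 * a" for t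
    proof -
      have Q: "(u + t *\<^sub>R r) \<bullet> (S *v (u + t *\<^sub>R r)) = l + 2 * t * (r \<bullet> (S *v u)) + t\<^sup>2 * (r \<bullet> (S *v r))"
        using symm[of u r]
        by (simp add: matrix_vector_right_distrib matrix_vector_mult_scaleR inner_add_left inner_add_right
            l_def power2_eq_square algebra_simps)
      have N: "(norm (u + t *\<^sub>R r))\<^sup>2 = 1 + 2 * t * (r \<bullet> u) + t\<^sup>2 * (r \<bullet> r)"
        using u unfolding power2_norm_eq_inner
        by (simp add: inner_add_left inner_add_right inner_commute power2_eq_square algebra_simps
            norm_eq_1)
      have rr: "r \<bullet> r = r \<bullet> (S *v u) - l * (r \<bullet> u)"
        by (subst (2) r_def) (simp add: inner_diff_right)
      have "2 * t * (r \<bullet> r) = 2 * t * (r \<bullet> (S *v u) - l * (r \<bullet> u))"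
        by (rule arg_cong[OF rr])
      also have "\<dots> = 2 * t * (r \<bullet> (S *v u)) - l * (2 * t * (r \<bullet> u))"
        by (simp add: algebra_simps)
      finally have "2 * t * (r \<bullet> r) = 2 * t * (r \<bullet> (S *v u)) - l * (2 * t * (r \<bullet> u))" .
      moreover have "l + 2 * t * (r \<bullet> (S *v u)) + t\<^sup>2 * (r \<bullet> (S *v r)) \<le> l * (1 + 2 * t * (r \<bullet> u) + t\<^sup>2 * (r \<bullet> r))"
        using le[of "u + t *\<^sub>R r"] unfolding Q N .
      ultimately show ?thesis
        unfolding a_def right_diff_distrib distrib_left by (simp add: mult.left_commute)
    qed
    define t where "t = (r \<bullet> r) / (\<bar>a\<bar> + 1)"
    have t: "t > 0" using r by (simp add: t_def)
    have "2 * (r \<bullet> r) \<le> t * a"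
      using ineq[of t] t by (simp add: power2_eq_square)
    also have "\<dots> \<le> t * (\<bar>a\<bar> + 1)" using t by (intro mult_left_mono) auto
    also have "\<dots> = r \<bullet> r" by (simp add: t_def)
    finally show False using r by simp
  qed
  then have "l \<in> {l. \<exists>v. v \<noteq> 0 \<and> S *v v = l *\<^sub>R v}"
    using u by (intro CollectI exI[of _ u]) auto
  then have "l \<le> lambda_max S"
    unfolding lambda_max_def by (intro Max_ge finite_symmetric_eigenvalues sym)
  then have "l * (norm v)\<^sup>2 \<le> lambda_max S * (norm v)\<^sup>2"
    by (rule mult_right_mono) simp
  with le show ?thesis by (rule order_trans)
qed

section \<open>The least-squares map\<close>

lemma linear_Sigma_of: "linear Sigma_of"
  by (rule linearI) (simp_all add: Sigma_of_def vec_eq_iff)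

lemma linear_Gamma_of: "linear Gamma_of"
  by (rule linearI) (simp_all add: Gamma_of_def vec_eq_iff)

lemma tendsto_Sigma_of: "(x \<longlongrightarrow> y) F \<Longrightarrow> ((\<lambda>z. Sigma_of (x z)) \<longlongrightarrow> Sigma_of y) F"
  by (rule linear_continuous_at[OF linear_conv_bounded_linear[THEN iffD1, OF linear_Sigma_of],
        THEN isCont_tendsto_compose])

lemma tendsto_Gamma_of: "(x \<longlongrightarrow> y) F \<Longrightarrow> ((\<lambda>z. Gamma_of (x z)) \<longlongrightarrow> Gamma_of y) F"
  by (rule linear_continuous_at[OF linear_conv_bounded_linear[THEN iffD1, OF linear_Gamma_of],
        THEN isCont_tendsto_compose])

text \<open>\<open>Gamma_of u - Sigma_of u *v b\<close> is the direction in which the normal equations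
  \<open>Sigma_of x *v b = Gamma_of x\<close> are violated when the moments move by \<open>u\<close>.\<close>

definition normal_defect :: "real ^ ('m::{finite, linorder}) \<Rightarrow> real ^ ('m lowtri + 'm) \<Rightarrow> real ^ ('m::{finite, linorder})" where
  "normal_defect b u = Gamma_of u - Sigma_of u *v b"

lemma linear_normal_defect: "linear (normal_defect b)"
  by (rule linearI)
    (simp_all add: normal_defect_def linear_add[OF linear_Gamma_of] linear_add[OF linear_Sigma_of]
      linear_scale[OF linear_Gamma_of] linear_scale[OF linear_Sigma_of]
      matrix_vector_mult_add_rdistrib scaleR_matrix_vector_assoc[symmetric] algebra_simps)

lemma tendsto_normal_defect:
  "(b \<longlongrightarrow> b') F \<Longrightarrow> (x \<longlongrightarrow> x') F \<Longrightarrow> ((\<lambda>z. normal_defect (b z) (x z)) \<longlongrightarrow> normal_defect b' x') F"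
  unfolding normal_defect_def by (intro tendsto_intros tendsto_Gamma_of tendsto_Sigma_of)

lemma pos_dom_det: "x \<in> pos_dom \<Longrightarrow> det (Sigma_of x) \<noteq> 0"
  by (simp add: pos_dom_def)

lemma open_pos_dom: "open pos_dom"
proof -
  have "continuous_on UNIV (\<lambda>x. det (Sigma_of x))"
    unfolding continuous_on by (auto intro!: tendsto_det tendsto_Sigma_of tendsto_ident_at)
  then show ?thesis
    unfolding pos_dom_def by (intro open_Collect_less continuous_on_const)
qed

lemma eventually_pos_dom: "(x \<longlongrightarrow> y) F \<Longrightarrow> y \<in> pos_dom \<Longrightarrow> \<forall>\<^sub>F z in F. x z \<in> pos_dom"
  by (rule topological_tendstoD[OF _ open_pos_dom])

lemma Sigma_of_g_map: "x \<in> pos_dom \<Longrightarrow> Sigma_of x *v g_map x = Gamma_of x"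
  by (simp add: g_map_def matrix_inv_mult_vec pos_dom_det)

lemma tendsto_g_map: "(x \<longlongrightarrow> y) F \<Longrightarrow> y \<in> pos_dom \<Longrightarrow> ((\<lambda>z. g_map (x z)) \<longlongrightarrow> g_map y) F"
  unfolding g_map_def
  by (intro tendsto_intros tendsto_matrix_inv tendsto_Gamma_of tendsto_Sigma_of pos_dom_det)

lemma g_map_diff:
  assumes "x \<in> pos_dom" "y \<in> pos_dom"
  shows "g_map y - g_map x = matrix_inv (Sigma_of y) *v normal_defect (g_map x) (y - x)"
proof -
  have "normal_defect (g_map x) (y - x) = Sigma_of y *v (g_map y - g_map x)"
    by (simp add: normal_defect_def linear_diff[OF linear_Gamma_of] linear_diff[OF linear_Sigma_of]
        matrix_vector_mult_diff_rdistrib matrix_vector_mult_diff_distrib Sigma_of_g_map assms)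
  then show ?thesis
    by (simp add: matrix_inv_mult_vec pos_dom_det assms)
qed

lemma g_map_has_derivative:
  assumes x: "x \<in> pos_dom"
  shows "(g_map has_derivative (\<lambda>u. matrix_inv (Sigma_of x) *v normal_defect (g_map x) u)) (at x)"
proof -
  let ?I = "\<lambda>y. matrix_inv (Sigma_of y)" and ?L = "normal_defect (g_map x)"
  have L: "bounded_linear ?L"
    using linear_normal_defect by (rule linear_conv_bounded_linear[THEN iffD1])
  then obtain B where B: "\<And>u. norm (?L u) \<le> norm u * B"
    using bounded_linear.bounded by blast
  have bl: "bounded_linear (\<lambda>u. ?I x *v ?L u)"
    using bounded_linear_compose[OF matrix_vector_mul_bounded_linear L] .
  have I0: "((\<lambda>y. norm (?I y - ?I x) * B) \<longlongrightarrow> 0) (at x)"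
    by (rule tendsto_eq_intros tendsto_norm_zero LIM_zero tendsto_matrix_inv tendsto_Sigma_of
        tendsto_ident_at pos_dom_det x refl)+ simp
  have "\<forall>\<^sub>F y in at x. y \<in> pos_dom"
    by (rule eventually_pos_dom[OF tendsto_ident_at x])
  then have "\<forall>\<^sub>F y in at x. norm (norm (g_map y - g_map x - ?I x *v ?L (y - x)) / norm (y - x)) \<le> norm (?I y - ?I x) * B"
  proof eventually_elim
    case (elim y)
    have "g_map y - g_map x - ?I x *v ?L (y - x) = (?I y - ?I x) *v ?L (y - x)"
      by (simp add: g_map_diff[OF x elim] matrix_vector_mult_diff_rdistrib)
    also have "norm \<dots> \<le> norm (?I y - ?I x) * norm (?L (y - x))"
      by (rule norm_matrix_vector_mult_le)
    also have "\<dots> \<le> norm (?I y - ?I x) * (norm (y - x) * B)"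
      by (intro mult_left_mono B) simp
    finally show ?case
      using B[of "y - x"] norm_ge_zero[of "?L (y - x)"]
      by (cases "y = x") (auto simp: divide_le_eq mult_ac)
  qed
  then have "((\<lambda>y. norm (g_map y - g_map x - ?I x *v ?L (y - x)) / norm (y - x)) \<longlongrightarrow> 0) (at x)"
    using I0 by (rule Lim_null_comparison)
  then show ?thesis
    using bl unfolding has_derivative_iff_norm by simp
qed

lemma jacobian_g_map:
  assumes "x \<in> pos_dom"
  shows "jacobian g_map (at x) *v u = matrix_inv (Sigma_of x) *v normal_defect (g_map x) u"
proof -
  note D = g_map_has_derivative[OF assms]
  have "(g_map has_derivative (\<lambda>h. jacobian g_map (at x) *v h)) (at x)"
    using D jacobian_works differentiableI by blast
  from has_derivative_unique[OF this D] show ?thesis by (rule fun_cong)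
qed

lemma tendsto_jacobian_g_map:
  fixes y :: "real ^ ('m::{finite, linorder} lowtri + 'm)"
  assumes x: "(x \<longlongrightarrow> y) F" and y: "y \<in> pos_dom"
  shows "((\<lambda>z. jacobian g_map (at (x z))) \<longlongrightarrow> jacobian g_map (at y)) F"
proof (intro vec_tendstoI)
  fix i k
  have eq: "jacobian g_map (at x) $ i $ k = (matrix_inv (Sigma_of x) *v normal_defect (g_map x) (axis k 1)) $ i"
    if "x \<in> pos_dom" for x :: "real ^ ('m lowtri + 'm)"
    using jacobian_g_map[OF that, of "axis k 1"] by (simp add: matrix_vector_mult_basis column_def vec_eq_iff)
  have "((\<lambda>z. (matrix_inv (Sigma_of (x z)) *v normal_defect (g_map (x z)) (axis k 1)) $ i) \<longlongrightarrow>
      (matrix_inv (Sigma_of y) *v normal_defect (g_map y) (axis k 1)) $ i) F"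
    by (intro tendsto_intros tendsto_matrix_inv tendsto_Sigma_of tendsto_normal_defect tendsto_g_map x y pos_dom_det)
  moreover have "\<forall>\<^sub>F z in F. (matrix_inv (Sigma_of (x z)) *v normal_defect (g_map (x z)) (axis k 1)) $ i
      = jacobian g_map (at (x z)) $ i $ k"
    using eventually_pos_dom[OF x y] by eventually_elim (simp add: eq)
  ultimately show "((\<lambda>z. jacobian g_map (at (x z)) $ i $ k) \<longlongrightarrow> jacobian g_map (at y) $ i $ k) F"
    unfolding eq[OF y] by (rule Lim_transform_eventually)
qed

section \<open>Kernel smoothing\<close>

lemma (in prob_space) expectation_scaled:
  fixes V :: "'a \<Rightarrow> real" and f G :: "real \<Rightarrow> real"
  assumes V: "distributed M lborel V (\<lambda>x. ennreal (f x))" and f: "\<And>x. 0 \<le> f x"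
    and G [measurable]: "G \<in> borel_measurable borel" and b: "0 < b"
  shows "(\<integral>w. G (V w / b) \<partial>M) = b * (\<integral>u. G u * f (b * u) \<partial>lborel)"
proof -
  have "(\<integral>w. G (V w / b) \<partial>M) = (\<integral>x. f x * G (x / b) \<partial>lborel)"
    using V f by (intro distributed_integral[symmetric]) auto
  also have "\<dots> = b * (\<integral>u. G u * f (b * u) \<partial>lborel)"
    using b lborel_integral_real_affine[of b "\<lambda>x. f x * G (x / b)" 0] by (simp add: mult.commute)
  finally show ?thesis .
qed

lemma tendsto_integral_scaled:
  fixes f G :: "real \<Rightarrow> real"
  assumes [measurable]: "f \<in> borel_measurable borel" and bdd: "bounded (range f)" and cont: "isCont f 0"
    and G: "integrable lborel G" and b: "b \<longlonglongrightarrow> 0"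
  shows "(\<lambda>n. \<integral>u. G u * f (b n * u) \<partial>lborel) \<longlonglongrightarrow> f 0 * (\<integral>u. G u \<partial>lborel)"
proof -
  obtain B where B: "\<And>x. \<bar>f x\<bar> \<le> B"
    using bdd by (auto simp: bounded_iff)
  have "(\<lambda>n. \<integral>u. G u * f (b n * u) \<partial>lborel) \<longlonglongrightarrow> (\<integral>u. G u * f 0 \<partial>lborel)"
  proof (rule integral_dominated_convergence)
    show "integrable lborel (\<lambda>u. \<bar>G u\<bar> * B)" using G by simp
    show "AE u in lborel. (\<lambda>n. G u * f (b n * u)) \<longlonglongrightarrow> G u * f 0"
      by (intro AE_I2 tendsto_mult tendsto_const isCont_tendsto_compose[OF cont] tendsto_mult_left_zero b)
    show "AE u in lborel. norm (G u * f (b n * u)) \<le> \<bar>G u\<bar> * B" for n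
      by (intro AE_I2) (auto simp: abs_mult intro!: mult_left_mono B)
  qed (use G in auto)
  then show ?thesis by (simp add: mult.commute)
qed

lemma symmetric_second_difference:
  fixes f :: "real \<Rightarrow> real"
  assumes diff: "\<And>x. x \<in> ball 0 \<delta> \<Longrightarrow> f differentiable (at x) \<and> deriv f differentiable (at x)"
    and y: "\<bar>y\<bar> < \<delta>"
  obtains s t where "\<bar>s\<bar> \<le> \<bar>y\<bar>" "\<bar>t\<bar> \<le> \<bar>y\<bar>"
    "f y + f (- y) - 2 * f 0 = (deriv (deriv f) s + deriv (deriv f) t) / 2 * y\<^sup>2"
proof -
  define D where "D m = (case m of 0 \<Rightarrow> f | Suc 0 \<Rightarrow> deriv f | _ \<Rightarrow> deriv (deriv f))" for m :: nat
  have D: "DERIV (D m) t :> D (Suc m) t" if "m < 2" "\<bar>t\<bar> < \<delta>" for m t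
  proof -
    have "DERIV f t :> deriv f t" "DERIV (deriv f) t :> deriv (deriv f) t"
      using diff[of t] that(2) by (auto simp: DERIV_deriv_iff_real_differentiable)
    then show ?thesis
      using that(1) by (auto simp: D_def less_2_cases_iff)
  qed
  have taylor: "\<exists>s. \<bar>s\<bar> \<le> \<bar>x\<bar> \<and> f x = f 0 + deriv f 0 * x + deriv (deriv f) s / 2 * x\<^sup>2"
    if x: "\<bar>x\<bar> < \<delta>" for x
  proof (cases "x = 0")
    case False
    have "\<exists>t. (if x < 0 then x < t \<and> t < 0 else 0 < t \<and> t < x) \<and>
        f x = (\<Sum>m<2. D m 0 / fact m * (x - 0) ^ m) + D 2 t / fact 2 * (x - 0) ^ 2"
      using False x by (intro Taylor[where a="- \<bar>x\<bar>" and b="\<bar>x\<bar>"]) (auto intro!: D simp: D_def[of 0])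
    then obtain t where t: "if x < 0 then x < t \<and> t < 0 else 0 < t \<and> t < x"
        and "f x = (\<Sum>m<2. D m 0 / fact m * (x - 0) ^ m) + D 2 t / fact 2 * (x - 0) ^ 2"
      by blast
    moreover have "\<bar>t\<bar> \<le> \<bar>x\<bar>" using t by (auto split: if_splits)
    ultimately show ?thesis
      by (intro exI[of _ t]) (simp add: D_def numeral_2_eq_2)
  qed (auto intro: exI[of _ 0])
  obtain s t where "\<bar>s\<bar> \<le> \<bar>y\<bar>" "f y = f 0 + deriv f 0 * y + deriv (deriv f) s / 2 * y\<^sup>2"
    "\<bar>t\<bar> \<le> \<bar>- y\<bar>" "f (- y) = f 0 + deriv f 0 * (- y) + deriv (deriv f) t / 2 * (- y)\<^sup>2"
    using taylor[of y] taylor[of "- y"] y by auto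
  then show ?thesis
    by (intro that[of s t]) (auto simp: field_simps)
qed

lemma tendsto_kernel_bias:
  fixes f K :: "real \<Rightarrow> real"
  assumes [measurable]: "f \<in> borel_measurable borel" and bdd: "bounded (range f)"
    and \<delta>: "0 < \<delta>" and diff: "\<And>x. x \<in> ball 0 \<delta> \<Longrightarrow> f differentiable (at x) \<and> deriv f differentiable (at x)"
    and bdd2: "bounded (deriv (deriv f) ` ball 0 \<delta>)" and cont: "isCont (deriv (deriv f)) 0"
    and K: "\<And>u. 0 \<le> K u" "\<And>u. K (- u) = K u" "integrable lborel K" "(\<integral>u. K u \<partial>lborel) = 1"
      "integrable lborel (\<lambda>u. u\<^sup>2 * K u)"
    and b: "b \<longlonglongrightarrow> 0" and bpos: "\<forall>\<^sub>F n in sequentially. 0 < b n"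
  shows "(\<lambda>n. ((\<integral>u. K u * f (b n * u) \<partial>lborel) - f 0) / (b n)\<^sup>2)
    \<longlonglongrightarrow> deriv (deriv f) 0 * (\<integral>u. u\<^sup>2 * K u \<partial>lborel) / 2"
proof -
  have [measurable]: "K \<in> borel_measurable borel" using K(3) by simp
  define \<psi> where "\<psi> y = f y + f (- y) - 2 * f 0" for y
  have [measurable]: "\<psi> \<in> borel_measurable borel" unfolding \<psi>_def by measurable
  obtain B where B: "\<And>x. \<bar>f x\<bar> \<le> B"
    using bdd by (auto simp: bounded_iff)
  obtain B2 where B2: "\<And>x. x \<in> ball 0 \<delta> \<Longrightarrow> \<bar>deriv (deriv f) x\<bar> \<le> B2"
    using bdd2 unfolding bounded_iff real_norm_def by blast
  define C where "C = max B2 (4 * B / \<delta>\<^sup>2)"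
  have "0 \<le> B" using B[of 0] by linarith
  then have "0 \<le> 4 * B / \<delta>\<^sup>2" by simp
  then have C0: "0 \<le> C" by (simp add: C_def le_max_iff_disj)
  have \<psi>_le: "\<bar>\<psi> y\<bar> \<le> C * y\<^sup>2" for y
  proof (cases "\<bar>y\<bar> < \<delta>")
    case True
    then obtain s t where st: "\<bar>s\<bar> \<le> \<bar>y\<bar>" "\<bar>t\<bar> \<le> \<bar>y\<bar>"
      "\<psi> y = (deriv (deriv f) s + deriv (deriv f) t) / 2 * y\<^sup>2"
      using symmetric_second_difference[OF diff] unfolding \<psi>_def by metis
    have "\<bar>(deriv (deriv f) s + deriv (deriv f) t) / 2\<bar> \<le> C"
      using B2[of s] B2[of t] st True by (simp add: C_def)
    then have "\<bar>(deriv (deriv f) s + deriv (deriv f) t) / 2\<bar> * \<bar>y\<^sup>2\<bar> \<le> C * \<bar>y\<^sup>2\<bar>"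
      by (rule mult_right_mono) simp
    then show ?thesis
      unfolding st(3) abs_mult by simp
  next
    case False
    have "\<bar>\<psi> y\<bar> \<le> 4 * B"
      using B[of y] B[of "- y"] B[of 0] unfolding \<psi>_def by linarith
    also have "\<dots> = 4 * B / \<delta>\<^sup>2 * \<delta>\<^sup>2" using \<delta> by simp
    also have "\<dots> \<le> C * y\<^sup>2"
      using False \<delta> \<open>0 \<le> B\<close> by (intro mult_mono) (auto simp: C0 abs_le_square_iff[symmetric], simp add: C_def)
    finally show ?thesis .
  qed
  have \<psi>_lim: "(\<lambda>n. \<psi> (b n * u) / (b n)\<^sup>2) \<longlonglongrightarrow> deriv (deriv f) 0 * u\<^sup>2" for u
  proof (rule tendstoI)
    fix e :: real assume e: "0 < e"
    define r where "r = e / (u\<^sup>2 + 1)"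
    have r: "0 < r" using e by (simp add: r_def add_nonneg_pos)
    obtain d where d: "0 < d" "\<And>x. \<bar>x\<bar> < d \<Longrightarrow> \<bar>deriv (deriv f) x - deriv (deriv f) 0\<bar> < r"
      using cont[unfolded continuous_at_eps_delta, rule_format, OF r] by (auto simp: dist_real_def)
    have "(\<lambda>n. \<bar>b n * u\<bar>) \<longlonglongrightarrow> 0"
      by (intro tendsto_rabs_zero tendsto_mult_left_zero b)
    then have "\<forall>\<^sub>F n in sequentially. \<bar>b n * u\<bar> < min d \<delta>"
      using d \<delta> by (intro order_tendstoD(2)) auto
    then show "\<forall>\<^sub>F n in sequentially. dist (\<psi> (b n * u) / (b n)\<^sup>2) (deriv (deriv f) 0 * u\<^sup>2) < e"
      using bpos
    proof eventually_elim
      case (elim n)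
      then have "\<bar>b n * u\<bar> < \<delta>" by simp
      then obtain s t where st: "\<bar>s\<bar> \<le> \<bar>b n * u\<bar>" "\<bar>t\<bar> \<le> \<bar>b n * u\<bar>"
        "\<psi> (b n * u) = (deriv (deriv f) s + deriv (deriv f) t) / 2 * (b n * u)\<^sup>2"
        using symmetric_second_difference[OF diff] unfolding \<psi>_def by metis
      have "\<psi> (b n * u) / (b n)\<^sup>2 = (deriv (deriv f) s + deriv (deriv f) t) / 2 * u\<^sup>2"
        using elim by (simp add: st power_mult_distrib)
      then have "\<psi> (b n * u) / (b n)\<^sup>2 - deriv (deriv f) 0 * u\<^sup>2
          = ((deriv (deriv f) s + deriv (deriv f) t) / 2 - deriv (deriv f) 0) * u\<^sup>2"
        by (simp add: left_diff_distrib)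
      then have "dist (\<psi> (b n * u) / (b n)\<^sup>2) (deriv (deriv f) 0 * u\<^sup>2)
          = \<bar>(deriv (deriv f) s + deriv (deriv f) t) / 2 - deriv (deriv f) 0\<bar> * u\<^sup>2"
        by (simp add: dist_real_def abs_mult)
      also have "\<dots> \<le> r * u\<^sup>2"
      proof (rule mult_right_mono)
        have "\<bar>deriv (deriv f) s - deriv (deriv f) 0\<bar> < r" "\<bar>deriv (deriv f) t - deriv (deriv f) 0\<bar> < r"
          using st elim by (auto intro!: d(2))
        then show "\<bar>(deriv (deriv f) s + deriv (deriv f) t) / 2 - deriv (deriv f) 0\<bar> \<le> r"
          by (auto simp: abs_le_iff abs_less_iff field_simps)
      qed simp
      also have "\<dots> < r * (u\<^sup>2 + 1)" using r by simp
      also have "\<dots> = e" by (simp add: r_def add_nonneg_eq_0_iff)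
      finally show ?case .
    qed
  qed
  have i: "integrable lborel (\<lambda>u. K u * f (c * u))" for c
    by (rule Bochner_Integration.integrable_bound[OF integrable_mult_right[OF K(3), of B]])
      (use \<open>0 \<le> B\<close> B K(1) in \<open>auto intro!: AE_I2 mult_left_mono simp: abs_mult mult.commute[of B]\<close>)
  have split: "(\<integral>u. K u * f (c * u) \<partial>lborel) - f 0 = (\<integral>u. K u * \<psi> (c * u) \<partial>lborel) / 2" for c
  proof -
    have "(\<integral>u. K u * f (c * u) \<partial>lborel) = (\<integral>u. K u * f (- c * u) \<partial>lborel)"
      using lborel_integral_real_affine[of "-1" "\<lambda>u. K u * f (c * u)" 0] by (simp add: K(2))
    moreover have "(\<integral>u. K u * \<psi> (c * u) \<partial>lborel)
        = (\<integral>u. (K u * f (c * u) + K u * f (- c * u)) - K u * (2 * f 0) \<partial>lborel)"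
      by (simp add: \<psi>_def algebra_simps)
    moreover have "\<dots> = (\<integral>u. K u * f (c * u) \<partial>lborel) + (\<integral>u. K u * f (- c * u) \<partial>lborel) - 2 * f 0"
      using i[of c] i[of "- c"] K(3,4) by simp
    ultimately show ?thesis by simp
  qed
  have "(\<lambda>n. \<integral>u. K u * (\<psi> (b n * u) / (b n)\<^sup>2) \<partial>lborel) \<longlonglongrightarrow> (\<integral>u. K u * (deriv (deriv f) 0 * u\<^sup>2) \<partial>lborel)"
  proof (rule integral_dominated_convergence)
    show "integrable lborel (\<lambda>u. C * (u\<^sup>2 * K u))" using K(5) by simp
    show "AE u in lborel. (\<lambda>n. K u * (\<psi> (b n * u) / (b n)\<^sup>2)) \<longlonglongrightarrow> K u * (deriv (deriv f) 0 * u\<^sup>2)"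
      by (intro AE_I2 tendsto_mult tendsto_const \<psi>_lim)
    show "AE u in lborel. norm (K u * (\<psi> (b n * u) / (b n)\<^sup>2)) \<le> C * (u\<^sup>2 * K u)" for n
    proof (rule AE_I2)
      fix u
      have "\<bar>\<psi> (b n * u) / (b n)\<^sup>2\<bar> \<le> C * u\<^sup>2"
        using \<psi>_le[of "b n * u"] C0 by (cases "b n = 0") (auto simp: divide_le_eq power_mult_distrib mult_ac)
      then have "K u * \<bar>\<psi> (b n * u) / (b n)\<^sup>2\<bar> \<le> K u * (C * u\<^sup>2)"
        by (intro mult_left_mono K(1))
      then show "norm (K u * (\<psi> (b n * u) / (b n)\<^sup>2)) \<le> C * (u\<^sup>2 * K u)"
        by (simp only: real_norm_def abs_mult abs_of_nonneg[OF K(1)] mult_ac)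
    qed
  qed auto
  then have "(\<lambda>n. (\<integral>u. K u * (\<psi> (b n * u) / (b n)\<^sup>2) \<partial>lborel) / 2)
      \<longlonglongrightarrow> (\<integral>u. K u * (deriv (deriv f) 0 * u\<^sup>2) \<partial>lborel) / 2"
    by (rule tendsto_divide[OF _ tendsto_const]) simp
  moreover have "(\<integral>u. K u * (\<psi> (b n * u) / (b n)\<^sup>2) \<partial>lborel) / 2
      = ((\<integral>u. K u * f (b n * u) \<partial>lborel) - f 0) / (b n)\<^sup>2" for n
    unfolding split by simp
  moreover have "(\<integral>u. K u * (deriv (deriv f) 0 * u\<^sup>2) \<partial>lborel) = deriv (deriv f) 0 * (\<integral>u. u\<^sup>2 * K u \<partial>lborel)"
    by (subst integral_mult_right_zero[symmetric]) (simp add: mult_ac)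
  ultimately show ?thesis by simp
qed

section \<open>A central limit theorem with random weights\<close>

lemma (in prob_space) indep_var_compose_indep_set:
  assumes X: "X \<in> measurable M R" and \<Phi>: "\<Phi> \<in> measurable R S" and Y: "Y \<in> measurable M T"
    and indep: "indep_set (sets (vimage_algebra (space M) X R)) (sets (vimage_algebra (space M) Y T))"
  shows "indep_var S (\<lambda>w. \<Phi> (X w)) T Y"
  unfolding indep_var_eq sets_vimage_algebra[symmetric]
proof (intro conjI)
  show \<Phi>X: "(\<lambda>w. \<Phi> (X w)) \<in> measurable M S"
    using X \<Phi> by (rule measurable_compose)
  show "Y \<in> measurable M T" by (rule Y)
  have sub: "sets (vimage_algebra (space M) (\<lambda>w. \<Phi> (X w)) S) \<subseteq> sets (vimage_algebra (space M) X R)"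
  proof
    fix B assume "B \<in> sets (vimage_algebra (space M) (\<lambda>w. \<Phi> (X w)) S)"
    then obtain A where A: "A \<in> sets S" "B = (\<lambda>w. \<Phi> (X w)) -` A \<inter> space M"
      using sets_vimage_algebra2[of "\<lambda>w. \<Phi> (X w)" "space M" S] measurable_space[OF \<Phi>X] by auto
    then have "B = X -` (\<Phi> -` A \<inter> space R) \<inter> space M"
      using measurable_space[OF X] by auto
    moreover have "\<Phi> -` A \<inter> space R \<in> sets R"
      using \<Phi> A(1) by (rule measurable_sets)
    ultimately show "B \<in> sets (vimage_algebra (space M) X R)"
      by (simp only: in_vimage_algebra)
  qed
  have ev: "sets (vimage_algebra (space M) X R) \<subseteq> events" "sets (vimage_algebra (space M) Y T) \<subseteq> events"
    using indep unfolding indep_set_def indep_sets_def by (auto split: bool.splits)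
  show "indep_set (sets (vimage_algebra (space M) (\<lambda>w. \<Phi> (X w)) S)) (sets (vimage_algebra (space M) Y T))"
    using sub ev indep_setD[OF indep] by (intro indep_setI) blast+
qed

lemma exp_minus_linear_bound:
  fixes x :: real
  assumes x: "0 \<le> x"
  shows "\<bar>exp (- x) - (1 - x)\<bar> \<le> x * min 1 x"
proof -
  have 0: "1 - x \<le> exp (- x)" using exp_ge_add_one_self[of "- x"] by simp
  have 1: "exp (- x) \<le> 1" using x by simp
  have "(1 + x) * exp (- x) \<le> exp x * exp (- x)"
    by (rule mult_right_mono) (use exp_ge_add_one_self[of x] in auto)
  also have "\<dots> = 1" by (simp add: exp_minus)
  also have "1 \<le> (1 + x) * (1 - x + x * x)"
    using x by (simp add: algebra_simps)
  finally have 2: "exp (- x) \<le> 1 - x + x * x" using x by simp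
  show ?thesis using 0 1 2 x by (auto simp: min_def)
qed

locale independent_weights = prob_space M for M :: "'w measure" +
  fixes u V :: "nat \<Rightarrow> 'w \<Rightarrow> real"
  assumes indep: "indep_var (\<Pi>\<^sub>M i\<in>UNIV. borel) (\<lambda>w i. u i w) (\<Pi>\<^sub>M i\<in>UNIV. borel) (\<lambda>w i. V i w)"
    and V_indep: "indep_vars (\<lambda>_. borel) V UNIV"
    and V_id: "distr M borel (V i) = distr M borel (V 0)"
    and u_id: "distr M borel (u i) = distr M borel (u 0)"
    and u_L2: "integrable M (\<lambda>w. (u 0 w)\<^sup>2)"
begin

lemma u_V_measurable [measurable]: "u i \<in> borel_measurable M" "V i \<in> borel_measurable M"
proof -
  show "u i \<in> borel_measurable M"
    using measurable_compose[OF indep_var_rv1[OF indep] measurable_component_singleton[of i]] by simp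
  show "V i \<in> borel_measurable M"
    using measurable_compose[OF indep_var_rv2[OF indep] measurable_component_singleton[of i]] by simp
qed

lemma integral_V_id:
  fixes G :: "real \<Rightarrow> 'b::{banach, second_countable_topology}"
  assumes "G \<in> borel_measurable borel"
  shows "(\<integral>w. G (V i w) \<partial>M) = (\<integral>w. G (V 0 w) \<partial>M)"
  using integral_distr[of "V i" M borel G] integral_distr[of "V 0" M borel G] assms V_id[of i] by simp

lemma integral_u_id:
  fixes G :: "real \<Rightarrow> real"
  assumes "G \<in> borel_measurable borel"
  shows "(\<integral>w. G (u i w) \<partial>M) = (\<integral>w. G (u 0 w) \<partial>M)"
    and "integrable M (\<lambda>w. G (u i w)) \<longleftrightarrow> integrable M (\<lambda>w. G (u 0 w))"
  using integral_distr[of "u i" M borel G] integral_distr[of "u 0" M borel G]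
    integrable_distr_eq[of "u i" M borel G] integrable_distr_eq[of "u 0" M borel G] assms u_id[of i] by simp_all

lemma integrable_u_sq: "integrable M (\<lambda>w. (u i w)\<^sup>2)"
  using integral_u_id(2)[of "\<lambda>x. x\<^sup>2" i] u_L2 by simp

lemma integrable_u_mult: "integrable M (\<lambda>w. u i w * u j w)"
proof (rule Bochner_Integration.integrable_bound)
  show "integrable M (\<lambda>w. (u i w)\<^sup>2 + (u j w)\<^sup>2)"
    using integrable_u_sq by simp
  have "\<bar>a * b\<bar> \<le> a\<^sup>2 + b\<^sup>2" for a b :: real
  proof -
    have "0 \<le> \<bar>a\<bar> * \<bar>b\<bar>" "2 * \<bar>a\<bar> * \<bar>b\<bar> \<le> a\<^sup>2 + b\<^sup>2"
      using sum_squares_bound[of "\<bar>a\<bar>" "\<bar>b\<bar>"] by auto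
    then show ?thesis unfolding abs_mult by linarith
  qed
  then show "AE w in M. norm (u i w * u j w) \<le> norm ((u i w)\<^sup>2 + (u j w)\<^sup>2)"
    by (auto intro!: AE_I2 order_trans[OF _ abs_ge_self])
qed simp

context
  fixes \<xi> :: "real \<Rightarrow> real" and c :: real
  assumes \<xi> [measurable]: "\<xi> \<in> borel_measurable borel"
    and \<xi>_bound: "\<And>x. \<bar>\<xi> x\<bar> \<le> c"
    and \<xi>_mean: "(\<integral>w. \<xi> (V 0 w) \<partial>M) = 0"
begin

lemma integrable_\<xi>: "integrable M (\<lambda>w. \<xi> (V i w))" "integrable M (\<lambda>w. (\<xi> (V i w))\<^sup>2)"
  "integrable M (\<lambda>w. \<xi> (V i w) * \<xi> (V j w))"
proof -
  have c: "0 \<le> c" using \<xi>_bound[of 0] by linarith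
  have "\<bar>\<xi> x * \<xi> y\<bar> \<le> c * c" for x y
    unfolding abs_mult using c by (intro mult_mono \<xi>_bound) auto
  then show 1: "integrable M (\<lambda>w. \<xi> (V i w) * \<xi> (V j w))" for i j
    by (intro integrable_const_bound[of _ "c * c"]) auto
  show "integrable M (\<lambda>w. \<xi> (V i w))"
    using \<xi>_bound by (intro integrable_const_bound[of _ c]) auto
  show "integrable M (\<lambda>w. (\<xi> (V i w))\<^sup>2)"
    using 1[of i i] by (simp add: power2_eq_square)
qed

lemma expectation_weighted_sum_sq:
  "integrable M (\<lambda>w. (\<Sum>i<n. \<xi> (V i w) * u i w)\<^sup>2)"
  "(\<integral>w. (\<Sum>i<n. \<xi> (V i w) * u i w)\<^sup>2 \<partial>M)
    = real n * (\<integral>w. (\<xi> (V 0 w))\<^sup>2 \<partial>M) * (\<integral>w. (u 0 w)\<^sup>2 \<partial>M)"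
proof -
  have prod: "integrable M (\<lambda>w. (u i w * u j w) * (\<xi> (V i w) * \<xi> (V j w)))"
    "(\<integral>w. (u i w * u j w) * (\<xi> (V i w) * \<xi> (V j w)) \<partial>M)
      = (\<integral>w. u i w * u j w \<partial>M) * (\<integral>w. \<xi> (V i w) * \<xi> (V j w) \<partial>M)" for i j
  proof -
    have "indep_var borel ((\<lambda>z. z i * z j) \<circ> (\<lambda>w i. u i w)) borel ((\<lambda>z. \<xi> (z i) * \<xi> (z j)) \<circ> (\<lambda>w i. V i w))"
      by (rule indep_var_compose[OF indep]) measurable
    then have iv: "indep_var borel (\<lambda>w. u i w * u j w) borel (\<lambda>w. \<xi> (V i w) * \<xi> (V j w))"
      by (simp add: comp_def)
    show "integrable M (\<lambda>w. (u i w * u j w) * (\<xi> (V i w) * \<xi> (V j w)))"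
      by (rule indep_var_integrable[OF iv integrable_u_mult integrable_\<xi>(3)])
    show "(\<integral>w. (u i w * u j w) * (\<xi> (V i w) * \<xi> (V j w)) \<partial>M)
      = (\<integral>w. u i w * u j w \<partial>M) * (\<integral>w. \<xi> (V i w) * \<xi> (V j w) \<partial>M)"
      by (rule indep_var_lebesgue_integral[OF iv integrable_u_mult integrable_\<xi>(3)])
  qed
  have off: "(\<integral>w. \<xi> (V i w) * \<xi> (V j w) \<partial>M) = 0" if "i \<noteq> j" for i j
  proof -
    have "indep_vars (\<lambda>_. borel) (\<lambda>i w. \<xi> (V i w)) {i, j}"
      by (rule indep_vars_compose2[OF indep_vars_subset[OF V_indep]]) auto
    then have "(\<integral>w. (\<Prod>k\<in>{i, j}. \<xi> (V k w)) \<partial>M) = (\<Prod>k\<in>{i, j}. \<integral>w. \<xi> (V k w) \<partial>M)"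
      by (intro indep_vars_lebesgue_integral) (auto intro: integrable_\<xi>)
    then show ?thesis
      using that integral_V_id[of \<xi>] \<xi>_mean by simp
  qed
  have diag: "(\<integral>w. \<xi> (V i w) * \<xi> (V i w) \<partial>M) = (\<integral>w. (\<xi> (V 0 w))\<^sup>2 \<partial>M)"
    "(\<integral>w. u i w * u i w \<partial>M) = (\<integral>w. (u 0 w)\<^sup>2 \<partial>M)" for i
    using integral_V_id[of "\<lambda>x. (\<xi> x)\<^sup>2" i] integral_u_id(1)[of "\<lambda>x. x\<^sup>2" i] by (simp_all add: power2_eq_square)
  have sq: "(\<Sum>i<n. \<xi> (V i w) * u i w)\<^sup>2 = (\<Sum>i<n. \<Sum>j<n. (u i w * u j w) * (\<xi> (V i w) * \<xi> (V j w)))" for w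
    by (simp add: power2_eq_square sum_product mult_ac)
  show "integrable M (\<lambda>w. (\<Sum>i<n. \<xi> (V i w) * u i w)\<^sup>2)"
    unfolding sq by (intro Bochner_Integration.integrable_sum prod)
  have "(\<integral>w. (\<Sum>i<n. \<xi> (V i w) * u i w)\<^sup>2 \<partial>M)
      = (\<Sum>i<n. \<Sum>j<n. (\<integral>w. u i w * u j w \<partial>M) * (\<integral>w. \<xi> (V i w) * \<xi> (V j w) \<partial>M))"
    unfolding sq using prod
    by (subst Bochner_Integration.integral_sum, intro Bochner_Integration.integrable_sum prod)
      (intro sum.cong refl, subst Bochner_Integration.integral_sum, auto)
  also have "\<dots> = (\<Sum>i<n. \<Sum>j<n. if j = i then (\<integral>w. (u 0 w)\<^sup>2 \<partial>M) * (\<integral>w. (\<xi> (V 0 w))\<^sup>2 \<partial>M) else 0)"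
    by (intro sum.cong refl) (auto simp: off diag)
  also have "\<dots> = real n * (\<integral>w. (\<xi> (V 0 w))\<^sup>2 \<partial>M) * (\<integral>w. (u 0 w)\<^sup>2 \<partial>M)"
    by simp
  finally show "(\<integral>w. (\<Sum>i<n. \<xi> (V i w) * u i w)\<^sup>2 \<partial>M)
    = real n * (\<integral>w. (\<xi> (V 0 w))\<^sup>2 \<partial>M) * (\<integral>w. (u 0 w)\<^sup>2 \<partial>M)" .
qed

definition weight_char :: "real \<Rightarrow> complex" where
  "weight_char s = char (distr M borel (\<lambda>w. \<xi> (V 0 w))) s"

lemma weight_char_eq: "weight_char s = (\<integral>w. iexp (s * \<xi> (V 0 w)) \<partial>M)"
  unfolding weight_char_def char_def by (subst integral_distr) auto

lemma weight_char_measurable [measurable]: "weight_char \<in> borel_measurable borel"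
  unfolding weight_char_def[abs_def] by (intro real_distribution.char_measurable real_distribution_distr) simp

lemma weight_char_le_1: "norm (weight_char s) \<le> 1"
  unfolding weight_char_def by (intro real_distribution.cmod_char_le_1 real_distribution_distr) simp

lemma expectation_iexp_weighted_sum:
  "(\<integral>w. iexp (\<Sum>i<n. \<xi> (V i w) * u i w) \<partial>M) = (\<integral>w. (\<Prod>i<n. weight_char (u i w)) \<partial>M)"
proof -
  let ?P = "\<Pi>\<^sub>M i\<in>(UNIV :: nat set). (borel :: real measure)"
  let ?PU = "distr M ?P (\<lambda>w i. u i w)" and ?PV = "distr M ?P (\<lambda>w i. V i w)"
  note rv [measurable] = indep_var_rv1[OF indep] indep_var_rv2[OF indep]
  interpret PU: prob_space ?PU by (rule prob_space_distr) (rule rv)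
  interpret PV: prob_space ?PV by (rule prob_space_distr) (rule rv)
  interpret P: pair_prob_space ?PU ?PV ..
  define F where "F a b = iexp (\<Sum>i<n. \<xi> (b i) * a i)" for a b :: "nat \<Rightarrow> real"
  have F [measurable]: "(\<lambda>(a, b). F a b) \<in> borel_measurable (?P \<Otimes>\<^sub>M ?P)"
    unfolding F_def by measurable
  have intF: "integrable (?PU \<Otimes>\<^sub>M ?PV) (\<lambda>(a, b). F a b)"
    by (intro P.P.integrable_const_bound[of _ 1]) (auto simp: F_def)
  have inner: "(\<integral>b. F a b \<partial>?PV) = (\<Prod>i<n. weight_char (a i))" for a
  proof -
    have "(\<integral>b. F a b \<partial>?PV) = (\<integral>w. F a (\<lambda>i. V i w) \<partial>M)"
      by (rule integral_distr) (unfold F_def, measurable)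
    also have "\<dots> = (\<integral>w. (\<Prod>i<n. iexp (a i * \<xi> (V i w))) \<partial>M)"
      by (simp add: F_def sum_distrib_left exp_sum mult_ac)
    also have "\<dots> = (\<Prod>i<n. \<integral>w. iexp (a i * \<xi> (V i w)) \<partial>M)"
    proof (rule indep_vars_lebesgue_integral)
      show "indep_vars (\<lambda>_. borel) (\<lambda>i w. iexp (a i * \<xi> (V i w))) {..<n}"
        by (rule indep_vars_compose2[OF indep_vars_subset[OF V_indep]]) auto
    qed (auto intro!: integrable_iexp)
    also have "\<dots> = (\<Prod>i<n. weight_char (a i))"
      unfolding weight_char_eq by (intro prod.cong refl integral_V_id[of "\<lambda>x. iexp (_ * \<xi> x)"]) simp
    finally show ?thesis .
  qed
  have "(\<integral>w. iexp (\<Sum>i<n. \<xi> (V i w) * u i w) \<partial>M) = (\<integral>w. (\<lambda>(a, b). F a b) (\<lambda>i. u i w, \<lambda>i. V i w) \<partial>M)"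
    by (simp add: F_def)
  also have "\<dots> = (\<integral>p. (\<lambda>(a, b). F a b) p \<partial>distr M (?P \<Otimes>\<^sub>M ?P) (\<lambda>w. (\<lambda>i. u i w, \<lambda>i. V i w)))"
    by (rule integral_distr[symmetric]) measurable
  also have "distr M (?P \<Otimes>\<^sub>M ?P) (\<lambda>w. (\<lambda>i. u i w, \<lambda>i. V i w)) = ?PU \<Otimes>\<^sub>M ?PV"
    using indep unfolding indep_var_distribution_eq by simp
  also have "(\<integral>p. (\<lambda>(a, b). F a b) p \<partial>(?PU \<Otimes>\<^sub>M ?PV)) = (\<integral>a. (\<integral>b. F a b \<partial>?PV) \<partial>?PU)"
    using P.integral_fst'[OF intF] by simp
  also have "\<dots> = (\<integral>a. (\<Prod>i<n. weight_char (a i)) \<partial>?PU)"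
    unfolding inner ..
  also have "\<dots> = (\<integral>w. (\<Prod>i<n. weight_char (u i w)) \<partial>M)"
    by (rule integral_distr) measurable
  finally show ?thesis .
qed

lemma weight_char_approx:
  defines "v \<equiv> \<integral>w. (\<xi> (V 0 w))\<^sup>2 \<partial>M"
  shows "norm (weight_char s - of_real (exp (- (s\<^sup>2 * v / 2))))
    \<le> v * (s\<^sup>2 * (min 1 (\<bar>s\<bar> * c) + min 1 (s\<^sup>2 * v)))"
proof -
  have v: "0 \<le> v" by (simp add: v_def)
  have c: "0 \<le> c" using \<xi>_bound[of 0] by linarith
  have "norm (weight_char s - complex_of_real (1 - s\<^sup>2 * v / 2))
      \<le> (s\<^sup>2 / 6) * expectation (\<lambda>w. min (6 * (\<xi> (V 0 w))\<^sup>2) (\<bar>s\<bar> * \<bar>\<xi> (V 0 w)\<bar> ^ 3))"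
    unfolding weight_char_def
    by (rule order_trans[OF _ char_approx3']) (use \<xi>_mean integrable_\<xi>[of 0] in \<open>auto simp: v_def\<close>)
  also have "\<dots> \<le> (s\<^sup>2 / 6) * expectation (\<lambda>w. (6 * min 1 (\<bar>s\<bar> * c)) * (\<xi> (V 0 w))\<^sup>2)"
  proof (intro mult_left_mono integral_mono)
    have le: "min (6 * x\<^sup>2) (\<bar>s\<bar> * \<bar>x\<bar> ^ 3) \<le> 6 * min 1 (\<bar>s\<bar> * c) * x\<^sup>2" if x: "\<bar>x\<bar> \<le> c" for x
    proof -
      have "\<bar>s\<bar> * \<bar>x\<bar> ^ 3 = (\<bar>s\<bar> * \<bar>x\<bar>) * x\<^sup>2"
        by (simp add: power3_eq_cube power2_eq_square)
      also have "\<dots> \<le> (\<bar>s\<bar> * c) * x\<^sup>2"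
        using x by (intro mult_right_mono mult_left_mono) auto
      also have "\<dots> \<le> 6 * (\<bar>s\<bar> * c) * x\<^sup>2"
        using c by (intro mult_right_mono) auto
      finally show ?thesis by (auto simp: min_def)
    qed
    then show "min (6 * (\<xi> (V 0 w))\<^sup>2) (\<bar>s\<bar> * \<bar>\<xi> (V 0 w)\<bar> ^ 3) \<le> 6 * min 1 (\<bar>s\<bar> * c) * (\<xi> (V 0 w))\<^sup>2" for w
      using \<xi>_bound by blast
    show "integrable M (\<lambda>w. min (6 * (\<xi> (V 0 w))\<^sup>2) (\<bar>s\<bar> * \<bar>\<xi> (V 0 w)\<bar> ^ 3))"
      by (rule Bochner_Integration.integrable_bound[OF integrable_mult_right[OF integrable_\<xi>(2)[of 0], of 6]])
        (auto intro!: AE_I2 simp: abs_of_nonneg)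
  qed (use integrable_\<xi>(2) in auto)
  also have "\<dots> = v * (s\<^sup>2 * min 1 (\<bar>s\<bar> * c))"
    by (simp add: v_def)
  finally have 1: "norm (weight_char s - complex_of_real (1 - s\<^sup>2 * v / 2)) \<le> v * (s\<^sup>2 * min 1 (\<bar>s\<bar> * c))" .
  have "norm (complex_of_real (exp (- (s\<^sup>2 * v / 2))) - complex_of_real (1 - s\<^sup>2 * v / 2))
      = \<bar>exp (- (s\<^sup>2 * v / 2)) - (1 - s\<^sup>2 * v / 2)\<bar>"
    by (subst norm_of_real[symmetric, where ?'a = complex]) simp
  also have "\<dots> \<le> (s\<^sup>2 * v / 2) * min 1 (s\<^sup>2 * v / 2)"
    using v by (intro exp_minus_linear_bound) simp
  also have "\<dots> \<le> (s\<^sup>2 * v) * min 1 (s\<^sup>2 * v)"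
    using v by (intro mult_mono) (auto simp: min_def)
  finally have 2: "norm (complex_of_real (exp (- (s\<^sup>2 * v / 2))) - complex_of_real (1 - s\<^sup>2 * v / 2)) \<le> v * (s\<^sup>2 * min 1 (s\<^sup>2 * v))"
    by (simp add: mult_ac)
  have "norm (weight_char s - of_real (exp (- (s\<^sup>2 * v / 2))))
      \<le> norm (weight_char s - complex_of_real (1 - s\<^sup>2 * v / 2)) + norm (complex_of_real (exp (- (s\<^sup>2 * v / 2))) - complex_of_real (1 - s\<^sup>2 * v / 2))"
    using dist_triangle2[of "weight_char s" "complex_of_real (exp (- (s\<^sup>2 * v / 2)))" "complex_of_real (1 - s\<^sup>2 * v / 2)"]
    by (simp only: dist_norm)
  also have "\<dots> \<le> v * (s\<^sup>2 * (min 1 (\<bar>s\<bar> * c) + min 1 (s\<^sup>2 * v)))"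
    using 1 2 by (simp add: distrib_left)
  finally show ?thesis .
qed

lemma expectation_iexp_approx:
  defines "v \<equiv> \<integral>w. (\<xi> (V 0 w))\<^sup>2 \<partial>M"
  shows "norm ((\<integral>w. iexp (\<Sum>i<n. \<xi> (V i w) * u i w) \<partial>M) - of_real (\<integral>w. exp (- (v * (\<Sum>i<n. (u i w)\<^sup>2) / 2)) \<partial>M))
    \<le> real n * v * (\<integral>w. (u 0 w)\<^sup>2 * (min 1 (\<bar>u 0 w\<bar> * c) + min 1 ((u 0 w)\<^sup>2 * v)) \<partial>M)"
proof -
  have v: "0 \<le> v" by (simp add: v_def)
  have c: "0 \<le> c" using \<xi>_bound[of 0] by linarith
  let ?R = "\<lambda>x. x\<^sup>2 * (min 1 (\<bar>x\<bar> * c) + min 1 (x\<^sup>2 * v))"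
  have R: "integrable M (\<lambda>w. ?R (u i w))" for i
  proof (rule Bochner_Integration.integrable_bound[OF integrable_mult_right[OF integrable_u_sq[of i], of 2]])
    have "\<bar>?R x\<bar> \<le> 2 * x\<^sup>2" for x
    proof -
      have "0 \<le> min 1 (\<bar>x\<bar> * c) + min 1 (x\<^sup>2 * v)" using v c by simp
      then have "\<bar>?R x\<bar> = ?R x" by simp
      also have "\<dots> \<le> x\<^sup>2 * 2" by (intro mult_left_mono) auto
      finally show ?thesis by simp
    qed
    then show "AE w in M. norm (?R (u i w)) \<le> norm (2 * (u i w)\<^sup>2)" by simp
  qed simp
  have pe: "(\<Prod>i<n. of_real (exp (- ((u i w)\<^sup>2 * v / 2)))) = (of_real (exp (- (v * (\<Sum>i<n. (u i w)\<^sup>2) / 2))) :: complex)" for w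
    by (simp add: exp_sum[symmetric] sum_negf sum_distrib_left sum_divide_distrib mult_ac flip: of_real_prod)
  have bound: "norm ((\<Prod>i<n. weight_char (u i w)) - of_real (exp (- (v * (\<Sum>i<n. (u i w)\<^sup>2) / 2)))) \<le> (\<Sum>i<n. v * ?R (u i w))" for w
  proof -
    have "norm ((\<Prod>i<n. weight_char (u i w)) - (\<Prod>i<n. of_real (exp (- ((u i w)\<^sup>2 * v / 2)))))
        \<le> (\<Sum>i<n. norm (weight_char (u i w) - of_real (exp (- ((u i w)\<^sup>2 * v / 2)))))"
      by (rule norm_prod_diff) (use v in \<open>auto simp: weight_char_le_1\<close>)
    also have "\<dots> \<le> (\<Sum>i<n. v * ?R (u i w))"
      unfolding v_def by (intro sum_mono weight_char_approx)
    finally show ?thesis unfolding pe .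
  qed
  have i1: "integrable M (\<lambda>w. \<Prod>i<n. weight_char (u i w))"
    by (intro integrable_const_bound[of _ 1]) (auto intro!: AE_I2 prod_le_1 simp: weight_char_le_1 simp flip: prod_norm)
  have i2: "integrable M (\<lambda>w. of_real (exp (- (v * (\<Sum>i<n. (u i w)\<^sup>2) / 2))) :: complex)"
    using v by (intro integrable_const_bound[of _ 1]) (auto intro!: AE_I2 mult_nonneg_nonneg sum_nonneg)
  have "norm ((\<integral>w. iexp (\<Sum>i<n. \<xi> (V i w) * u i w) \<partial>M) - of_real (\<integral>w. exp (- (v * (\<Sum>i<n. (u i w)\<^sup>2) / 2)) \<partial>M))
      = norm (\<integral>w. (\<Prod>i<n. weight_char (u i w)) - of_real (exp (- (v * (\<Sum>i<n. (u i w)\<^sup>2) / 2))) \<partial>M)"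
    unfolding expectation_iexp_weighted_sum integral_complex_of_real[symmetric]
    by (subst Bochner_Integration.integral_diff[OF i1 i2]) simp
  also have "\<dots> \<le> (\<integral>w. norm ((\<Prod>i<n. weight_char (u i w)) - of_real (exp (- (v * (\<Sum>i<n. (u i w)\<^sup>2) / 2)))) \<partial>M)"
    by (rule integral_norm_bound)
  also have "\<dots> \<le> (\<integral>w. (\<Sum>i<n. v * ?R (u i w)) \<partial>M)"
    by (rule integral_mono) (use R i1 i2 in \<open>auto intro!: bound\<close>)
  also have "\<dots> = (\<Sum>i<n. v * (\<integral>w. ?R (u i w) \<partial>M))"
    using R by (subst Bochner_Integration.integral_sum) auto
  also have "\<dots> = (\<Sum>i<n. v * (\<integral>w. ?R (u 0 w) \<partial>M))"
    by (intro sum.cong refl arg_cong[of _ _ "(*) v"] integral_u_id(1)[of ?R]) simp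
  also have "\<dots> = real n * v * (\<integral>w. ?R (u 0 w) \<partial>M)"
    by simp
  finally show ?thesis .
qed

end

theorem weighted_clt:
  fixes \<xi> :: "nat \<Rightarrow> real \<Rightarrow> real"
  assumes lln: "AE w in M. (\<lambda>n. (\<Sum>i<n. (u i w)\<^sup>2) / real n) \<longlonglongrightarrow> (\<integral>w. (u 0 w)\<^sup>2 \<partial>M)"
    and \<xi>: "\<And>n. \<xi> n \<in> borel_measurable borel"
    and bound: "\<forall>\<^sub>F n in sequentially. \<forall>x. \<bar>\<xi> n x\<bar> \<le> c n" and c: "c \<longlonglongrightarrow> 0"
    and mean: "\<forall>\<^sub>F n in sequentially. (\<integral>w. \<xi> n (V 0 w) \<partial>M) = 0"
    and var: "(\<lambda>n. real n * (\<integral>w. (\<xi> n (V 0 w))\<^sup>2 \<partial>M)) \<longlonglongrightarrow> v"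
  shows "(\<lambda>n. \<integral>w. iexp (\<Sum>i<n. \<xi> n (V i w) * u i w) \<partial>M)
    \<longlonglongrightarrow> of_real (exp (- (v * (\<integral>w. (u 0 w)\<^sup>2 \<partial>M) / 2)))"
proof -
  define vn where "vn n = (\<integral>w. (\<xi> n (V 0 w))\<^sup>2 \<partial>M)" for n
  let ?m = "\<integral>w. (u 0 w)\<^sup>2 \<partial>M"
  have vn_pos: "0 \<le> vn n" for n by (simp add: vn_def)
  have nvn: "(\<lambda>n. real n * vn n) \<longlonglongrightarrow> v" using var by (simp add: vn_def)
  have "(\<lambda>n. (real n * vn n) * inverse (real n)) \<longlonglongrightarrow> 0"
    using tendsto_mult[OF nvn lim_inverse_n] by simp
  then have vn0: "vn \<longlonglongrightarrow> 0"
    by (rule Lim_transform_eventually) (auto simp: eventually_sequentially field_simps intro!: exI[of _ 1])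
  have c0: "\<forall>\<^sub>F n in sequentially. 0 \<le> c n"
    using bound by eventually_elim (meson abs_ge_zero order_trans)
  have "(\<lambda>n. \<integral>w. exp (- (vn n * (\<Sum>i<n. (u i w)\<^sup>2) / 2)) \<partial>M) \<longlonglongrightarrow> (\<integral>w. exp (- (v * ?m / 2)) \<partial>M)"
  proof (rule integral_dominated_convergence[where w="\<lambda>_. 1"])
    show "AE w in M. (\<lambda>n. exp (- (vn n * (\<Sum>i<n. (u i w)\<^sup>2) / 2))) \<longlonglongrightarrow> exp (- (v * ?m / 2))"
      using lln
    proof eventually_elim
      case (elim w)
      have "(\<lambda>n. exp (- ((real n * vn n) * ((\<Sum>i<n. (u i w)\<^sup>2) / real n) / 2))) \<longlonglongrightarrow> exp (- (v * ?m / 2))"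
        by (intro tendsto_intros nvn elim) simp
      then show ?case
        by (rule Lim_transform_eventually) (auto simp: eventually_sequentially intro!: exI[of _ 1])
    qed
    show "AE w in M. norm (exp (- (vn n * (\<Sum>i<n. (u i w)\<^sup>2) / 2))) \<le> 1" for n
      using vn_pos by (auto intro!: AE_I2 mult_nonneg_nonneg sum_nonneg)
  qed auto
  then have main: "(\<lambda>n. of_real (\<integral>w. exp (- (vn n * (\<Sum>i<n. (u i w)\<^sup>2) / 2)) \<partial>M)) \<longlonglongrightarrow> (of_real (exp (- (v * ?m / 2))) :: complex)"
    by (simp add: prob_space tendsto_of_real_iff)
  have "(\<lambda>n. \<integral>w. (u 0 w)\<^sup>2 * (min 1 (\<bar>u 0 w\<bar> * \<bar>c n\<bar>) + min 1 ((u 0 w)\<^sup>2 * vn n)) \<partial>M) \<longlonglongrightarrow> (\<integral>w. 0 \<partial>M)"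
  proof (rule integral_dominated_convergence[where w="\<lambda>w. 2 * (u 0 w)\<^sup>2"])
    show "AE w in M. (\<lambda>n. (u 0 w)\<^sup>2 * (min 1 (\<bar>u 0 w\<bar> * \<bar>c n\<bar>) + min 1 ((u 0 w)\<^sup>2 * vn n))) \<longlonglongrightarrow> 0"
    proof (rule AE_I2)
      fix w
      have "(\<lambda>n. (u 0 w)\<^sup>2 * (min 1 (\<bar>u 0 w\<bar> * \<bar>c n\<bar>) + min 1 ((u 0 w)\<^sup>2 * vn n)))
        \<longlonglongrightarrow> (u 0 w)\<^sup>2 * (min 1 (\<bar>u 0 w\<bar> * 0) + min 1 ((u 0 w)\<^sup>2 * 0))"
        by (intro tendsto_intros tendsto_rabs_zero c vn0)
      then show "(\<lambda>n. (u 0 w)\<^sup>2 * (min 1 (\<bar>u 0 w\<bar> * \<bar>c n\<bar>) + min 1 ((u 0 w)\<^sup>2 * vn n))) \<longlonglongrightarrow> 0"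
        by simp
    qed
    show "AE w in M. norm ((u 0 w)\<^sup>2 * (min 1 (\<bar>u 0 w\<bar> * \<bar>c n\<bar>) + min 1 ((u 0 w)\<^sup>2 * vn n))) \<le> 2 * (u 0 w)\<^sup>2" for n
    proof (rule AE_I2)
      fix w
      have "\<bar>min 1 (\<bar>u 0 w\<bar> * \<bar>c n\<bar>) + min 1 ((u 0 w)\<^sup>2 * vn n)\<bar> \<le> 2"
        using vn_pos[of n] by (simp add: abs_le_iff)
      from mult_left_mono[OF this, of "(u 0 w)\<^sup>2"]
      show "norm ((u 0 w)\<^sup>2 * (min 1 (\<bar>u 0 w\<bar> * \<bar>c n\<bar>) + min 1 ((u 0 w)\<^sup>2 * vn n))) \<le> 2 * (u 0 w)\<^sup>2"
        by (simp add: abs_mult mult.commute)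
    qed
  qed (use u_L2 in auto)
  from tendsto_mult[OF nvn this]
  have err: "(\<lambda>n. real n * vn n * (\<integral>w. (u 0 w)\<^sup>2 * (min 1 (\<bar>u 0 w\<bar> * \<bar>c n\<bar>) + min 1 ((u 0 w)\<^sup>2 * vn n)) \<partial>M)) \<longlonglongrightarrow> 0"
    by simp
  have "\<forall>\<^sub>F n in sequentially. norm ((\<integral>w. iexp (\<Sum>i<n. \<xi> n (V i w) * u i w) \<partial>M)
      - of_real (\<integral>w. exp (- (vn n * (\<Sum>i<n. (u i w)\<^sup>2) / 2)) \<partial>M))
    \<le> real n * vn n * (\<integral>w. (u 0 w)\<^sup>2 * (min 1 (\<bar>u 0 w\<bar> * \<bar>c n\<bar>) + min 1 ((u 0 w)\<^sup>2 * vn n)) \<partial>M)"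
    using bound mean c0
  proof eventually_elim
    case (elim n)
    then show ?case
      using expectation_iexp_approx[of "\<xi> n" "c n" n] \<xi> by (simp add: vn_def)
  qed
  from Lim_transform[OF main Lim_null_comparison[OF this err]] show ?thesis .
qed

end

section \<open>The law of large numbers for stationary ergodic processes\<close>

lemma (in prob_space) stationary_process_lln:
  fixes Z :: "nat \<Rightarrow> 'a \<Rightarrow> 'b::topological_space" and \<phi> :: "'b \<Rightarrow> real"
  assumes stat: "stationary_process M Z" and erg: "ergodic_process M Z"
    and \<phi> [measurable]: "\<phi> \<in> borel_measurable borel" and int: "integrable M (\<lambda>w. \<phi> (Z 0 w))"
  shows "AE w in M. (\<lambda>n. (\<Sum>i<n. \<phi> (Z i w)) / real n) \<longlonglongrightarrow> (\<integral>w. \<phi> (Z 0 w) \<partial>M)"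
proof -
  let ?S = "\<Pi>\<^sub>M i\<in>(UNIV :: nat set). (borel :: 'b measure)"
  let ?T = "\<lambda>z :: nat \<Rightarrow> 'b. \<lambda>i. z (Suc i)"
  have [measurable]: "Z i \<in> borel_measurable M" for i
    using stat by (simp add: stationary_process_def)
  have Zm [measurable]: "(\<lambda>w i. Z i w) \<in> measurable M ?S"
    by (rule measurable_PiM_single') (auto simp: space_PiM)
  have T [measurable]: "?T \<in> measurable ?S ?S"
    by (rule measurable_PiM_single') (auto simp: space_PiM)
  define P where "P = distr M ?S (\<lambda>w i. Z i w)"
  have setsP [measurable_cong]: "sets P = sets ?S" by (simp add: P_def)
  interpret P: prob_space P unfolding P_def by (rule prob_space_distr) simp
  interpret P: ergodic_transformation P ?T
  proof
    show "?T \<in> measurable P P" unfolding P_def by simp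
    have "distr P P ?T = distr P ?S ?T" by (rule distr_cong) (auto simp: setsP)
    also have "\<dots> = distr M ?S (\<lambda>w i. Z (i + 1) w)"
      unfolding P_def by (subst distr_distr) (auto simp: comp_def)
    also have "\<dots> = P"
      using stat unfolding stationary_process_def P_def by blast
    finally show "distr P P ?T = P" .
    fix A assume A: "A \<in> sets P" "?T -` A \<inter> space P = A"
    have "measure P A = measure M {w \<in> space M. (\<lambda>i. Z i w) \<in> A}"
      using A(1) unfolding setsP unfolding P_def
      by (subst measure_distr) (auto intro!: arg_cong[of _ _ prob])
    moreover have "{z. ?T z \<in> A} = A"
      using A(2) by (auto simp: P_def space_PiM)
    ultimately show "measure P A \<in> {0, 1}"
      using erg A(1) unfolding setsP ergodic_process_def by auto
  qed
  have iterate: "(?T ^^ i) z = (\<lambda>j. z (j + i))" for i z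
    by (induction i arbitrary: z) (auto simp: funpow_swap1)
  have int': "integrable P (\<lambda>z. \<phi> (z 0))" and exp: "(\<integral>z. \<phi> (z 0) \<partial>P) = (\<integral>w. \<phi> (Z 0 w) \<partial>M)"
    using int unfolding P_def by (auto simp: integrable_distr_eq integral_distr)
  have "AE z in P. (\<lambda>n. birkhoff_sum ?T (\<lambda>z. \<phi> (z 0)) n z / real n) \<longlonglongrightarrow> (\<integral>w. \<phi> (Z 0 w) \<partial>M)"
    using P.birkhoff[OF int'] unfolding exp .
  from AE_distrD[OF Zm this[unfolded P_def]] show ?thesis
    by (simp add: birkhoff_sum_def iterate)
qed

lemma stationary_process_distr:
  fixes Z :: "nat \<Rightarrow> 'w \<Rightarrow> 'b::topological_space"
  assumes "stationary_process M Z"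
  shows "distr M borel (Z i) = distr M borel (Z 0)"
proof -
  let ?S = "\<Pi>\<^sub>M i\<in>(UNIV :: nat set). (borel :: 'b measure)"
  have [measurable]: "Z i \<in> borel_measurable M" for i
    using assms by (simp add: stationary_process_def)
  have Zm: "(\<lambda>w j. Z (j + k) w) \<in> measurable M ?S" for k
    by (rule measurable_PiM_single') (auto simp: space_PiM)
  have eq: "distr (distr M ?S (\<lambda>w j. Z (j + k) w)) borel (\<lambda>z. z 0) = distr M borel (Z k)" for k
    using Zm[of k] by (subst distr_distr) (auto simp: comp_def)
  show ?thesis
    using assms eq[of i] eq[of 0] unfolding stationary_process_def by simp
qed

section \<open>Kernel-weighted moment estimators\<close>

lemma inner_outer: "t \<bullet> (outer v w *v s) = (t \<bullet> v) * (w \<bullet> s)"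
  by (simp add: outer_def matrix_vector_mult_def inner_vec_def sum_distrib_left sum_distrib_right mult_ac)
    (rule sum.swap)

lemma transpose_outer: "transpose (outer v v) = outer v v"
  by (simp add: vec_eq_iff outer_def transpose_def mult.commute)

lemma norm_outer: "norm (outer v w) = norm v * norm w"
proof -
  have "outer v w $ i = v $ i *\<^sub>R w" for i
    by (simp add: outer_def vec_eq_iff)
  then show ?thesis
    by (simp add: norm_vec_def[of "outer v w"] norm_vec_def[of v] L2_set_left_distrib)
qed

lemma borel_measurable_outer [measurable (raw)]:
  assumes [measurable]: "v \<in> borel_measurable N" "w \<in> borel_measurable N"
  shows "(\<lambda>x. outer (v x :: real ^ 'a) (w x :: real ^ 'b)) \<in> borel_measurable N"
proof -
  have "continuous_on UNIV (\<lambda>(v :: real ^ 'a, w :: real ^ 'b). outer v w)"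
    unfolding continuous_on case_prod_unfold outer_def
    by (intro ballI vec_tendstoI) (auto intro!: tendsto_intros)
  then have "(\<lambda>x. (\<lambda>(v, w). outer v w) (v x, w x)) \<in> borel_measurable N"
    by (rule borel_measurable_continuous_on) simp
  then show ?thesis by simp
qed

lemma borel_measurable_vec_nth [measurable (raw)]:
  fixes v :: "'b \<Rightarrow> 'c::{second_countable_topology, real_normed_vector} ^ 'n"
  assumes "v \<in> borel_measurable N"
  shows "(\<lambda>x. v x $ i) \<in> borel_measurable N"
  using borel_measurable_continuous_on[of "\<lambda>v. v $ i" v N] assms by (simp add: continuous_intros)

lemma quadratic_form_bounded_linear: "bounded_linear (\<lambda>A :: real ^ 'n ^ 'm. t \<bullet> (A *v s))"
  by (intro linear_conv_bounded_linear[THEN iffD1] linearI)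
    (simp_all add: matrix_vector_mult_add_rdistrib inner_add_right scaleR_matrix_vector_assoc[symmetric])

lemma bounded_linear_transpose: "bounded_linear (transpose :: real ^ 'n ^ 'm \<Rightarrow> real ^ 'm ^ 'n)"
  by (intro linear_conv_bounded_linear[THEN iffD1] linearI) (simp_all add: transpose_def vec_eq_iff)

lemma integrable_outer:
  assumes [measurable]: "W \<in> borel_measurable M" and "integrable M (\<lambda>w. (norm (W w))\<^sup>2)"
  shows "integrable M (\<lambda>w. outer (W w :: real ^ 'n) (W w))"
  by (rule Bochner_Integration.integrable_bound[OF assms(2)]) (auto simp: norm_outer power2_eq_square)

lemma integrable_inner_sq:
  fixes W :: "'w \<Rightarrow> 'b::euclidean_space"
  assumes [measurable]: "W \<in> borel_measurable M" and "integrable M (\<lambda>w. (norm (W w))\<^sup>2)"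
  shows "integrable M (\<lambda>w. (t \<bullet> W w)\<^sup>2)"
proof (rule Bochner_Integration.integrable_bound[OF integrable_mult_right[OF assms(2), of "(norm t)\<^sup>2"]])
  have "(t \<bullet> x)\<^sup>2 \<le> (norm t)\<^sup>2 * (norm x)\<^sup>2" for x
    using Cauchy_Schwarz_ineq[of t x] by (simp add: power2_norm_eq_inner)
  then show "AE w in M. norm ((t \<bullet> W w)\<^sup>2) \<le> norm ((norm t)\<^sup>2 * (norm (W w))\<^sup>2)" by simp
qed simp

lemma (in prob_space) integrable_of_sq:
  assumes [measurable]: "W \<in> borel_measurable M" and "integrable M (\<lambda>w. (norm (W w))\<^sup>2)"
  shows "integrable M (W :: 'a \<Rightarrow> 'b::euclidean_space)"
proof (rule Bochner_Integration.integrable_bound)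
  show "integrable M (\<lambda>w. 1 + (norm (W w))\<^sup>2)" using assms by simp
  have "x \<le> 1 + x\<^sup>2" if "0 \<le> x" for x :: real
    using that by (cases "x \<le> 1") (auto intro: add_increasing2 order_trans[OF self_le_power[of x 2]])
  then show "AE w in M. norm (W w) \<le> norm (1 + (norm (W w))\<^sup>2)" by simp
qed simp

lemma (in prob_space) quadratic_form_cov_matrix:
  fixes W :: "'a \<Rightarrow> real ^ 'n"
  assumes [measurable]: "W \<in> borel_measurable M" and W: "integrable M (\<lambda>w. (norm (W w))\<^sup>2)"
  shows "t \<bullet> (cov_matrix M W *v t) = (\<integral>w. (t \<bullet> (W w - expectation W))\<^sup>2 \<partial>M)"
    and "transpose (cov_matrix M W) = cov_matrix M W"
    and "integrable M (\<lambda>w. (t \<bullet> (W w - expectation W))\<^sup>2)"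
proof -
  let ?e = "expectation W"
  have sq: "integrable M (\<lambda>w. (norm (W w - ?e))\<^sup>2)"
  proof (rule Bochner_Integration.integrable_bound)
    show "integrable M (\<lambda>w. 2 * (norm (W w))\<^sup>2 + 2 * (norm ?e)\<^sup>2)" using W by simp
    have "(norm (x - y))\<^sup>2 \<le> 2 * (norm x)\<^sup>2 + 2 * (norm y)\<^sup>2" for x y :: "real ^ 'n"
    proof -
      have "(norm (x - y))\<^sup>2 \<le> (norm x + norm y)\<^sup>2"
        by (intro power_mono norm_triangle_ineq4) simp
      also have "\<dots> \<le> 2 * (norm x)\<^sup>2 + 2 * (norm y)\<^sup>2"
        using sum_squares_bound[of "norm x" "norm y"] by (simp add: power2_sum)
      finally show ?thesis .
    qed
    then show "AE w in M. norm ((norm (W w - ?e))\<^sup>2) \<le> norm (2 * (norm (W w))\<^sup>2 + 2 * (norm ?e)\<^sup>2)" by simp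
  qed simp
  have outer: "integrable M (\<lambda>w. outer (W w - ?e) (W w - ?e))"
    by (rule integrable_outer[OF _ sq]) simp
  show "t \<bullet> (cov_matrix M W *v t) = (\<integral>w. (t \<bullet> (W w - ?e))\<^sup>2 \<partial>M)"
    unfolding cov_matrix_def integral_bounded_linear[OF quadratic_form_bounded_linear outer, symmetric]
    by (simp add: inner_outer power2_eq_square inner_commute)
  show "transpose (cov_matrix M W) = cov_matrix M W"
    unfolding cov_matrix_def integral_bounded_linear[OF bounded_linear_transpose outer, symmetric]
    by (simp add: transpose_outer)
  show "integrable M (\<lambda>w. (t \<bullet> (W w - ?e))\<^sup>2)"
    by (rule integrable_inner_sq[OF _ sq]) simp
qed

lemma (in prob_space) expectation_abs_le_sqrt:
  fixes X :: "'a \<Rightarrow> real"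
  assumes [measurable]: "X \<in> borel_measurable M" and X: "integrable M (\<lambda>w. (X w)\<^sup>2)"
  shows "(\<integral>w. \<bar>X w\<bar> \<partial>M) \<le> sqrt (\<integral>w. (X w)\<^sup>2 \<partial>M)"
proof (rule real_le_rsqrt)
  have "integrable M X" using integrable_of_sq[of X] X by simp
  then show "(\<integral>w. \<bar>X w\<bar> \<partial>M)\<^sup>2 \<le> (\<integral>w. (X w)\<^sup>2 \<partial>M)"
    using variance_positive[of "\<lambda>w. \<bar>X w\<bar>"] variance_eq[of "\<lambda>w. \<bar>X w\<bar>"] X by simp
qed

locale kernel_moments = prob_space M for M :: "'w measure" +
  fixes U :: "nat \<Rightarrow> 'w \<Rightarrow> real ^ 'q" and V :: "nat \<Rightarrow> 'w \<Rightarrow> real" and f K :: "real \<Rightarrow> real" and h :: "nat \<Rightarrow> real"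
  assumes U_measurable [measurable]: "U i \<in> borel_measurable M"
    and U_id: "distr M borel (U i) = distr M borel (U 0)"
    and U_L2: "integrable M (\<lambda>w. (norm (U 0 w))\<^sup>2)"
    and U_lln: "\<And>\<phi> :: real ^ 'q \<Rightarrow> real. \<phi> \<in> borel_measurable borel \<Longrightarrow> integrable M (\<lambda>w. \<phi> (U 0 w)) \<Longrightarrow>
      AE w in M. (\<lambda>n. (\<Sum>i<n. \<phi> (U i w)) / real n) \<longlonglongrightarrow> (\<integral>w. \<phi> (U 0 w) \<partial>M)"
    and V_indep: "indep_vars (\<lambda>_. borel) V UNIV"
    and f_nonneg: "\<And>x. 0 \<le> f x"
    and V_distr: "\<And>i. distributed M lborel (V i) (\<lambda>x. ennreal (f x))"
    and UV_indep: "indep_set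
      (sets (vimage_algebra (space M) (\<lambda>w i. U i w) (\<Pi>\<^sub>M i\<in>UNIV. borel)))
      (sets (vimage_algebra (space M) (\<lambda>w i. V i w) (\<Pi>\<^sub>M i\<in>UNIV. borel)))"
    and f_bounded: "bounded (range f)" and f_cont: "isCont f 0" and f_pos: "0 < f 0"
    and K_measurable [measurable]: "K \<in> borel_measurable borel"
    and K_nonneg: "\<And>u. 0 \<le> K u" and K_sym: "\<And>u. K (- u) = K u"
    and K_bounded: "bounded (range K)" and K_integrable: "integrable lborel K" and K_integral: "(\<integral>u. K u \<partial>lborel) = 1"
    and K_sq: "integrable lborel (\<lambda>u. (K u)\<^sup>2)"
    and h_pos: "\<And>n. 0 < n \<Longrightarrow> 0 < h n" and h_lim: "h \<longlonglongrightarrow> 0"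
    and nh_lim: "filterlim (\<lambda>n. real n * h n) at_top sequentially"
    and cov_lim: "(\<lambda>n. real n * h n * lambda_max (cov_matrix M (sample_mean U n))) \<longlonglongrightarrow> 0"
begin

definition \<kappa> :: "nat \<Rightarrow> real" where "\<kappa> n = (\<integral>w. K (V 0 w / h n) \<partial>M)"

definition \<mu> :: "real ^ 'q" where "\<mu> = expectation (U 0)"

definition Z :: "nat \<Rightarrow> 'w \<Rightarrow> real ^ 'q" where
  "Z n w = sqrt (real n * h n) *\<^sub>R (mu_hat M K h V U n w - \<mu>)"

lemma nh_nonneg: "0 \<le> real n * h n"
  using h_pos[of n] by (cases n) auto

lemma eventually_nh_pos: "\<forall>\<^sub>F n in sequentially. 0 < real n * h n"
  using nh_lim unfolding filterlim_at_top_dense by blast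

lemma V_measurable [measurable]: "V i \<in> borel_measurable M"
  using V_distr by (auto simp: distributed_def)

lemma f_measurable [measurable]: "f \<in> borel_measurable borel"
proof -
  have "(\<lambda>x. enn2real (ennreal (f x))) \<in> borel_measurable lborel"
    using V_distr[of 0] unfolding distributed_def by (intro borel_measurable_enn2real) auto
  then show ?thesis using f_nonneg by simp
qed

lemma V_id: "distr M borel (V i) = distr M borel (V 0)"
proof -
  have "distr M borel (V i) = density lborel (\<lambda>x. ennreal (f x))" for i
    using V_distr[of i] distr_cong[OF refl sets_lborel[symmetric] refl, of M "V i"]
    unfolding distributed_def by simp
  then show ?thesis by simp
qed

lemma mu_hat_measurable [measurable]: "mu_hat M K h V U n \<in> borel_measurable M"
  unfolding mu_hat_def[abs_def] by measurable

lemma Z_measurable [measurable]: "Z n \<in> borel_measurable M"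
  unfolding Z_def[abs_def] by measurable

lemma U_L2_all: "integrable M (\<lambda>w. (norm (U i w))\<^sup>2)"
  using integrable_distr_eq[of "U i" M borel "\<lambda>x. (norm x)\<^sup>2"] integrable_distr_eq[of "U 0" M borel "\<lambda>x. (norm x)\<^sup>2"]
    U_id[of i] U_L2 by simp

lemma U_integrable: "integrable M (U i)"
  by (rule integrable_of_sq[OF _ U_L2_all]) simp

lemma U_expectation: "expectation (U i) = \<mu>"
proof -
  have "expectation (U j) = (\<integral>x. x \<partial>distr M borel (U j))" for j
    by (rule integral_distr[symmetric]) auto
  then show ?thesis by (simp only: U_id[of i] \<mu>_def)
qed

lemma kappa_over_h: "(\<lambda>n. \<kappa> n / h n) \<longlonglongrightarrow> f 0"
proof -
  have "(\<lambda>n. \<integral>u. K u * f (h n * u) \<partial>lborel) \<longlonglongrightarrow> f 0"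
    using tendsto_integral_scaled[OF f_measurable f_bounded f_cont K_integrable h_lim] K_integral by simp
  moreover have "\<forall>\<^sub>F n in sequentially. (\<integral>u. K u * f (h n * u) \<partial>lborel) = \<kappa> n / h n"
    using eventually_gt_at_top[of 0]
  proof eventually_elim
    case (elim n)
    then show ?case
      using expectation_scaled[OF V_distr[of 0] f_nonneg K_measurable h_pos[OF elim]] h_pos[OF elim]
      by (simp add: \<kappa>_def)
  qed
  ultimately show ?thesis by (rule Lim_transform_eventually)
qed

lemma K_sq_over_h: "(\<lambda>n. (\<integral>w. (K (V 0 w / h n))\<^sup>2 \<partial>M) / h n) \<longlonglongrightarrow> f 0 * c2 K"
proof -
  have "(\<lambda>n. \<integral>u. (K u)\<^sup>2 * f (h n * u) \<partial>lborel) \<longlonglongrightarrow> f 0 * c2 K"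
    using tendsto_integral_scaled[OF f_measurable f_bounded f_cont K_sq h_lim] by (simp add: c2_def)
  moreover have "\<forall>\<^sub>F n in sequentially. (\<integral>u. (K u)\<^sup>2 * f (h n * u) \<partial>lborel) = (\<integral>w. (K (V 0 w / h n))\<^sup>2 \<partial>M) / h n"
    using eventually_gt_at_top[of 0]
  proof eventually_elim
    case (elim n)
    then show ?case
      using expectation_scaled[OF V_distr[of 0] f_nonneg, of "\<lambda>u. (K u)\<^sup>2", OF _ h_pos[OF elim]] h_pos[OF elim]
      by simp
  qed
  ultimately show ?thesis by (rule Lim_transform_eventually)
qed

lemma eventually_kappa_pos: "\<forall>\<^sub>F n in sequentially. f 0 / 2 * h n < \<kappa> n \<and> 0 < \<kappa> n \<and> 0 < h n \<and> 0 < n"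
proof -
  have "\<forall>\<^sub>F n in sequentially. f 0 / 2 < \<kappa> n / h n"
    using f_pos by (intro order_tendstoD(1)[OF kappa_over_h]) simp
  then show ?thesis using eventually_gt_at_top[of 0]
  proof eventually_elim
    case (elim n)
    then have "f 0 / 2 * h n < \<kappa> n" using h_pos[of n] by (simp add: less_divide_eq)
    moreover have "0 < f 0 / 2 * h n" using f_pos h_pos[of n] elim by simp
    ultimately show ?case using h_pos[of n] elim by auto
  qed
qed

definition \<xi> :: "nat \<Rightarrow> real \<Rightarrow> real" where
  "\<xi> n x = sqrt (real n * h n) / real n * (K (x / h n) / \<kappa> n - 1)"

lemma xi_measurable [measurable]: "\<xi> n \<in> borel_measurable borel"
  unfolding \<xi>_def[abs_def] by measurable

lemma integrable_K: "integrable M (\<lambda>w. K (V 0 w / b))" "integrable M (\<lambda>w. (K (V 0 w / b))\<^sup>2)"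
proof -
  obtain B where B: "\<And>x. \<bar>K x\<bar> \<le> B" using K_bounded by (auto simp: bounded_iff)
  then show "integrable M (\<lambda>w. K (V 0 w / b))" by (intro integrable_const_bound[of _ B]) auto
  have "\<bar>(K x)\<^sup>2\<bar> \<le> B\<^sup>2" for x
    using power_mono[OF B[of x], of 2] by simp
  then show "integrable M (\<lambda>w. (K (V 0 w / b))\<^sup>2)" by (intro integrable_const_bound[of _ "B\<^sup>2"]) auto
qed

lemma xi_mean: "0 < \<kappa> n \<Longrightarrow> (\<integral>w. \<xi> n (V 0 w) \<partial>M) = 0"
  using integrable_K(1)[of "h n"] by (simp add: \<xi>_def prob_space flip: \<kappa>_def)

lemma xi_bound: "\<exists>c. c \<longlonglongrightarrow> 0 \<and> (\<forall>\<^sub>F n in sequentially. \<forall>x. \<bar>\<xi> n x\<bar> \<le> c n)"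
proof -
  obtain B where B: "\<And>x. \<bar>K x\<bar> \<le> B" using K_bounded by (auto simp: bounded_iff)
  have B0: "0 \<le> B" using B[of 0] by linarith
  define C where "C = 2 * B / f 0 + 1"
  have C: "0 < C" using B0 f_pos by (simp add: C_def add_nonneg_pos)
  have "((\<lambda>x. C * inverse (sqrt x)) \<longlongrightarrow> C * 0) at_top"
    by (intro tendsto_mult tendsto_const tendsto_inverse_0_at_top sqrt_at_top)
  then have "(\<lambda>n. C * inverse (sqrt (real n * h n))) \<longlonglongrightarrow> 0"
    using filterlim_compose[OF _ nh_lim] by fastforce
  moreover have "\<forall>\<^sub>F n in sequentially. h n < 1"
    using order_tendstoD(2)[OF h_lim, of 1] by simp
  then have "\<forall>\<^sub>F n in sequentially. \<forall>x. \<bar>\<xi> n x\<bar> \<le> C * inverse (sqrt (real n * h n))"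
    using eventually_kappa_pos
  proof (eventually_elim, intro allI)
    case (elim n)
    fix x
    have hn: "0 < h n" "0 < real n" "0 < real n * h n" using elim by auto
    have "\<bar>K (x / h n) / \<kappa> n\<bar> \<le> B / (f 0 / 2 * h n)"
      unfolding abs_divide using B B0 elim f_pos hn by (intro frac_le) auto
    also have "\<dots> = (2 * B / f 0) / h n" by simp
    finally have "\<bar>K (x / h n) / \<kappa> n - 1\<bar> \<le> (2 * B / f 0) / h n + 1" by linarith
    also have "\<dots> \<le> C / h n"
      using hn elim by (simp add: C_def add_divide_distrib)
    finally have "\<bar>\<xi> n x\<bar> \<le> sqrt (real n * h n) / real n * (C / h n)"
      unfolding \<xi>_def abs_mult using hn by (intro mult_mono) auto
    also have "\<dots> = C * (sqrt (real n * h n) / (real n * h n))" by simp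
    also have "sqrt (real n * h n) / (real n * h n) = inverse (sqrt (real n * h n))"
      using hn by (simp only: sqrt_divide_self_eq less_imp_le)
    finally show "\<bar>\<xi> n x\<bar> \<le> C * inverse (sqrt (real n * h n))" .
  qed
  ultimately show ?thesis by blast
qed

lemma xi_variance: "(\<lambda>n. real n * (\<integral>w. (\<xi> n (V 0 w))\<^sup>2 \<partial>M)) \<longlonglongrightarrow> c2 K / f 0"
proof -
  have "(\<lambda>n. ((\<integral>w. (K (V 0 w / h n))\<^sup>2 \<partial>M) / h n) / (\<kappa> n / h n)\<^sup>2 - h n) \<longlonglongrightarrow> (f 0 * c2 K) / (f 0)\<^sup>2 - 0"
    using f_pos by (intro tendsto_intros K_sq_over_h kappa_over_h h_lim) simp
  moreover have "(f 0 * c2 K) / (f 0)\<^sup>2 - 0 = c2 K / f 0"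
    using f_pos by (simp add: power2_eq_square)
  moreover have "\<forall>\<^sub>F n in sequentially. ((\<integral>w. (K (V 0 w / h n))\<^sup>2 \<partial>M) / h n) / (\<kappa> n / h n)\<^sup>2 - h n
      = real n * (\<integral>w. (\<xi> n (V 0 w))\<^sup>2 \<partial>M)"
    using eventually_kappa_pos
  proof eventually_elim
    case (elim n)
    have "(\<xi> n x)\<^sup>2 = h n / real n * ((K (x / h n))\<^sup>2 / (\<kappa> n)\<^sup>2 - 2 * K (x / h n) / \<kappa> n + 1)" for x
      using elim by (simp add: \<xi>_def power_mult_distrib power_divide power2_diff) (simp add: power2_eq_square)
    then have "(\<integral>w. (\<xi> n (V 0 w))\<^sup>2 \<partial>M)
        = h n / real n * ((\<integral>w. (K (V 0 w / h n))\<^sup>2 \<partial>M) / (\<kappa> n)\<^sup>2 - 2 * \<kappa> n / \<kappa> n + 1)"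
      using integrable_K[of "h n"] by (simp add: prob_space flip: \<kappa>_def)
    then show ?case
      using elim by (simp add: field_simps power2_eq_square)
  qed
  ultimately show ?thesis using Lim_transform_eventually by fastforce
qed

lemma independent_weights: "independent_weights M (\<lambda>i w. t \<bullet> U i w) V"
proof
  have Um: "(\<lambda>w i. U i w) \<in> measurable M (\<Pi>\<^sub>M i\<in>UNIV. borel)"
    by (rule measurable_PiM_single') (auto simp: space_PiM)
  have Vm: "(\<lambda>w i. V i w) \<in> measurable M (\<Pi>\<^sub>M i\<in>UNIV. borel)"
    by (rule measurable_PiM_single') (auto simp: space_PiM)
  have \<Phi>: "(\<lambda>z i. t \<bullet> z i) \<in> measurable (\<Pi>\<^sub>M i\<in>(UNIV :: nat set). borel) (\<Pi>\<^sub>M i\<in>UNIV. borel)"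
    by (rule measurable_PiM_single') (auto simp: space_PiM)
  show "indep_var (\<Pi>\<^sub>M i\<in>UNIV. borel) (\<lambda>w i. t \<bullet> U i w) (\<Pi>\<^sub>M i\<in>UNIV. borel) (\<lambda>w i. V i w)"
    by (rule indep_var_compose_indep_set[OF Um \<Phi> Vm UV_indep])
  show "indep_vars (\<lambda>_. borel) V UNIV" by (rule V_indep)
  show "distr M borel (V i) = distr M borel (V 0)" for i by (rule V_id)
  show "distr M borel (\<lambda>w. t \<bullet> U i w) = distr M borel (\<lambda>w. t \<bullet> U 0 w)" for i
    using distr_distr[of "\<lambda>x. t \<bullet> x" borel borel "U i" M] distr_distr[of "\<lambda>x. t \<bullet> x" borel borel "U 0" M] U_id[of i]
    by (simp add: comp_def)
  show "integrable M (\<lambda>w. (t \<bullet> U 0 w)\<^sup>2)"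
    by (rule integrable_inner_sq[OF _ U_L2]) simp
qed

definition mean_err :: "real ^ 'q \<Rightarrow> nat \<Rightarrow> 'w \<Rightarrow> real" where
  "mean_err t n w = sqrt (real n * h n) * (t \<bullet> (sample_mean U n w - \<mu>))"

lemma mean_err_measurable [measurable]: "mean_err t n \<in> borel_measurable M"
  unfolding mean_err_def[abs_def] sample_mean_def by measurable

lemma inner_Z_decompose:
  assumes "0 < \<kappa> n" "0 < n"
  shows "t \<bullet> Z n w = (\<Sum>i<n. \<xi> n (V i w) * (t \<bullet> U i w)) + mean_err t n w"
proof -
  let ?s = "sqrt (real n * h n)"
  have a: "(\<Sum>i<n. \<xi> n (V i w) * (t \<bullet> U i w))
      = ?s / real n * ((\<Sum>i<n. K (V i w / h n) * (t \<bullet> U i w)) / \<kappa> n - (\<Sum>i<n. t \<bullet> U i w))"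
    by (simp add: \<xi>_def sum_distrib_left sum_divide_distrib sum_subtractf[symmetric] algebra_simps)
  have b: "t \<bullet> Z n w = ?s * ((\<Sum>i<n. K (V i w / h n) * (t \<bullet> U i w)) / (real n * \<kappa> n) - t \<bullet> \<mu>)"
    by (simp add: Z_def mu_hat_def inner_diff_right inner_sum_right flip: \<kappa>_def)
  have c: "mean_err t n w = ?s * ((\<Sum>i<n. t \<bullet> U i w) / real n - t \<bullet> \<mu>)"
    by (simp add: mean_err_def sample_mean_def inner_diff_right inner_sum_right)
  show ?thesis
    unfolding a b c using assms by (simp add: field_simps)
qed

lemma sample_mean_L2: "integrable M (\<lambda>w. (norm (sample_mean U n w))\<^sup>2)"
proof (rule Bochner_Integration.integrable_bound)
  show "integrable M (\<lambda>w. real n * (1 / real n)\<^sup>2 * (\<Sum>i<n. (norm (U i w))\<^sup>2))"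
    using U_L2_all by simp
  have "(norm (sample_mean U n w))\<^sup>2 \<le> real n * (1 / real n)\<^sup>2 * (\<Sum>i<n. (norm (U i w))\<^sup>2)" for w
  proof -
    have "(norm (\<Sum>i<n. U i w))\<^sup>2 \<le> (\<Sum>i<n. norm (U i w))\<^sup>2"
      by (intro power_mono norm_sum) simp
    also have "\<dots> \<le> real n * (\<Sum>i<n. (norm (U i w))\<^sup>2)"
      using sum_squared_le_sum_of_squares[of "\<lambda>i. norm (U i w)" "{..<n}"] by (simp add: mult.commute)
    finally show ?thesis
      by (simp add: sample_mean_def power_mult_distrib power_divide divide_right_mono)
  qed
  then show "AE w in M. norm ((norm (sample_mean U n w))\<^sup>2) \<le> norm (real n * (1 / real n)\<^sup>2 * (\<Sum>i<n. (norm (U i w))\<^sup>2))"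
    by (auto intro!: AE_I2 order_trans[OF _ abs_ge_self])
qed (simp add: sample_mean_def)

lemma expectation_sample_mean: "0 < n \<Longrightarrow> expectation (sample_mean U n) = \<mu>"
proof -
  assume n: "0 < n"
  have "expectation (sample_mean U n) = (1 / real n) *\<^sub>R (\<Sum>i<n. expectation (U i))"
    unfolding sample_mean_def[abs_def] using U_integrable by (simp add: Bochner_Integration.integral_sum)
  also have "\<dots> = (1 / real n) *\<^sub>R (real n *\<^sub>R \<mu>)"
    by (simp only: U_expectation sum_constant_scaleR card_lessThan)
  finally show ?thesis using n by simp
qed

lemma mean_err_L2:
  shows "0 < n \<Longrightarrow> integrable M (\<lambda>w. (mean_err t n w)\<^sup>2)"
    and "(\<lambda>n. \<integral>w. (mean_err t n w)\<^sup>2 \<partial>M) \<longlonglongrightarrow> 0"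
proof -
  have [measurable]: "sample_mean U n \<in> borel_measurable M" for n
    unfolding sample_mean_def[abs_def] by measurable
  have sq: "(mean_err t n w)\<^sup>2 = real n * h n * (t \<bullet> (sample_mean U n w - expectation (sample_mean U n)))\<^sup>2"
    if "0 < n" for n w
    using that nh_nonneg[of n] by (simp add: mean_err_def power_mult_distrib expectation_sample_mean)
  show "integrable M (\<lambda>w. (mean_err t n w)\<^sup>2)" if "0 < n"
    unfolding sq[OF that] by (intro integrable_mult_right quadratic_form_cov_matrix(3) sample_mean_L2) simp
  have bound: "(\<integral>w. (mean_err t n w)\<^sup>2 \<partial>M) \<le> real n * h n * lambda_max (cov_matrix M (sample_mean U n)) * (norm t)\<^sup>2"
    if n: "0 < n" for n
  proof -
    have "(\<integral>w. (mean_err t n w)\<^sup>2 \<partial>M) = real n * h n * (t \<bullet> (cov_matrix M (sample_mean U n) *v t))"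
      unfolding sq[OF n] by (simp add: quadratic_form_cov_matrix(1)[OF _ sample_mean_L2])
    also have "\<dots> \<le> real n * h n * (lambda_max (cov_matrix M (sample_mean U n)) * (norm t)\<^sup>2)"
      by (intro mult_left_mono quadratic_form_le_lambda_max quadratic_form_cov_matrix(2) sample_mean_L2 nh_nonneg) simp
    finally show ?thesis by simp
  qed
  have "(\<lambda>n. real n * h n * lambda_max (cov_matrix M (sample_mean U n)) * (norm t)\<^sup>2) \<longlonglongrightarrow> 0"
    by (rule tendsto_mult_left_zero[OF cov_lim])
  then show "(\<lambda>n. \<integral>w. (mean_err t n w)\<^sup>2 \<partial>M) \<longlonglongrightarrow> 0"
    by (rule tendsto_sandwich[rotated 2, OF tendsto_const])
      (auto intro!: always_eventually eventually_mono[OF eventually_gt_at_top[of 0]] bound)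
qed

lemma Z_char:
  "(\<lambda>n. \<integral>w. iexp (t \<bullet> Z n w) \<partial>M) \<longlonglongrightarrow> of_real (exp (- (c2 K / f 0 * (\<integral>w. (t \<bullet> U 0 w)\<^sup>2 \<partial>M) / 2)))"
proof -
  interpret I: independent_weights M "\<lambda>i w. t \<bullet> U i w" V by (rule independent_weights)
  obtain c where c: "c \<longlonglongrightarrow> 0" "\<forall>\<^sub>F n in sequentially. \<forall>x. \<bar>\<xi> n x\<bar> \<le> c n"
    using xi_bound by blast
  have "AE w in M. (\<lambda>n. (\<Sum>i<n. (t \<bullet> U i w)\<^sup>2) / real n) \<longlonglongrightarrow> (\<integral>w. (t \<bullet> U 0 w)\<^sup>2 \<partial>M)"
    using I.u_L2 by (intro U_lln[of "\<lambda>x. (t \<bullet> x)\<^sup>2"]) auto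
  then have main: "(\<lambda>n. \<integral>w. iexp (\<Sum>i<n. \<xi> n (V i w) * (t \<bullet> U i w)) \<partial>M)
      \<longlonglongrightarrow> of_real (exp (- (c2 K / f 0 * (\<integral>w. (t \<bullet> U 0 w)\<^sup>2 \<partial>M) / 2)))"
  proof (rule I.weighted_clt[OF _ _ c(2) c(1) _ xi_variance])
    show "\<forall>\<^sub>F n in sequentially. (\<integral>w. \<xi> n (V 0 w) \<partial>M) = 0"
      using eventually_kappa_pos by eventually_elim (simp add: xi_mean)
  qed simp
  have "(\<lambda>n. sqrt (\<integral>w. (mean_err t n w)\<^sup>2 \<partial>M)) \<longlonglongrightarrow> 0"
    using tendsto_real_sqrt[OF mean_err_L2(2)] by simp
  moreover have "\<forall>\<^sub>F n in sequentially. norm ((\<integral>w. iexp (t \<bullet> Z n w) \<partial>M)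
      - (\<integral>w. iexp (\<Sum>i<n. \<xi> n (V i w) * (t \<bullet> U i w)) \<partial>M)) \<le> sqrt (\<integral>w. (mean_err t n w)\<^sup>2 \<partial>M)"
    using eventually_kappa_pos
  proof eventually_elim
    case (elim n)
    let ?S = "\<lambda>w. \<Sum>i<n. \<xi> n (V i w) * (t \<bullet> U i w)"
    have le: "norm (iexp (x + y) - iexp x) \<le> \<bar>y\<bar>" for x y :: real
    proof -
      have "iexp (x + y) - iexp x = iexp x * (iexp y - 1)"
        by (simp add: right_diff_distrib exp_add distrib_left)
      then have "norm (iexp (x + y) - iexp x) = norm (iexp y - 1)"
        by (simp add: norm_mult)
      also have "\<dots> \<le> \<bar>y\<bar>"
        using iexp_approx1[of y 0] by simp
      finally show ?thesis .
    qed
    have me: "integrable M (mean_err t n)"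
      using integrable_of_sq[of "mean_err t n"] mean_err_L2(1)[of n t] elim by simp
    have "norm ((\<integral>w. iexp (t \<bullet> Z n w) \<partial>M) - (\<integral>w. iexp (?S w) \<partial>M))
        = norm (\<integral>w. iexp (?S w + mean_err t n w) - iexp (?S w) \<partial>M)"
      using elim by (subst Bochner_Integration.integral_diff) (auto simp: inner_Z_decompose intro!: integrable_iexp)
    also have "\<dots> \<le> (\<integral>w. norm (iexp (?S w + mean_err t n w) - iexp (?S w)) \<partial>M)"
      by (rule integral_norm_bound)
    also have "\<dots> \<le> (\<integral>w. \<bar>mean_err t n w\<bar> \<partial>M)"
      by (rule integral_mono'[OF integrable_abs[OF me]]) (rule le, simp)
    also have "\<dots> \<le> sqrt (\<integral>w. (mean_err t n w)\<^sup>2 \<partial>M)"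
      using mean_err_L2(1)[of n t] elim by (intro expectation_abs_le_sqrt) auto
    finally show ?case .
  qed
  ultimately have "(\<lambda>n. (\<integral>w. iexp (t \<bullet> Z n w) \<partial>M)
      - (\<integral>w. iexp (\<Sum>i<n. \<xi> n (V i w) * (t \<bullet> U i w)) \<partial>M)) \<longlonglongrightarrow> 0"
    by (rule Lim_null_comparison[rotated])
  from Lim_transform[OF main this] show ?thesis .
qed

lemma Z_tight: "tight_seq M Z"
proof -
  define C where "C = (\<Sum>b\<in>(Basis :: (real ^ 'q) set). 2 * (c2 K / f 0 * (\<integral>w. (b \<bullet> U 0 w)\<^sup>2 \<partial>M)) + 2 * 0) + 1"
  obtain c where c: "c \<longlonglongrightarrow> 0" "\<forall>\<^sub>F n in sequentially. \<forall>x. \<bar>\<xi> n x\<bar> \<le> c n"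
    using xi_bound by blast
  define D where "D n = (\<Sum>b\<in>(Basis :: (real ^ 'q) set). 2 * (real n * (\<integral>w. (\<xi> n (V 0 w))\<^sup>2 \<partial>M) * (\<integral>w. (b \<bullet> U 0 w)\<^sup>2 \<partial>M))
      + 2 * (\<integral>w. (mean_err b n w)\<^sup>2 \<partial>M))" for n
  have "D \<longlonglongrightarrow> C - 1"
    unfolding D_def[abs_def] C_def add_diff_cancel_right' by (intro tendsto_intros xi_variance mean_err_L2(2))
  then have ev: "\<forall>\<^sub>F n in sequentially. D n < C"
    by (intro order_tendstoD(2)) auto
  have "\<forall>\<^sub>F n in sequentially. integrable M (\<lambda>w. (norm (Z n w))\<^sup>2) \<and> (\<integral>w. (norm (Z n w))\<^sup>2 \<partial>M) \<le> C"
    using c(2) eventually_kappa_pos ev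
  proof eventually_elim
    case (elim n)
    let ?S = "\<lambda>b w. \<Sum>i<n. \<xi> n (V i w) * (b \<bullet> U i w)"
    let ?g = "\<lambda>w. \<Sum>b\<in>(Basis :: (real ^ 'q) set). 2 * (?S b w)\<^sup>2 + 2 * (mean_err b n w)\<^sup>2"
    have S: "integrable M (\<lambda>w. (?S b w)\<^sup>2)"
      "(\<integral>w. (?S b w)\<^sup>2 \<partial>M) = real n * (\<integral>w. (\<xi> n (V 0 w))\<^sup>2 \<partial>M) * (\<integral>w. (b \<bullet> U 0 w)\<^sup>2 \<partial>M)" for b
    proof -
      interpret I: independent_weights M "\<lambda>i w. b \<bullet> U i w" V by (rule independent_weights)
      show "integrable M (\<lambda>w. (?S b w)\<^sup>2)"
        "(\<integral>w. (?S b w)\<^sup>2 \<partial>M) = real n * (\<integral>w. (\<xi> n (V 0 w))\<^sup>2 \<partial>M) * (\<integral>w. (b \<bullet> U 0 w)\<^sup>2 \<partial>M)"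
        using elim xi_mean[of n] by (auto intro!: I.expectation_weighted_sum_sq[of "\<xi> n" "c n"])
    qed
    have m: "integrable M (\<lambda>w. (mean_err b n w)\<^sup>2)" for b
      using elim mean_err_L2(1) by blast
    have le: "(norm (Z n w))\<^sup>2 \<le> ?g w" for w
    proof -
      have "(norm (Z n w))\<^sup>2 = (\<Sum>b\<in>Basis. (b \<bullet> Z n w)\<^sup>2)"
        unfolding power2_norm_eq_inner euclidean_inner[of "Z n w" "Z n w"] by (simp add: power2_eq_square inner_commute)
      also have "\<dots> \<le> ?g w"
      proof (rule sum_mono)
        fix b :: "real ^ 'q"
        show "(b \<bullet> Z n w)\<^sup>2 \<le> 2 * (?S b w)\<^sup>2 + 2 * (mean_err b n w)\<^sup>2"
          using elim sum_squares_bound[of "?S b w" "mean_err b n w"]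
          by (simp add: inner_Z_decompose power2_sum)
      qed
      finally show ?thesis .
    qed
    have g: "integrable M ?g" using S(1) m by auto
    have i: "integrable M (\<lambda>w. (norm (Z n w))\<^sup>2)"
      by (rule Bochner_Integration.integrable_bound[OF g]) (auto intro!: AE_I2 order_trans[OF le abs_ge_self])
    have "(\<integral>w. (norm (Z n w))\<^sup>2 \<partial>M) \<le> (\<integral>w. ?g w \<partial>M)"
      by (rule integral_mono[OF i g le])
    also have "\<dots> = D n"
      using S m by (simp add: D_def Bochner_Integration.integral_sum)
    finally show ?case using i elim by auto
  qed
  then show ?thesis by (rule tight_seq_L2_bounded[rotated]) simp
qed

lemma mu_hat_consistent: "((\<lambda>(n, w). mu_hat M K h V U n w) \<longlongrightarrow> \<mu>) (prob_filter M)"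
proof -
  have "((\<lambda>x. inverse (sqrt x)) \<longlongrightarrow> 0) at_top"
    by (intro tendsto_inverse_0_at_top sqrt_at_top)
  then have "(\<lambda>n. inverse (sqrt (real n * h n))) \<longlonglongrightarrow> 0"
    using filterlim_compose[OF _ nh_lim] by fastforce
  then have "((\<lambda>(n, w). inverse (sqrt (real n * h n))) \<longlongrightarrow> 0) (prob_filter M)"
    by (rule tendsto_prob_filter_deterministic)
  then have "((\<lambda>(n, w). (\<lambda>x r. r *\<^sub>R x) (Z n w) ((\<lambda>(n, w). inverse (sqrt (real n * h n))) (n, w)) - (\<lambda>x r. r *\<^sub>R x) (Z n w) 0) \<longlongrightarrow> 0) (prob_filter M)"
    by (intro slutsky Z_tight) (auto simp: case_prod_unfold intro!: continuous_intros)
  then have "((\<lambda>(n, w). inverse (sqrt (real n * h n)) *\<^sub>R Z n w + \<mu>) \<longlongrightarrow> 0 + \<mu>) (prob_filter M)"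
    unfolding case_prod_unfold by (intro tendsto_add tendsto_const) simp
  moreover have "\<forall>\<^sub>F p in prob_filter M. (case p of (n, w) \<Rightarrow> inverse (sqrt (real n * h n)) *\<^sub>R Z n w + \<mu>)
      = (case p of (n, w) \<Rightarrow> mu_hat M K h V U n w)"
    using eventually_prob_filter_deterministic[OF eventually_nh_pos]
  proof eventually_elim
    case (elim p)
    obtain n w where p: "p = (n, w)" by (cases p)
    have "0 < real n * h n" using elim unfolding p prod.case .
    then have "inverse (sqrt (real n * h n)) * sqrt (real n * h n) = 1"
      by (intro left_inverse) (metis less_irrefl real_sqrt_eq_zero_cancel_iff)
    then show ?case by (simp only: p Z_def prod.case scaleR_scaleR) simp
  qed
  ultimately show ?thesis
    using Lim_transform_eventually by fastforce
qed

lemma Sigma_mu_hat_consistent: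
  "((\<lambda>(n, w). Sigma_mu_hat K f U n w) \<longlongrightarrow> (c2 K / f 0) *\<^sub>R (\<integral>w. outer (U 0 w) (U 0 w) \<partial>M)) (prob_filter M)"
  unfolding Sigma_mu_hat_def case_prod_unfold
proof (intro tendsto_scaleR tendsto_const vec_tendstoI)
  fix k l
  have int: "integrable M (\<lambda>w. outer (U 0 w) (U 0 w))"
    by (rule integrable_outer[OF _ U_L2]) simp
  have eq: "A $ k $ l = axis k 1 \<bullet> (A *v axis l 1)" for A :: "real ^ 'q ^ 'q"
    by (simp add: inner_axis' matrix_vector_mult_basis column_def)
  have int': "integrable M (\<lambda>w. U 0 w $ k * U 0 w $ l)"
    using integrable_bounded_linear[OF quadratic_form_bounded_linear int, of "axis k 1" "axis l 1"]
    unfolding eq[symmetric] by (simp add: outer_def)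
  have lim: "(\<integral>w. outer (U 0 w) (U 0 w) \<partial>M) $ k $ l = (\<integral>w. U 0 w $ k * U 0 w $ l \<partial>M)"
    unfolding eq integral_bounded_linear[OF quadratic_form_bounded_linear int, symmetric]
    unfolding eq[symmetric] by (simp add: outer_def)
  have "((\<lambda>(n, w). (\<Sum>i<n. U i w $ k * U i w $ l) / real n) \<longlongrightarrow> (\<integral>w. U 0 w $ k * U 0 w $ l \<partial>M)) (prob_filter M)"
    using U_lln[of "\<lambda>x. x $ k * x $ l"] int' by (intro AE_tendsto_imp_prob_filter) auto
  then show "((\<lambda>p. sample_mean (\<lambda>i w. outer (U i w) (U i w)) (fst p) (snd p) $ k $ l)
      \<longlongrightarrow> (\<integral>w. outer (U 0 w) (U 0 w) \<partial>M) $ k $ l) (prob_filter M)"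
    unfolding lim by (simp add: case_prod_unfold sample_mean_def outer_def)
qed

lemma a_scale_eq:
  assumes "0 < n" "0 < l"
  shows "a_scale M K f h V l n = (\<integral>u. K u * f (l * h n * u) \<partial>lborel) / f 0"
proof -
  have b: "0 < l * h n" using assms h_pos by simp
  have "(\<integral>w. K (- V i w / (l * h n)) \<partial>M) = l * h n * (\<integral>u. K u * f (l * h n * u) \<partial>lborel)" for i
    using expectation_scaled[OF V_distr[of i] f_nonneg K_measurable b] by (simp add: K_sym)
  moreover have "integrable M (\<lambda>w. K (- V i w / (l * h n)))" for i
  proof -
    obtain B where B: "\<And>x. \<bar>K x\<bar> \<le> B" using K_bounded by (auto simp: bounded_iff)
    then show ?thesis by (intro integrable_const_bound[of _ B]) auto
  qed
  ultimately have "(\<integral>w. f_hat K h V l n 0 w \<partial>M) = (\<integral>u. K u * f (l * h n * u) \<partial>lborel)"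
    using assms b h_pos[of n] by (simp add: f_hat_def Bochner_Integration.integral_sum)
  then show ?thesis by (simp add: a_scale_def)
qed

lemma a_scale_lim:
  assumes l: "0 < l"
  shows "a_scale M K f h V l \<longlonglongrightarrow> 1"
proof -
  have "(\<lambda>n. (\<integral>u. K u * f (l * h n * u) \<partial>lborel) / f 0) \<longlonglongrightarrow> f 0 * 1 / f 0"
    using tendsto_integral_scaled[OF f_measurable f_bounded f_cont K_integrable tendsto_mult_right_zero[OF h_lim], of l]
      f_pos K_integral by (intro tendsto_divide tendsto_const) auto
  moreover have "\<forall>\<^sub>F n in sequentially. (\<integral>u. K u * f (l * h n * u) \<partial>lborel) / f 0 = a_scale M K f h V l n"
    using eventually_gt_at_top[of 0] by eventually_elim (simp add: a_scale_eq l)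
  ultimately show ?thesis using f_pos Lim_transform_eventually by fastforce
qed

lemma a_scale_bias:
  assumes l: "0 < l" and \<delta>: "0 < \<delta>"
    and diff: "\<And>x. x \<in> ball 0 \<delta> \<Longrightarrow> f differentiable (at x) \<and> deriv f differentiable (at x)"
    and bdd2: "bounded (deriv (deriv f) ` ball 0 \<delta>)" and cont: "isCont (deriv (deriv f)) 0"
    and K2: "integrable lborel (\<lambda>u. u\<^sup>2 * K u)"
  shows "(\<lambda>n. (a_scale M K f h V l n - 1) / (h n)\<^sup>2) \<longlonglongrightarrow> deriv (deriv f) 0 * d2 K / (2 * f 0) * l\<^sup>2"
proof -
  have "(\<lambda>n. ((\<integral>u. K u * f (l * h n * u) \<partial>lborel) - f 0) / (l * h n)\<^sup>2)
      \<longlonglongrightarrow> deriv (deriv f) 0 * (\<integral>u. u\<^sup>2 * K u \<partial>lborel) / 2"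
  proof (rule tendsto_kernel_bias[OF f_measurable f_bounded \<delta> diff bdd2 cont K_nonneg K_sym K_integrable K_integral K2])
    show "(\<lambda>n. l * h n) \<longlonglongrightarrow> 0" by (rule tendsto_mult_right_zero[OF h_lim])
    show "\<forall>\<^sub>F n in sequentially. 0 < l * h n"
      using eventually_gt_at_top[of 0] by eventually_elim (simp add: l h_pos)
  qed
  from tendsto_mult[OF this tendsto_const[of "l\<^sup>2 / f 0"]]
  have "(\<lambda>n. ((\<integral>u. K u * f (l * h n * u) \<partial>lborel) - f 0) / (l * h n)\<^sup>2 * (l\<^sup>2 / f 0))
      \<longlonglongrightarrow> deriv (deriv f) 0 * d2 K / (2 * f 0) * l\<^sup>2"
    by (simp add: d2_def field_simps)
  moreover have "\<forall>\<^sub>F n in sequentially. ((\<integral>u. K u * f (l * h n * u) \<partial>lborel) - f 0) / (l * h n)\<^sup>2 * (l\<^sup>2 / f 0)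
      = (a_scale M K f h V l n - 1) / (h n)\<^sup>2"
    using eventually_gt_at_top[of 0]
  proof eventually_elim
    case (elim n)
    then show ?case
      using l f_pos h_pos[of n] by (simp add: a_scale_eq field_simps)
  qed
  ultimately show ?thesis by (rule Lim_transform_eventually)
qed

end

section \<open>Confidence sets from asymptotic normality\<close>

lemma inner_transpose_matrix:
  fixes C :: "real ^ 'n ^ 'm"
  shows "t \<bullet> (C *v x) = (transpose C *v t) \<bullet> x"
  by (simp add: dot_lmul_matrix)

lemma continuous_on_matrix_vector_mult [continuous_intros]:
  fixes A :: "'b::topological_space \<Rightarrow> real ^ 'n ^ 'm"
  shows "continuous_on X A \<Longrightarrow> continuous_on X v \<Longrightarrow> continuous_on X (\<lambda>x. A x *v v x)"
  unfolding continuous_on by (auto intro: tendsto_matrix_vector_mult)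

lemma borel_measurable_matrix_vector_mult [measurable (raw)]:
  fixes A :: "'b \<Rightarrow> real ^ 'n ^ 'm"
  assumes [measurable]: "A \<in> borel_measurable N" "v \<in> borel_measurable N"
  shows "(\<lambda>x. A x *v v x) \<in> borel_measurable N"
proof -
  have "continuous_on UNIV (\<lambda>(A :: real ^ 'n ^ 'm, v). A *v v)"
    unfolding case_prod_unfold by (intro continuous_intros)
  then have "(\<lambda>x. (\<lambda>(A, v). A *v v) (A x, v x)) \<in> borel_measurable N"
    by (rule borel_measurable_continuous_on) simp
  then show ?thesis by simp
qed

locale asymptotically_normal = prob_space M for M :: "'w measure" +
  fixes W :: "nat \<Rightarrow> 'w \<Rightarrow> real ^ 'm" and S :: "real ^ 'm ^ 'm"
    and \<rho> :: "nat \<Rightarrow> real" and est :: "nat \<Rightarrow> 'w \<Rightarrow> real ^ 'm" and \<beta> :: "real ^ 'm"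
  assumes W_measurable [measurable]: "\<And>n. W n \<in> borel_measurable M"
    and W_tight: "tight_seq M W"
    and W_char: "\<And>t. (\<lambda>n. \<integral>w. iexp (t \<bullet> W n w) \<partial>M) \<longlonglongrightarrow> of_real (exp (- (t \<bullet> (S *v t)) / 2))"
    and S_sym: "transpose S = S" and S_pos: "\<And>v. v \<noteq> 0 \<Longrightarrow> 0 < v \<bullet> (S *v v)"
    and \<rho>_nonneg: "\<And>n. 0 \<le> \<rho> n" and \<rho>_pos: "\<forall>\<^sub>F n in sequentially. 0 < \<rho> n"
    and est_measurable [measurable]: "\<And>n. est n \<in> borel_measurable M"
    and close: "((\<lambda>(n, w). sqrt (\<rho> n) *\<^sub>R (est n w - \<beta>) - W n w) \<longlongrightarrow> 0) (prob_filter M)"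
begin

lemma asymptotic_ellipsoid:
  assumes Sh: "((\<lambda>(n, w). Sh n w) \<longlongrightarrow> S) (prob_filter M)"
    and Shinv: "\<And>n. rv_where M (\<lambda>w. invertible (Sh n w)) (\<lambda>w. matrix_inv (Sh n w)) (Shinv n)"
    and \<alpha>: "0 < \<alpha>" "\<alpha> < 1"
  shows "asymptotic_confidence_set M \<alpha>
    (\<lambda>n w. ellipsoid (\<rho> n) (est n w) (Shinv n w) (quantile (chi_square CARD('m)) (1 - \<alpha>))) \<beta>"
proof -
  obtain C :: "real ^ 'm ^ 'm" where C: "C ** S ** transpose C = mat 1"
    using orthonormalizing_matrix[OF S_sym S_pos] by blast
  have detS: "det S \<noteq> 0" by (rule quadratic_form_matrix_inv(1)[OF C])
  have Shinv_meas [measurable]: "Shinv n \<in> borel_measurable M" for n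
    using Shinv by (simp add: rv_where_def)
  define c where "c = quantile (chi_square CARD('m)) (1 - \<alpha>)"
  define Q where "Q n w = \<rho> n * ((est n w - \<beta>) \<bullet> (Shinv n w *v (est n w - \<beta>)))" for n w
  define E where "E n = {w \<in> space M. \<beta> \<in> ellipsoid (\<rho> n) (est n w) (Shinv n w) c}" for n
  have E_eq: "E n = {w \<in> space M. Q n w \<le> c}" for n
    by (simp add: E_def Q_def ellipsoid_def)
  have E_sets: "E n \<in> sets M" for n
    unfolding E_eq Q_def by measurable
  have lim: "(\<lambda>n. prob {w \<in> space M. (norm (C *v W n w))\<^sup>2 \<le> x}) \<longlonglongrightarrow> cdf (chi_square DIM(real ^ 'm)) x" for x
  proof (rule tendsto_cdf_chi_square)
    fix t
    have "(transpose C *v t) \<bullet> (S *v (transpose C *v t)) = t \<bullet> ((C ** S ** transpose C) *v t)"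
      by (simp only: inner_transpose_matrix[of t C, symmetric] matrix_vector_mul_assoc matrix_mul_assoc)
    also have "\<dots> = (norm t)\<^sup>2"
      unfolding C by (simp add: power2_norm_eq_inner)
    finally show "(\<lambda>n. \<integral>w. iexp (t \<bullet> (C *v W n w)) \<partial>M) \<longlonglongrightarrow> of_real (exp (- (norm t)\<^sup>2 / 2))"
      using W_char[of "transpose C *v t"] by (simp only: inner_transpose_matrix[of t C])
  qed measurable
  have "\<forall>\<^sub>F (n, w) in prob_filter M. Shinv n w = matrix_inv (Sh n w)"
    using eventually_invertible[OF Sh detS] eventually_prob_filter_space
    by eventually_elim (use Shinv in \<open>auto simp: rv_where_def\<close>)
  then have Shinv_lim: "((\<lambda>(n, w). Shinv n w) \<longlongrightarrow> matrix_inv S) (prob_filter M)"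
    by (intro Lim_transform_eventually[OF tendsto_matrix_inv[OF Sh detS]]) (auto elim!: eventually_mono)
  have QZ: "((\<lambda>(n, w). Q n w - (norm (C *v W n w))\<^sup>2) \<longlongrightarrow> 0) (prob_filter M)"
  proof -
    define F where "F x y = (x + fst y) \<bullet> (snd y *v (x + fst y))" for x :: "real ^ 'm" and y :: "(real ^ 'm) \<times> (real ^ 'm ^ 'm)"
    define \<eta> where "\<eta> = (\<lambda>(n, w). (sqrt (\<rho> n) *\<^sub>R (est n w - \<beta>) - W n w, Shinv n w))"
    have "continuous_on UNIV (\<lambda>(x, y). F x y)"
      unfolding F_def case_prod_unfold by (intro continuous_intros)
    moreover have "(\<eta> \<longlongrightarrow> (0, matrix_inv S)) (prob_filter M)"
      using tendsto_Pair[OF close Shinv_lim] by (simp add: \<eta>_def case_prod_unfold)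
    ultimately have "((\<lambda>(n, w). F (W n w) (\<eta> (n, w)) - F (W n w) (0, matrix_inv S)) \<longlongrightarrow> 0) (prob_filter M)"
      using W_tight by (intro slutsky)
    moreover have "F (W n w) (\<eta> (n, w)) = Q n w" for n w
      using \<rho>_nonneg[of n] by (simp add: F_def \<eta>_def Q_def matrix_vector_mult_scaleR)
    moreover have "F x (0, matrix_inv S) = (norm (C *v x))\<^sup>2" for x
      by (simp add: F_def quadratic_form_matrix_inv(2)[OF C])
    ultimately show ?thesis by simp
  qed
  have "(\<lambda>n. prob (E n)) \<longlonglongrightarrow> cdf (chi_square DIM(real ^ 'm)) c"
  proof (rule prob_tendsto_of_close[OF lim _ _ E_sets _ QZ])
    show "\<forall>\<^sub>F (n, w) in prob_filter M. w \<in> E n \<longleftrightarrow> Q n w \<le> c"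
      using eventually_prob_filter_space by eventually_elim (auto simp: E_eq)
  qed (auto intro!: isCont_cdf_chi_square)
  then show ?thesis
    using cdf_chi_square_quantile[of "CARD('m)" "1 - \<alpha>"] \<alpha>
    by (simp add: asymptotic_confidence_set_def E_def c_def)
qed

lemma asymptotic_interval:
  assumes Sh: "((\<lambda>(n, w). Sh n w) \<longlongrightarrow> S) (prob_filter M)"
    and Sh_measurable [measurable]: "\<And>n. Sh n \<in> borel_measurable M"
    and \<alpha>: "0 < \<alpha>" "\<alpha> < 1"
  shows "asymptotic_confidence_set M \<alpha>
    (\<lambda>n w. {est n w $ j - quantile std_normal_distribution (1 - \<alpha> / 2) * sqrt (Sh n w $ j $ j / \<rho> n) ..
            est n w $ j + quantile std_normal_distribution (1 - \<alpha> / 2) * sqrt (Sh n w $ j $ j / \<rho> n)}) (\<beta> $ j)"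
proof -
  define z where "z = quantile std_normal_distribution (1 - \<alpha> / 2)"
  note z = std_normal_quantile_square[OF \<alpha>, folded z_def]
  define s where "s = S $ j $ j"
  have s_eq: "axis j 1 \<bullet> (S *v axis j 1) = s"
    by (simp add: s_def inner_axis' matrix_vector_mult_basis column_def)
  have s: "0 < s"
    using S_pos[of "axis j 1"] by (simp add: s_eq axis_eq_0_iff)
  define E where "E n = {w \<in> space M. \<beta> $ j \<in> {est n w $ j - z * sqrt (Sh n w $ j $ j / \<rho> n) ..
            est n w $ j + z * sqrt (Sh n w $ j $ j / \<rho> n)}}" for n
  have E_sets: "E n \<in> sets M" for n
    unfolding E_def atLeastAtMost_iff by measurable
  define Q where "Q n w = (\<rho> n * (est n w $ j - \<beta> $ j)\<^sup>2 - z\<^sup>2 * (Sh n w $ j $ j - s)) / s" for n w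
  have lim: "(\<lambda>n. prob {w \<in> space M. (norm (W n w $ j / sqrt s))\<^sup>2 \<le> x}) \<longlonglongrightarrow> cdf (chi_square DIM(real)) x" for x
  proof (rule tendsto_cdf_chi_square)
    fix t :: real
    have q: "((t / sqrt s) *\<^sub>R axis j 1) \<bullet> (S *v ((t / sqrt s) *\<^sub>R axis j 1)) = (norm t)\<^sup>2"
      using s by (simp add: matrix_vector_mult_scaleR s_eq power2_eq_square field_simps)
    have i: "((t / sqrt s) *\<^sub>R axis j 1) \<bullet> x = t \<bullet> (x $ j / sqrt s)" for x :: "real ^ 'm"
      by (simp add: inner_axis')
    show "(\<lambda>n. \<integral>w. iexp (t \<bullet> (W n w $ j / sqrt s)) \<partial>M) \<longlonglongrightarrow> of_real (exp (- (norm t)\<^sup>2 / 2))"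
      using W_char[of "(t / sqrt s) *\<^sub>R axis j 1"] unfolding q unfolding i .
  qed measurable
  have Shj: "((\<lambda>p. (case p of (n, w) \<Rightarrow> Sh n w) $ j $ j) \<longlongrightarrow> s) (prob_filter M)"
    unfolding s_def by (intro tendsto_vec_nth Sh)
  have "\<forall>\<^sub>F (n, w) in prob_filter M. w \<in> E n \<longleftrightarrow> Q n w \<le> z\<^sup>2"
    using order_tendstoD(1)[OF Shj s] eventually_prob_filter_space eventually_prob_filter_deterministic[OF \<rho>_pos]
  proof eventually_elim
    case (elim p)
    obtain n w where p: "p = (n, w)" by (cases p)
    have a: "0 < Sh n w $ j $ j" "w \<in> space M" "0 < \<rho> n"
      using elim by (simp_all add: p)
    let ?d = "est n w $ j - \<beta> $ j" and ?r = "z * sqrt (Sh n w $ j $ j / \<rho> n)"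
    have r: "0 \<le> ?r" using a z by simp
    have "w \<in> E n \<longleftrightarrow> \<bar>?d\<bar> \<le> \<bar>?r\<bar>"
      using a(2) r by (auto simp: E_def)
    also have "\<dots> \<longleftrightarrow> ?d\<^sup>2 \<le> ?r\<^sup>2" by (rule abs_le_square_iff)
    also have "?r\<^sup>2 = z\<^sup>2 * Sh n w $ j $ j / \<rho> n"
      using a by (simp add: power_mult_distrib)
    also have "?d\<^sup>2 \<le> z\<^sup>2 * Sh n w $ j $ j / \<rho> n \<longleftrightarrow> \<rho> n * ?d\<^sup>2 \<le> z\<^sup>2 * Sh n w $ j $ j"
      using a by (simp add: le_divide_eq mult.commute)
    also have "\<dots> \<longleftrightarrow> Q n w \<le> z\<^sup>2"
      using s by (simp add: Q_def divide_le_eq algebra_simps)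
    finally show ?case by (simp add: p)
  qed
  moreover have "((\<lambda>(n, w). Q n w - (norm (W n w $ j / sqrt s))\<^sup>2) \<longlongrightarrow> 0) (prob_filter M)"
  proof -
    define F where "F x y = (((x + fst y) $ j)\<^sup>2 - z\<^sup>2 * (snd y - s)) / s" for x :: "real ^ 'm" and y :: "(real ^ 'm) \<times> real"
    define \<eta> where "\<eta> = (\<lambda>(n, w). (sqrt (\<rho> n) *\<^sub>R (est n w - \<beta>) - W n w, Sh n w $ j $ j))"
    have "continuous_on UNIV (\<lambda>(x, y). F x y)"
      unfolding F_def case_prod_unfold using s by (intro continuous_intros) auto
    moreover have "(\<eta> \<longlongrightarrow> (0, s)) (prob_filter M)"
      using tendsto_Pair[OF close Shj] by (simp add: \<eta>_def case_prod_unfold)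
    ultimately have "((\<lambda>(n, w). F (W n w) (\<eta> (n, w)) - F (W n w) (0, s)) \<longlongrightarrow> 0) (prob_filter M)"
      using W_tight by (intro slutsky)
    moreover have "F (W n w) (\<eta> (n, w)) = Q n w" for n w
      using \<rho>_nonneg[of n] by (simp add: F_def \<eta>_def Q_def power_mult_distrib)
    moreover have "F x (0, s) = (norm (x $ j / sqrt s))\<^sup>2" for x
      using s by (simp add: F_def power_divide)
    ultimately show ?thesis by simp
  qed
  ultimately have "(\<lambda>n. prob (E n)) \<longlonglongrightarrow> cdf (chi_square DIM(real)) (z\<^sup>2)"
    by (intro prob_tendsto_of_close[OF lim _ _ E_sets]) (auto intro!: isCont_cdf_chi_square)
  then show ?thesis
    using z by (simp add: asymptotic_confidence_set_def E_def z_def)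
qed

end

section \<open>Smoothed least squares\<close>

lemma transpose_sandwich: "transpose S = S \<Longrightarrow> transpose (sandwich J S) = sandwich J S"
  by (simp add: sandwich_def matrix_transpose_mul matrix_mul_assoc)

lemma quadratic_form_sandwich:
  "t \<bullet> (sandwich J S *v t) = (transpose J *v t) \<bullet> (S *v (transpose J *v t))"
proof -
  have "sandwich J S *v t = J *v (S *v (transpose J *v t))"
    by (simp only: sandwich_def matrix_vector_mul_assoc matrix_mul_assoc)
  then show ?thesis by (simp only: inner_transpose_matrix)
qed

lemma tendsto_sandwich_matrix:
  "(J \<longlongrightarrow> J') F \<Longrightarrow> (S \<longlongrightarrow> S') F \<Longrightarrow> ((\<lambda>x. sandwich (J x) (S x)) \<longlongrightarrow> sandwich J' S') F"
  unfolding sandwich_def by (intro tendsto_intros)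

lemma tendsto_block_diag:
  assumes "(s \<longlongrightarrow> s') F" "(t \<longlongrightarrow> t') F"
  shows "((\<lambda>x. block_diag (s x) (t x)) \<longlongrightarrow> block_diag s' t') F"
  unfolding block_diag_def by (intro vec_tendstoI) (auto split: sum.split intro: assms)

lemma block_diag_1: "block_diag 1 1 = mat 1"
  by (auto simp: block_diag_def mat_def vec_eq_iff split: sum.split)

lemma block_diag_diff: "block_diag s t - block_diag s' t' = block_diag (s - s') (t - t')"
  by (auto simp: block_diag_def vec_eq_iff split: sum.split)

lemma block_diag_scaleR: "c *\<^sub>R block_diag s t = block_diag (c * s) (c * t)"
  by (auto simp: block_diag_def vec_eq_iff split: sum.split)

lemma quadratic_form_integral_outer:
  fixes W :: "'w \<Rightarrow> real ^ 'n"
  assumes "W \<in> borel_measurable M" "integrable M (\<lambda>w. (norm (W w))\<^sup>2)"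
  shows "t \<bullet> ((c *\<^sub>R (\<integral>w. outer (W w) (W w) \<partial>M)) *v t) = c * (\<integral>w. (t \<bullet> W w)\<^sup>2 \<partial>M)"
proof -
  have "t \<bullet> ((\<integral>w. outer (W w) (W w) \<partial>M) *v t) = (\<integral>w. (t \<bullet> W w)\<^sup>2 \<partial>M)"
    unfolding integral_bounded_linear[OF quadratic_form_bounded_linear integrable_outer[OF assms], symmetric]
    by (simp add: inner_outer power2_eq_square inner_commute)
  then show ?thesis
    by (simp add: scaleR_matrix_vector_assoc[symmetric])
qed

lemma tight_seq_matrix_vector_mult:
  assumes "tight_seq M W"
  shows "tight_seq M (\<lambda>n w. (J :: real ^ 'n ^ 'm) *v W n w)"
  unfolding tight_seq_def
proof (intro allI impI)
  fix \<delta> :: real assume "0 < \<delta>"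
  then obtain B where B: "\<forall>\<^sub>F n in sequentially. \<exists>A\<in>sets M. 1 - \<delta> \<le> measure M A \<and> (\<forall>w\<in>A. norm (W n w) \<le> B)"
    using assms unfolding tight_seq_def by blast
  have "norm (J *v x) \<le> norm J * B" if "norm x \<le> B" for x
    using norm_matrix_vector_mult_le[of J x] mult_left_mono[OF that, of "norm J"] by simp
  then have "\<forall>\<^sub>F n in sequentially. \<exists>A\<in>sets M. 1 - \<delta> \<le> measure M A \<and> (\<forall>w\<in>A. norm (J *v W n w) \<le> norm J * B)"
    using B by (elim eventually_mono) blast
  then show "\<exists>B. \<forall>\<^sub>F n in sequentially. \<exists>A\<in>sets M. 1 - \<delta> \<le> measure M A \<and> (\<forall>w\<in>A. norm (J *v W n w) \<le> B)" ..
qed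

locale smoothed_least_squares =
  kernel_moments M U V f K h
  for M :: "'w measure" and U :: "nat \<Rightarrow> 'w \<Rightarrow> real ^ ('m::{finite, linorder} lowtri + 'm)"
    and V :: "nat \<Rightarrow> 'w \<Rightarrow> real" and f K :: "real \<Rightarrow> real" and h :: "nat \<Rightarrow> real" +
  fixes lS lG :: real and bt :: "nat \<Rightarrow> 'w \<Rightarrow> real ^ ('m::{finite, linorder})"
  assumes mu_pos_dom: "expectation (U 0) \<in> pos_dom"
    and S_pos: "\<And>v. v \<noteq> 0 \<Longrightarrow> 0 < v \<bullet> (sandwich (jacobian g_map (at (expectation (U 0))))
      ((c2 K / f 0) *\<^sub>R (\<integral>w. outer (U 0 w) (U 0 w) \<partial>M)) *v v)"
    and lS: "0 < lS" and lG: "0 < lG"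
    and bt: "\<And>n. rv_where M
      (\<lambda>w. block_diag (a_scale M K f h V lS n) (a_scale M K f h V lG n) *v mu_hat M K h V U n w \<in> pos_dom)
      (\<lambda>w. g_map (block_diag (a_scale M K f h V lS n) (a_scale M K f h V lG n) *v mu_hat M K h V U n w)) (bt n)"
begin

abbreviation \<rho> :: "nat \<Rightarrow> real" where "\<rho> n \<equiv> real n * h n"

definition A :: "nat \<Rightarrow> real ^ ('m lowtri + 'm) ^ ('m lowtri + 'm)" where
  "A n = block_diag (a_scale M K f h V lS n) (a_scale M K f h V lG n)"

definition mut :: "nat \<Rightarrow> 'w \<Rightarrow> real ^ ('m lowtri + 'm)" where
  "mut n w = A n *v mu_hat M K h V U n w"

definition \<beta> :: "real ^ ('m::{finite, linorder})" where "\<beta> = g_map \<mu>"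

definition J :: "real ^ ('m lowtri + 'm) ^ ('m::{finite, linorder})" where "J = jacobian g_map (at \<mu>)"

definition Smu :: "real ^ ('m lowtri + 'm) ^ ('m lowtri + 'm)" where
  "Smu = (c2 K / f 0) *\<^sub>R (\<integral>w. outer (U 0 w) (U 0 w) \<partial>M)"

definition S :: "real ^ ('m::{finite, linorder}) ^ ('m::{finite, linorder})" where "S = sandwich J Smu"

lemma mu_dom: "\<mu> \<in> pos_dom"
  using mu_pos_dom by (simp add: \<mu>_def)

lemma outer_integrable: "integrable M (\<lambda>w. outer (U 0 w) (U 0 w))"
  by (rule integrable_outer[OF _ U_L2]) simp

lemma transpose_Smu: "transpose Smu = Smu"
proof -
  have "transpose (\<integral>w. outer (U 0 w) (U 0 w) \<partial>M) = (\<integral>w. outer (U 0 w) (U 0 w) \<partial>M)"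
    unfolding integral_bounded_linear[OF bounded_linear_transpose outer_integrable, symmetric]
    by (simp add: transpose_outer)
  then show ?thesis
    by (simp add: Smu_def linear_scale[OF bounded_linear.linear[OF bounded_linear_transpose]])
qed

lemma quadratic_form_Smu: "t \<bullet> (Smu *v t) = c2 K / f 0 * (\<integral>w. (t \<bullet> U 0 w)\<^sup>2 \<partial>M)"
  unfolding Smu_def by (rule quadratic_form_integral_outer[OF _ U_L2]) simp

lemma A_lim: "A \<longlonglongrightarrow> mat 1"
  unfolding A_def[abs_def] block_diag_1[symmetric]
  by (intro tendsto_block_diag a_scale_lim lS lG)

lemma A_prob_lim: "((\<lambda>(n, w). A n) \<longlongrightarrow> mat 1) (prob_filter M)"
  by (rule tendsto_prob_filter_deterministic[OF A_lim])

lemma mut_lim: "((\<lambda>(n, w). mut n w) \<longlongrightarrow> \<mu>) (prob_filter M)"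
  using tendsto_matrix_vector_mult[OF A_prob_lim mu_hat_consistent] by (simp add: mut_def case_prod_unfold)

lemma eventually_mut_pos_dom: "\<forall>\<^sub>F (n, w) in prob_filter M. mut n w \<in> pos_dom"
  using eventually_pos_dom[OF mut_lim mu_dom] by (simp add: case_prod_unfold)

lemma inv_Sigma_lim:
  "((\<lambda>(n, w). matrix_inv (Sigma_of (mut n w))) \<longlongrightarrow> matrix_inv (Sigma_of \<mu>)) (prob_filter M)"
  using tendsto_matrix_inv[OF tendsto_Sigma_of[OF mut_lim] pos_dom_det[OF mu_dom]] by (simp add: case_prod_unfold)

lemma bt_measurable: "bt n \<in> borel_measurable M"
  using bt by (simp add: rv_where_def)

lemma J_mult: "J *v u = matrix_inv (Sigma_of \<mu>) *v normal_defect \<beta> u"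
  unfolding J_def \<beta>_def by (rule jacobian_g_map[OF mu_dom])

text \<open>\<open>shift\<close> is the contribution of the scaling \<open>A n\<close> to \<open>sqrt (\<rho> n) *\<^sub>R (mut n w - \<mu>)\<close>.\<close>

definition shift :: "nat \<Rightarrow> real ^ ('m lowtri + 'm)" where
  "shift n = sqrt (\<rho> n) *\<^sub>R ((A n - mat 1) *v \<mu>)"

lemma asymptotically_normal_estimator:
  assumes D_measurable: "\<And>n. D n \<in> borel_measurable M"
    and D: "((\<lambda>(n, w). matrix_inv (Sigma_of (mut n w)) *v normal_defect \<beta> (shift n) - sqrt (\<rho> n) *\<^sub>R D n w) \<longlongrightarrow> 0)
      (prob_filter M)"
  shows "asymptotically_normal M (\<lambda>n w. J *v Z n w) S \<rho> (\<lambda>n w. bt n w - D n w) \<beta>"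
proof
  show "(\<lambda>w. J *v Z n w) \<in> borel_measurable M" for n by measurable
  show "tight_seq M (\<lambda>n w. J *v Z n w)" by (rule tight_seq_matrix_vector_mult[OF Z_tight])
  show "(\<lambda>n. \<integral>w. iexp (t \<bullet> (J *v Z n w)) \<partial>M) \<longlonglongrightarrow> of_real (exp (- (t \<bullet> (S *v t)) / 2))" for t
    using Z_char[of "transpose J *v t"]
    by (simp only: inner_transpose_matrix[of t J] S_def quadratic_form_sandwich quadratic_form_Smu minus_divide_left)
  show "transpose S = S" unfolding S_def by (rule transpose_sandwich[OF transpose_Smu])
  show "0 < v \<bullet> (S *v v)" if "v \<noteq> 0" for v
    using S_pos[OF that] by (simp add: S_def J_def Smu_def \<mu>_def)
  show "0 \<le> \<rho> n" for n by (rule nh_nonneg)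
  show "\<forall>\<^sub>F n in sequentially. 0 < \<rho> n" by (rule eventually_nh_pos)
  show "(\<lambda>w. bt n w - D n w) \<in> borel_measurable M" for n
    using bt_measurable[of n] D_measurable[of n] by simp
  define F where "F z y = fst y *v normal_defect \<beta> (snd y *v z)"
    for z :: "real ^ ('m lowtri + 'm)" and y :: "(real ^ ('m::{finite, linorder}) ^ ('m::{finite, linorder})) \<times> (real ^ ('m lowtri + 'm) ^ ('m lowtri + 'm))"
  let ?P = "\<lambda>n w. matrix_inv (Sigma_of (mut n w))"
  have "continuous_on UNIV (\<lambda>(z, y). F z y)"
    unfolding continuous_on case_prod_unfold F_def
    by (intro ballI tendsto_matrix_vector_mult tendsto_normal_defect tendsto_const tendsto_fst tendsto_snd tendsto_ident_at)
  moreover have "((\<lambda>(n, w). (?P n w, A n)) \<longlongrightarrow> (matrix_inv (Sigma_of \<mu>), mat 1)) (prob_filter M)"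
    using tendsto_Pair[OF inv_Sigma_lim A_prob_lim] by (simp add: case_prod_unfold)
  ultimately have "((\<lambda>(n, w). F (Z n w) ((\<lambda>(n, w). (?P n w, A n)) (n, w)) - F (Z n w) (matrix_inv (Sigma_of \<mu>), mat 1)) \<longlongrightarrow> 0)
      (prob_filter M)"
    using Z_tight by (intro slutsky)
  then have "((\<lambda>(n, w). ?P n w *v normal_defect \<beta> (A n *v Z n w) - J *v Z n w) \<longlongrightarrow> 0) (prob_filter M)"
    by (simp add: F_def J_mult)
  from tendsto_add[OF this D]
  have "((\<lambda>(n, w). ?P n w *v normal_defect \<beta> (A n *v Z n w) - J *v Z n w
      + (?P n w *v normal_defect \<beta> (shift n) - sqrt (\<rho> n) *\<^sub>R D n w)) \<longlongrightarrow> 0) (prob_filter M)"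
    by (simp add: case_prod_unfold)
  moreover have "\<forall>\<^sub>F p in prob_filter M.
      (case p of (n, w) \<Rightarrow> ?P n w *v normal_defect \<beta> (A n *v Z n w) - J *v Z n w
        + (?P n w *v normal_defect \<beta> (shift n) - sqrt (\<rho> n) *\<^sub>R D n w))
      = (case p of (n, w) \<Rightarrow> sqrt (\<rho> n) *\<^sub>R (bt n w - D n w - \<beta>) - J *v Z n w)"
    using eventually_mut_pos_dom eventually_prob_filter_space
  proof eventually_elim
    case (elim p)
    obtain n w where p: "p = (n, w)" by (cases p)
    have dom: "mut n w \<in> pos_dom" "w \<in> space M" using elim by (simp_all add: p)
    have btw: "bt n w = g_map (mut n w)"
      using bt[of n] dom by (simp add: rv_where_def mut_def A_def)
    have "sqrt (\<rho> n) *\<^sub>R (mut n w - \<mu>) = A n *v Z n w + shift n"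
      by (simp add: Z_def shift_def mut_def matrix_vector_mult_scaleR matrix_vector_mult_diff_distrib
          matrix_vector_mult_diff_rdistrib scaleR_diff_right)
    then have "normal_defect \<beta> (A n *v Z n w) + normal_defect \<beta> (shift n) = sqrt (\<rho> n) *\<^sub>R normal_defect \<beta> (mut n w - \<mu>)"
      by (simp flip: linear_add[OF linear_normal_defect] linear_scale[OF linear_normal_defect])
    then have "?P n w *v normal_defect \<beta> (A n *v Z n w) + ?P n w *v normal_defect \<beta> (shift n)
        = sqrt (\<rho> n) *\<^sub>R (?P n w *v normal_defect \<beta> (mut n w - \<mu>))"
      by (simp flip: matrix_vector_right_distrib matrix_vector_mult_scaleR)
    also have "?P n w *v normal_defect \<beta> (mut n w - \<mu>) = bt n w - \<beta>"
      using g_map_diff[OF mu_dom dom(1)] by (simp add: btw \<beta>_def)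
    finally show ?case
      by (simp add: p algebra_simps)
  qed
  ultimately show "((\<lambda>(n, w). sqrt (\<rho> n) *\<^sub>R (bt n w - D n w - \<beta>) - J *v Z n w) \<longlongrightarrow> 0) (prob_filter M)"
    by (rule Lim_transform_eventually)
qed

lemma asymptotically_normal_unbiased:
  assumes "(\<lambda>n. sqrt (\<rho> n) * norm (A n - mat 1)) \<longlonglongrightarrow> 0"
  shows "asymptotically_normal M (\<lambda>n w. J *v Z n w) S \<rho> bt \<beta>"
proof -
  have "shift \<longlonglongrightarrow> 0"
  proof (rule Lim_null_comparison)
    show "(\<lambda>n. sqrt (\<rho> n) * norm (A n - mat 1) * norm \<mu>) \<longlonglongrightarrow> 0"
      using assms by (rule tendsto_mult_left_zero)
    show "\<forall>\<^sub>F n in sequentially. norm (shift n) \<le> sqrt (\<rho> n) * norm (A n - mat 1) * norm \<mu>"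
      using norm_matrix_vector_mult_le[of "A _ - mat 1" \<mu>] nh_nonneg
      by (intro always_eventually allI) (simp add: shift_def mult.assoc mult_left_mono)
  qed
  then have "((\<lambda>(n, w). shift n) \<longlongrightarrow> 0) (prob_filter M)"
    by (rule tendsto_prob_filter_deterministic)
  from tendsto_matrix_vector_mult[OF inv_Sigma_lim tendsto_normal_defect[OF tendsto_const this]]
  have "((\<lambda>(n, w). matrix_inv (Sigma_of (mut n w)) *v normal_defect \<beta> (shift n)) \<longlongrightarrow> 0) (prob_filter M)"
    by (simp add: case_prod_unfold linear_0[OF linear_normal_defect])
  then show ?thesis
    using asymptotically_normal_estimator[of "\<lambda>n w. 0"] by simp
qed

lemma asymptotically_normal_bias_corrected:
  assumes \<delta>: "0 < \<delta>"
    and diff: "\<And>x. x \<in> ball 0 \<delta> \<Longrightarrow> f differentiable (at x) \<and> deriv f differentiable (at x)"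
    and bdd2: "bounded (deriv (deriv f) ` ball 0 \<delta>)" and cont: "isCont (deriv (deriv f)) 0"
    and K2: "integrable lborel (\<lambda>u. u\<^sup>2 * K u)"
    and rate: "\<And>n. 0 < n \<Longrightarrow> real n powr (1 / 5) * h n \<le> C"
    and k: "k = deriv (deriv f) 0 * d2 K / (2 * f 0)"
    and Dt: "\<And>n. rv_where M (\<lambda>w. mut n w \<in> pos_dom)
      (\<lambda>w. (k * (h n)\<^sup>2) *\<^sub>R (jacobian g_map (at (mut n w)) *v (block_diag (lS\<^sup>2) (lG\<^sup>2) *v mut n w))) (Dt n)"
  shows "asymptotically_normal M (\<lambda>n w. J *v Z n w) S \<rho> (\<lambda>n w. bt n w - Dt n w) \<beta>"
proof (rule asymptotically_normal_estimator)
  show "Dt n \<in> borel_measurable M" for n using Dt by (simp add: rv_where_def)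
  let ?L = "block_diag (lS\<^sup>2) (lG\<^sup>2) :: real ^ ('m lowtri + 'm) ^ ('m lowtri + 'm)"
  let ?P = "\<lambda>n w. matrix_inv (Sigma_of (mut n w))"
  define E where "E n = (block_diag ((a_scale M K f h V lS n - 1) / (h n)\<^sup>2) ((a_scale M K f h V lG n - 1) / (h n)\<^sup>2)
    :: real ^ ('m lowtri + 'm) ^ ('m lowtri + 'm))" for n
  have E: "E \<longlonglongrightarrow> k *\<^sub>R ?L"
    unfolding E_def[abs_def] block_diag_scaleR k
    by (intro tendsto_block_diag a_scale_bias[OF _ \<delta> diff bdd2 cont K2] lS lG)
  have shift: "shift n = (sqrt (\<rho> n) * (h n)\<^sup>2) *\<^sub>R (E n *v \<mu>)" if "0 < n" for n
  proof -
    have "A n - mat 1 = (h n)\<^sup>2 *\<^sub>R E n"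
      using h_pos[OF that] by (simp add: A_def E_def block_diag_1[symmetric] block_diag_diff block_diag_scaleR)
    then show ?thesis by (simp add: shift_def scaleR_matrix_vector_assoc[symmetric])
  qed
  have bound: "sqrt (\<rho> n) * (h n)\<^sup>2 \<le> sqrt (C ^ 5)" if n: "0 < n" for n
  proof -
    have "(real n powr (1 / 5)) ^ 5 = real n"
      using n by (simp add: powr_power)
    then have "\<rho> n * ((h n)\<^sup>2)\<^sup>2 = (real n powr (1 / 5) * h n) ^ 5"
      by (simp add: power_mult_distrib) (simp add: eval_nat_numeral)
    also have "\<dots> \<le> C ^ 5"
      using h_pos[OF n] by (intro power_mono rate n) simp
    finally have "sqrt (\<rho> n * ((h n)\<^sup>2)\<^sup>2) \<le> sqrt (C ^ 5)" by (rule real_sqrt_le_mono)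
    then show ?thesis by (simp only: real_sqrt_mult[of "\<rho> n"] real_sqrt_abs abs_power2)
  qed
  define R where "R n w = ?P n w *v normal_defect \<beta> (E n *v \<mu>) - k *\<^sub>R (jacobian g_map (at (mut n w)) *v (?L *v mut n w))" for n w
  have "((\<lambda>p. (case p of (n, w) \<Rightarrow> ?P n w) *v normal_defect \<beta> ((case p of (n, w) \<Rightarrow> E n) *v \<mu>)
      - k *\<^sub>R (jacobian g_map (at (case p of (n, w) \<Rightarrow> mut n w)) *v (?L *v (case p of (n, w) \<Rightarrow> mut n w))))
      \<longlongrightarrow> matrix_inv (Sigma_of \<mu>) *v normal_defect \<beta> ((k *\<^sub>R ?L) *v \<mu>) - k *\<^sub>R (jacobian g_map (at \<mu>) *v (?L *v \<mu>))) (prob_filter M)"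
    by (intro tendsto_diff tendsto_scaleR tendsto_const tendsto_matrix_vector_mult inv_Sigma_lim tendsto_normal_defect
        tendsto_prob_filter_deterministic[OF E] tendsto_jacobian_g_map mut_lim mu_dom)
  moreover have "matrix_inv (Sigma_of \<mu>) *v normal_defect \<beta> ((k *\<^sub>R ?L) *v \<mu>) = k *\<^sub>R (jacobian g_map (at \<mu>) *v (?L *v \<mu>))"
    unfolding J_mult[symmetric] J_def by (simp add: scaleR_matrix_vector_assoc[symmetric] matrix_vector_mult_scaleR)
  ultimately have "((\<lambda>(n, w). R n w) \<longlongrightarrow> 0) (prob_filter M)"
    by (simp add: R_def case_prod_unfold)
  then have "((\<lambda>p. sqrt (C ^ 5) * norm (case p of (n, w) \<Rightarrow> R n w)) \<longlongrightarrow> 0) (prob_filter M)"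
    by (intro tendsto_mult_right_zero tendsto_norm_zero)
  moreover have "\<forall>\<^sub>F p in prob_filter M.
      norm (case p of (n, w) \<Rightarrow> ?P n w *v normal_defect \<beta> (shift n) - sqrt (\<rho> n) *\<^sub>R Dt n w)
      \<le> sqrt (C ^ 5) * norm (case p of (n, w) \<Rightarrow> R n w)"
    using eventually_mut_pos_dom eventually_prob_filter_space eventually_prob_filter_deterministic[OF eventually_gt_at_top[of 0]]
  proof eventually_elim
    case (elim p)
    obtain n w where p: "p = (n, w)" by (cases p)
    have dom: "mut n w \<in> pos_dom" "w \<in> space M" "0 < n" using elim by (simp_all add: p)
    have "Dt n w = (k * (h n)\<^sup>2) *\<^sub>R (jacobian g_map (at (mut n w)) *v (?L *v mut n w))"
      using Dt[of n] dom by (simp add: rv_where_def)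
    then have eq: "?P n w *v normal_defect \<beta> (shift n) - sqrt (\<rho> n) *\<^sub>R Dt n w = (sqrt (\<rho> n) * (h n)\<^sup>2) *\<^sub>R R n w"
      by (simp add: shift[OF dom(3)] R_def linear_scale[OF linear_normal_defect] matrix_vector_mult_scaleR
          scaleR_diff_right mult_ac)
    have "norm ((sqrt (\<rho> n) * (h n)\<^sup>2) *\<^sub>R R n w) \<le> sqrt (C ^ 5) * norm (R n w)"
      using nh_nonneg[of n] by (simp add: abs_mult mult_right_mono[OF bound[OF dom(3)]])
    then show ?case unfolding p prod.case eq .
  qed
  ultimately show "((\<lambda>(n, w). ?P n w *v normal_defect \<beta> (shift n) - sqrt (\<rho> n) *\<^sub>R Dt n w) \<longlongrightarrow> 0) (prob_filter M)"
    by (rule Lim_null_comparison[rotated])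
qed

lemma covariance_estimator_lim:
  assumes m: "((\<lambda>(n, w). m n w) \<longlongrightarrow> \<mu>) (prob_filter M)"
    and Sh: "\<And>n. rv_where M (\<lambda>w. m n w \<in> pos_dom)
      (\<lambda>w. sandwich (jacobian g_map (at (m n w))) (Sigma_mu_hat K f U n w)) (Sh n)"
  shows "((\<lambda>(n, w). Sh n w) \<longlongrightarrow> S) (prob_filter M)"
proof -
  have "((\<lambda>p. sandwich (jacobian g_map (at (case p of (n, w) \<Rightarrow> m n w))) (case p of (n, w) \<Rightarrow> Sigma_mu_hat K f U n w)) \<longlongrightarrow> S) (prob_filter M)"
    unfolding S_def J_def Smu_def
    by (intro tendsto_sandwich_matrix tendsto_jacobian_g_map m mu_dom Sigma_mu_hat_consistent)
  moreover have "\<forall>\<^sub>F p in prob_filter M. sandwich (jacobian g_map (at (case p of (n, w) \<Rightarrow> m n w)))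
      (case p of (n, w) \<Rightarrow> Sigma_mu_hat K f U n w) = (case p of (n, w) \<Rightarrow> Sh n w)"
    using eventually_pos_dom[OF m mu_dom] eventually_prob_filter_space
    by eventually_elim (use Sh in \<open>auto simp: rv_where_def\<close>)
  ultimately show ?thesis by (rule Lim_transform_eventually)
qed

end

section \<open>The regression moments\<close>

lemma design_None [simp]: "design x $ None = 1"
  and design_Some [simp]: "design x $ Some k = x $ k"
  by (simp_all add: design_def)

lemma inner_design:
  fixes b :: "real ^ ('p::finite) option"
  shows "b \<bullet> design x = b $ None + (\<Sum>k\<in>UNIV. b $ Some k * x $ k)"
  unfolding inner_vec_def by (simp add: UNIV_option_conv sum.reindex)

lemma outer_mult_vec: "outer v w *v b = (w \<bullet> b) *\<^sub>R v"
  by (simp add: vec_eq_iff outer_def matrix_vector_mult_def inner_vec_def sum_distrib_left sum_distrib_right mult_ac)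

lemma Sigma_of_moment_obs: "Sigma_of (moment_obs x y) = outer (design x) (design x)"
  and Gamma_of_moment_obs: "Gamma_of (moment_obs x y) = y *\<^sub>R design x"
  using stack_vech_iff[OF transpose_outer, of "moment_obs x y" "design x" "y *\<^sub>R design x"]
  by (auto simp: moment_obs_def)

lemma normal_defect_moment_obs: "normal_defect b (moment_obs x y) = (y - b \<bullet> design x) *\<^sub>R design x"
  by (simp add: normal_defect_def Sigma_of_moment_obs Gamma_of_moment_obs outer_mult_vec
      scaleR_diff_left inner_commute)

lemma continuous_design: "continuous_on UNIV (design :: real ^ 'p \<Rightarrow> real ^ ('p::finite) option)"
  unfolding continuous_on
proof (intro ballI vec_tendstoI)
  fix x :: "real ^ 'p" and j
  show "((\<lambda>x. design x $ j) \<longlongrightarrow> design x $ j) (at x within UNIV)"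
    by (cases j) (auto intro!: tendsto_intros)
qed

lemma borel_measurable_design [measurable (raw)]:
  "X \<in> borel_measurable N \<Longrightarrow> (\<lambda>w. design (X w)) \<in> borel_measurable N"
  by (rule borel_measurable_continuous_on[OF continuous_design])

lemma borel_measurable_moment_obs [measurable (raw)]:
  fixes X :: "'w \<Rightarrow> real ^ ('p::{finite, linorder})"
  assumes [measurable]: "X \<in> borel_measurable N" "y \<in> borel_measurable N"
  shows "(\<lambda>w. moment_obs (X w) (y w)) \<in> borel_measurable N"
proof (rule borel_measurable_euclidean_space[THEN iffD2], intro ballI)
  fix b :: "real ^ ('p option lowtri + 'p option)" assume "b \<in> Basis"
  then obtain k where b: "b = axis k 1" by (auto simp: Basis_vec_def)
  show "(\<lambda>w. moment_obs (X w) (y w) \<bullet> b) \<in> borel_measurable N"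
    unfolding b inner_axis
    by (cases k) (auto simp: moment_obs_def stack_def vech_def outer_def split: prod.split)
qed

locale regression_moments = prob_space M for M :: "'w measure" +
  fixes X :: "'w \<Rightarrow> real ^ ('p::{finite, linorder})" and e :: "'w \<Rightarrow> real" and \<beta> :: "real ^ 'p option"
    and U :: "'w \<Rightarrow> real ^ ('p option lowtri + 'p option)" and \<mu> :: "real ^ ('p option lowtri + 'p option)"
  assumes X_measurable [measurable]: "X \<in> borel_measurable M" and e_measurable [measurable]: "e \<in> borel_measurable M"
    and e_mean: "AE w in M. real_cond_exp M (vimage_algebra (space M) X borel) e w = 0"
    and e_var: "AE w in M. 0 < nn_cond_exp M (vimage_algebra (space M) X borel) (\<lambda>w'. ennreal ((e w')\<^sup>2)) w"
    and U_eq: "\<And>w. U w = moment_obs (X w) (\<beta> \<bullet> design (X w) + e w)"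
    and U_sq: "integrable M (\<lambda>w. (norm (U w))\<^sup>2)"
    and \<mu>_eq: "\<mu> = stack (vech (\<integral>w. outer (design (X w)) (design (X w)) \<partial>M))
      (\<integral>w. (\<beta> \<bullet> design (X w) + e w) *\<^sub>R design (X w) \<partial>M)"
    and \<mu>_dom: "\<mu> \<in> pos_dom"
begin

abbreviation \<F> :: "'w measure" where "\<F> \<equiv> vimage_algebra (space M) X borel"

lemma U_measurable [measurable]: "U \<in> borel_measurable M"
  using borel_measurable_moment_obs[of X M "\<lambda>w. \<beta> \<bullet> design (X w) + e w"] by (simp add: U_eq[abs_def])

lemma U_integrable: "integrable M U"
  by (rule integrable_of_sq[OF _ U_sq]) simp

lemma bounded_linear_U:
  "bounded_linear Sigma_of" "bounded_linear Gamma_of" "bounded_linear (normal_defect b)"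
  using linear_Sigma_of linear_Gamma_of linear_normal_defect by (auto simp: linear_conv_bounded_linear)

lemma expectation_U: "expectation U = \<mu>"
proof -
  have "expectation U = stack (vech (Sigma_of (expectation U))) (Gamma_of (expectation U))"
    using stack_vech_iff[OF transpose_Sigma_of] by blast
  also have "Sigma_of (expectation U) = (\<integral>w. outer (design (X w)) (design (X w)) \<partial>M)"
    unfolding integral_bounded_linear[OF bounded_linear_U(1) U_integrable, symmetric]
    by (simp add: U_eq Sigma_of_moment_obs)
  also have "Gamma_of (expectation U) = (\<integral>w. (\<beta> \<bullet> design (X w) + e w) *\<^sub>R design (X w) \<partial>M)"
    unfolding integral_bounded_linear[OF bounded_linear_U(2) U_integrable, symmetric]
    by (simp add: U_eq Gamma_of_moment_obs)
  finally show ?thesis by (simp add: \<mu>_eq)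
qed

lemma normal_defect_U: "normal_defect \<beta> (U w) = e w *\<^sub>R design (X w)"
  by (simp add: U_eq normal_defect_moment_obs)

lemma error_design_integrable: "integrable M (\<lambda>w. e w *\<^sub>R design (X w))"
  using integrable_bounded_linear[OF bounded_linear_U(3)[of \<beta>] U_integrable] by (simp add: normal_defect_U)

lemma subalg: "subalgebra M \<F>"
proof (unfold subalgebra_def, intro conjI)
  show "sets \<F> \<subseteq> sets M"
    using measurable_sets[OF X_measurable] by (subst sets_vimage_algebra2) auto
qed simp

lemma sigma_finite_subalgebra: "sigma_finite_subalgebra M \<F>"
  by (intro finite_measure_subalgebra_is_sigma_finite finite_measure_subalgebra.intro
      finite_measure_subalgebra_axioms.intro subalg finite_measure_axioms)

lemma X_measurable_F [measurable]: "X \<in> borel_measurable \<F>"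
  by (rule measurable_vimage_algebra1) simp

lemma expectation_error_design: "(\<integral>w. e w *\<^sub>R design (X w) \<partial>M) = 0"
proof -
  interpret F: sigma_finite_subalgebra M \<F> by (rule sigma_finite_subalgebra)
  have "(\<integral>w. e w *\<^sub>R design (X w) \<partial>M) $ j = 0" for j
  proof -
    have int: "integrable M (\<lambda>w. design (X w) $ j * e w)"
      using integrable_bounded_linear[OF bounded_linear_vec_nth error_design_integrable, of j] by (simp add: mult.commute)
    have "(\<integral>w. e w *\<^sub>R design (X w) \<partial>M) $ j = (\<integral>w. design (X w) $ j * e w \<partial>M)"
      using integral_bounded_linear[OF bounded_linear_vec_nth error_design_integrable, of j] by (simp add: mult.commute)
    also have "\<dots> = (\<integral>w. design (X w) $ j * real_cond_exp M \<F> e w \<partial>M)"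
      by (rule F.real_cond_exp_intg(2)[OF int, symmetric]) measurable
    also have "\<dots> = (\<integral>w. 0 \<partial>M)"
    proof (rule integral_cong_AE)
      show "AE w in M. design (X w) $ j * real_cond_exp M \<F> e w = 0"
        using e_mean by eventually_elim simp
    qed measurable
    finally show ?thesis by simp
  qed
  then show ?thesis by (simp add: vec_eq_iff)
qed

lemma g_map_mu: "g_map \<mu> = \<beta>"
proof -
  have "normal_defect \<beta> \<mu> = (\<integral>w. e w *\<^sub>R design (X w) \<partial>M)"
    using integral_bounded_linear[OF bounded_linear_U(3) U_integrable, of \<beta>] by (simp add: expectation_U normal_defect_U)
  then have "Sigma_of \<mu> *v \<beta> = Gamma_of \<mu>"
    by (simp add: expectation_error_design normal_defect_def)
  then show ?thesis
    using matrix_inv_mult_vec(2)[OF pos_dom_det[OF \<mu>_dom], of \<beta>] by (simp add: g_map_def)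
qed

lemma inner_transpose_jacobian:
  "(transpose (jacobian g_map (at \<mu>)) *v v) \<bullet> U w
    = e w * ((transpose (matrix_inv (Sigma_of \<mu>)) *v v) \<bullet> design (X w))"
  unfolding inner_transpose_matrix[symmetric] jacobian_g_map[OF \<mu>_dom] g_map_mu normal_defect_U
  by (simp add: matrix_vector_mult_scaleR)

lemma AE_inner_design_eq_0:
  assumes "(\<integral>w. (e w * (a \<bullet> design (X w)))\<^sup>2 \<partial>M) = 0" and int: "integrable M (\<lambda>w. (e w * (a \<bullet> design (X w)))\<^sup>2)"
  shows "AE w in M. a \<bullet> design (X w) = 0"
proof -
  interpret F: sigma_finite_subalgebra M \<F> by (rule sigma_finite_subalgebra)
  let ?g = "\<lambda>w. ennreal ((a \<bullet> design (X w))\<^sup>2)"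
  have "(\<integral>\<^sup>+w. ?g w * nn_cond_exp M \<F> (\<lambda>w'. ennreal ((e w')\<^sup>2)) w \<partial>M) = (\<integral>\<^sup>+w. ?g w * ennreal ((e w)\<^sup>2) \<partial>M)"
    by (rule F.nn_cond_exp_intg) measurable
  also have "\<dots> = (\<integral>\<^sup>+w. ennreal ((e w * (a \<bullet> design (X w)))\<^sup>2) \<partial>M)"
    by (simp add: ennreal_mult[symmetric] power_mult_distrib mult.commute)
  also have "\<dots> = 0"
    using assms by (simp add: nn_integral_eq_integral)
  finally have "AE w in M. ?g w * nn_cond_exp M \<F> (\<lambda>w'. ennreal ((e w')\<^sup>2)) w = 0"
    by (subst (asm) nn_integral_0_iff_AE) measurable
  with e_var show ?thesis
    by eventually_elim (auto simp: ennreal_eq_0_iff)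
qed

lemma second_moment_pos:
  assumes v: "v \<noteq> 0"
  shows "0 < (\<integral>w. ((transpose (jacobian g_map (at \<mu>)) *v v) \<bullet> U w)\<^sup>2 \<partial>M)"
proof (rule ccontr)
  let ?a = "transpose (matrix_inv (Sigma_of \<mu>)) *v v"
  assume "\<not> 0 < (\<integral>w. ((transpose (jacobian g_map (at \<mu>)) *v v) \<bullet> U w)\<^sup>2 \<partial>M)"
  moreover have "0 \<le> (\<integral>w. ((transpose (jacobian g_map (at \<mu>)) *v v) \<bullet> U w)\<^sup>2 \<partial>M)"
    by simp
  ultimately have "(\<integral>w. (e w * (?a \<bullet> design (X w)))\<^sup>2 \<partial>M) = 0"
    unfolding inner_transpose_jacobian by linarith
  moreover have "integrable M (\<lambda>w. (e w * (?a \<bullet> design (X w)))\<^sup>2)"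
    unfolding inner_transpose_jacobian[symmetric] by (rule integrable_inner_sq[OF _ U_sq]) simp
  ultimately have a0: "AE w in M. ?a \<bullet> design (X w) = 0"
    by (rule AE_inner_design_eq_0)
  have lin: "bounded_linear (\<lambda>x. Sigma_of x *v ?a)"
    by (intro linear_conv_bounded_linear[THEN iffD1] linearI)
      (simp_all add: linear_add[OF linear_Sigma_of] linear_scale[OF linear_Sigma_of]
        matrix_vector_mult_add_rdistrib scaleR_matrix_vector_assoc[symmetric])
  have "Sigma_of \<mu> *v ?a = (\<integral>w. Sigma_of (U w) *v ?a \<partial>M)"
    using integral_bounded_linear[OF lin U_integrable] by (simp add: expectation_U)
  also have "\<dots> = (\<integral>w. (?a \<bullet> design (X w)) *\<^sub>R design (X w) \<partial>M)"
    by (simp add: U_eq Sigma_of_moment_obs outer_mult_vec inner_commute)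
  also have "\<dots> = (\<integral>w. 0 \<partial>M)"
    by (rule integral_cong_AE) (use a0 in \<open>auto elim!: eventually_mono\<close>)
  finally have "Sigma_of \<mu> *v ?a = 0" by simp
  then have "?a = 0"
    using matrix_inv_mult_vec(2)[OF pos_dom_det[OF \<mu>_dom], of ?a] by simp
  moreover have "v \<bullet> v = ?a \<bullet> (Sigma_of \<mu> *v v)"
    unfolding inner_transpose_matrix[symmetric] matrix_inv_mult_vec(2)[OF pos_dom_det[OF \<mu>_dom]] ..
  ultimately show False using v by simp
qed

end

lemma c2_pos:
  assumes "integrable lborel K" "(\<integral>u. K u \<partial>lborel) = 1" "integrable lborel (\<lambda>u. (K u)\<^sup>2)"
  shows "0 < c2 K"
proof (rule ccontr)
  assume "\<not> 0 < c2 K"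
  moreover have "0 \<le> c2 K" by (simp add: c2_def)
  ultimately have "(\<integral>u. (K u)\<^sup>2 \<partial>lborel) = 0" unfolding c2_def by linarith
  then have "AE u in lborel. (K u)\<^sup>2 = 0"
    by (subst (asm) integral_nonneg_eq_0_iff_AE[OF assms(3)]) auto
  then have "(\<integral>u. K u \<partial>lborel) = (\<integral>u. 0 \<partial>(lborel :: real measure))"
    using assms(1) by (intro integral_cong_AE) auto
  then show False using assms(2) by simp
qed

theorem corollary4p1:
  fixes M :: "'w measure"
    and X :: "nat \<Rightarrow> 'w \<Rightarrow> real ^ ('p::{finite, linorder})"
    and \<epsilon> Y V :: "nat \<Rightarrow> 'w \<Rightarrow> real"
    and \<beta> :: "real ^ 'p option"
    and U :: "nat \<Rightarrow> 'w \<Rightarrow> real ^ ('p option lowtri + 'p option)"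
    and \<mu> :: "real ^ ('p option lowtri + 'p option)"
    and f K :: "real \<Rightarrow> real"
    and h :: "nat \<Rightarrow> real"
    and lS lG \<alpha> :: real
    and A :: "nat \<Rightarrow> real ^ ('p option lowtri + 'p option) ^ ('p option lowtri + 'p option)"
    and muh mut :: "nat \<Rightarrow> 'w \<Rightarrow> real ^ ('p option lowtri + 'p option)"
    and Smu :: "nat \<Rightarrow> 'w \<Rightarrow> real ^ ('p option lowtri + 'p option) ^ ('p option lowtri + 'p option)"
    and bt :: "nat \<Rightarrow> 'w \<Rightarrow> real ^ 'p option"
    and Sb :: "nat \<Rightarrow> 'w \<Rightarrow> real ^ 'p option ^ 'p option"
  assumes "prob_space M"
    \<comment> \<open>regression model\<close>
    and "stationary_process M (\<lambda>i w. (X i w, \<epsilon> i w))"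
    and "ergodic_process M (\<lambda>i w. (X i w, \<epsilon> i w))"
    and "integrable M (\<epsilon> 0)"
    and "AE w in M. real_cond_exp M (vimage_algebra (space M) (X 0) borel) (\<epsilon> 0) w = 0"
    and "integrable M (\<lambda>w. (norm (X 0 w))\<^sup>2)"
    and Y: "\<And>i w. Y i w = \<beta> $ None + (\<Sum>k\<in>UNIV. \<beta> $ Some k * X i w $ k) + \<epsilon> i w"
    and U: "\<And>i w. U i w = moment_obs (X i w) (Y i w)"
    and mu: "\<mu> = stack (vech (\<integral>w. outer (design (X 0 w)) (design (X 0 w)) \<partial>M))
                     (\<integral>w. Y 0 w *\<^sub>R design (X 0 w) \<partial>M)"
    and "integrable M (\<lambda>w. (norm (U 0 w))\<^sup>2)"
    and "integrable M (\<lambda>w. (norm (X 0 w)) ^ 4)"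
    and "\<mu> \<in> pos_dom"
    and "AE w in M.
           0 < nn_cond_exp M (vimage_algebra (space M) (X 0) borel) (\<lambda>w'. ennreal ((\<epsilon> 0 w')\<^sup>2)) w \<and>
           nn_cond_exp M (vimage_algebra (space M) (X 0) borel) (\<lambda>w'. ennreal ((\<epsilon> 0 w')\<^sup>2)) w < \<infinity>"
    and "interior (law_support M (X 0)) \<noteq> {}"
    \<comment> \<open>smoothing variables, kernel, bandwidths\<close>
    and "prob_space.indep_vars M (\<lambda>_. borel) V UNIV"
    and "\<And>x. 0 \<le> f x"
    and "\<And>i. distributed M lborel (V i) (\<lambda>x. ennreal (f x))"
    and "prob_space.indep_set M
           (sets (vimage_algebra (space M) (\<lambda>w i. U i w) (\<Pi>\<^sub>M i\<in>UNIV. borel)))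
           (sets (vimage_algebra (space M) (\<lambda>w i. V i w) (\<Pi>\<^sub>M i\<in>UNIV. borel)))"
    and "bounded (range f)" and "isCont f 0" and "0 < f 0"
    and "K \<in> borel_measurable borel" and "\<And>u. 0 \<le> K u" and "\<And>u. K (- u) = K u"
    and "bounded (range K)" and "integrable lborel K" and "(\<integral>u. K u \<partial>lborel) = 1"
    and "integrable lborel (\<lambda>u. (K u)\<^sup>2)"
    and "\<And>n. 0 < n \<Longrightarrow> 0 < h n"
    and "h \<longlonglongrightarrow> 0"
    and "filterlim (\<lambda>n. real n * h n) at_top sequentially"
    and "(\<lambda>n. real n * h n * lambda_max (cov_matrix M (sample_mean U n))) \<longlonglongrightarrow> 0"
    \<comment> \<open>estimators\<close>
    and "0 < lS" and "0 < lG" and "lS \<noteq> lG"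
    and "0 < \<alpha>" and "\<alpha> < 1"
    and muh: "muh = mu_hat M K h V U"
    and Smu: "Smu = Sigma_mu_hat K f U"
    and A: "\<And>n. A n = block_diag (a_scale M K f h V lS n) (a_scale M K f h V lG n)"
    and mut: "\<And>n w. mut n w = A n *v muh n w"
    and bt: "\<And>n. rv_where M (\<lambda>w. mut n w \<in> pos_dom) (\<lambda>w. g_map (mut n w)) (bt n)"
    and Sb: "\<And>n. rv_where M (\<lambda>w. muh n w \<in> pos_dom)
                   (\<lambda>w. sandwich (jacobian g_map (at (muh n w))) (Smu n w)) (Sb n)"
  shows
    "((\<lambda>n. sqrt (real n * h n) * norm (A n - mat 1)) \<longlonglongrightarrow> 0 \<longrightarrow>
      (\<forall>Sbinv.
        (\<forall>n. rv_where M (\<lambda>w. invertible (Sb n w)) (\<lambda>w. matrix_inv (Sb n w)) (Sbinv n)) \<longrightarrow>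
        asymptotic_confidence_set M \<alpha>
          (\<lambda>n w. ellipsoid (real n * h n) (bt n w) (Sbinv n w)
                   (quantile (chi_square (CARD('p) + 1)) (1 - \<alpha>)))
          \<beta>) \<and>
      (\<forall>j. asymptotic_confidence_set M \<alpha>
          (\<lambda>n w. {bt n w $ j - quantile std_normal_distribution (1 - \<alpha> / 2)
                                 * sqrt (Sb n w $ j $ j / (real n * h n)) ..
                  bt n w $ j + quantile std_normal_distribution (1 - \<alpha> / 2)
                                 * sqrt (Sb n w $ j $ j / (real n * h n))})
          (\<beta> $ j)))
     \<and>
     ((\<exists>\<delta>>0. (\<forall>x\<in>ball 0 \<delta>. f differentiable (at x) \<and> deriv f differentiable (at x)) \<and>
             bounded (deriv (deriv f) ` ball 0 \<delta>)) \<and>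
      isCont (deriv (deriv f)) 0 \<and> deriv (deriv f) 0 \<noteq> 0 \<and>
      integrable lborel (\<lambda>u. u\<^sup>2 * K u) \<and>
      (\<exists>c C. 0 < c \<and> (\<forall>n>0. c \<le> real n powr (1/5) * h n \<and> real n powr (1/5) * h n \<le> C)) \<longrightarrow>
      (\<forall>\<kappa> \<Lambda> Dt St Stinv.
        \<kappa> = deriv (deriv f) 0 * d2 K / (2 * f 0) \<and>
        \<Lambda> = block_diag (lS\<^sup>2) (lG\<^sup>2) \<and>
        (\<forall>n. rv_where M (\<lambda>w. mut n w \<in> pos_dom)
               (\<lambda>w. (\<kappa> * (h n)\<^sup>2) *\<^sub>R (jacobian g_map (at (mut n w)) *v (\<Lambda> *v mut n w))) (Dt n)) \<and>
        (\<forall>n. rv_where M (\<lambda>w. mut n w \<in> pos_dom)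
               (\<lambda>w. sandwich (jacobian g_map (at (mut n w))) (Smu n w)) (St n)) \<and>
        (\<forall>n. rv_where M (\<lambda>w. invertible (St n w)) (\<lambda>w. matrix_inv (St n w)) (Stinv n)) \<longrightarrow>
        asymptotic_confidence_set M \<alpha>
          (\<lambda>n w. ellipsoid (real n * h n) (bt n w - Dt n w) (Stinv n w)
                   (quantile (chi_square (CARD('p) + 1)) (1 - \<alpha>)))
          \<beta> \<and>
        (\<forall>j. asymptotic_confidence_set M \<alpha>
          (\<lambda>n w. {bt n w $ j - Dt n w $ j - quantile std_normal_distribution (1 - \<alpha> / 2)
                                 * sqrt (Sb n w $ j $ j / (real n * h n)) ..
                  bt n w $ j - Dt n w $ j + quantile std_normal_distribution (1 - \<alpha> / 2)
                                 * sqrt (Sb n w $ j $ j / (real n * h n))})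
          (\<beta> $ j))))"
proof -
  interpret prob_space M by fact
  have Y_eq: "Y i w = \<beta> \<bullet> design (X i w) + \<epsilon> i w" for i w
    by (simp add: Y inner_design)
  have Z_measurable: "(\<lambda>w. (X i w, \<epsilon> i w)) \<in> borel_measurable M" for i
    using assms(2) by (simp add: stationary_process_def)
  have [measurable]: "fst \<in> borel_measurable (borel :: ((real ^ ('p::{finite, linorder})) \<times> real) measure)"
    "snd \<in> borel_measurable (borel :: ((real ^ ('p::{finite, linorder})) \<times> real) measure)"
    by (auto intro!: borel_measurable_continuous_onI continuous_intros)
  have [measurable]: "X i \<in> borel_measurable M" "\<epsilon> i \<in> borel_measurable M" for i
    using measurable_compose[OF Z_measurable, of fst borel i] measurable_compose[OF Z_measurable, of snd borel i]
    by simp_all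
  define \<Phi> where "\<Phi> z = moment_obs (fst z) (\<beta> \<bullet> design (fst z) + snd z)" for z :: "(real ^ ('p::{finite, linorder})) \<times> real"
  have \<Phi> [measurable]: "\<Phi> \<in> borel_measurable borel"
    unfolding \<Phi>_def by measurable
  have U_\<Phi>: "U i w = \<Phi> (X i w, \<epsilon> i w)" for i w
    by (simp add: U Y_eq \<Phi>_def)
  have U_measurable: "U i \<in> borel_measurable M" for i
    using measurable_compose[OF Z_measurable \<Phi>, of i] by (simp add: U_\<Phi>[abs_def])
  have U_id: "distr M borel (U i) = distr M borel (U 0)" for i
  proof -
    have "distr M borel (U j) = distr (distr M borel (\<lambda>w. (X j w, \<epsilon> j w))) borel \<Phi>" for j
      using distr_distr[OF \<Phi> Z_measurable, of j] by (simp add: comp_def U_\<Phi>[abs_def])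
    then show ?thesis
      using stationary_process_distr[OF assms(2), of i] by simp
  qed
  interpret R: regression_moments M "X 0" "\<epsilon> 0" \<beta> "U 0" \<mu>
  proof
    show "AE w in M. 0 < nn_cond_exp M (vimage_algebra (space M) (X 0) borel) (\<lambda>w'. ennreal ((\<epsilon> 0 w')\<^sup>2)) w"
      using assms(13) by eventually_elim simp
    show "\<mu> = stack (vech (\<integral>w. outer (design (X 0 w)) (design (X 0 w)) \<partial>M))
        (\<integral>w. (\<beta> \<bullet> design (X 0 w) + \<epsilon> 0 w) *\<^sub>R design (X 0 w) \<partial>M)"
      by (simp add: mu Y_eq)
  qed (use assms(5,10,12) in \<open>auto simp: U Y_eq\<close>)
  interpret S: smoothed_least_squares M U V f K h lS lG bt
  proof
    show "AE w in M. (\<lambda>n. (\<Sum>i<n. \<phi> (U i w)) / real n) \<longlonglongrightarrow> (\<integral>w. \<phi> (U 0 w) \<partial>M)"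
      if [measurable]: "\<phi> \<in> borel_measurable borel" and "integrable M (\<lambda>w. \<phi> (U 0 w))"
      for \<phi> :: "real ^ ('p option lowtri + 'p option) \<Rightarrow> real"
      using stationary_process_lln[OF assms(2,3), of "\<lambda>z. \<phi> (\<Phi> z)"] that(2) by (simp add: U_\<Phi>)
    show "expectation (U 0) \<in> pos_dom"
      using assms(12) by (simp add: R.expectation_U)
    show "0 < v \<bullet> (sandwich (jacobian g_map (at (expectation (U 0))))
        ((c2 K / f 0) *\<^sub>R (\<integral>w. outer (U 0 w) (U 0 w) \<partial>M)) *v v)" if "v \<noteq> 0" for v
      unfolding R.expectation_U quadratic_form_sandwich quadratic_form_integral_outer[OF U_measurable assms(10)]
      using R.second_moment_pos[OF that] assms(21) c2_pos[OF assms(26,27,28)] by simp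
    show "rv_where M
        (\<lambda>w. block_diag (a_scale M K f h V lS n) (a_scale M K f h V lG n) *v mu_hat M K h V U n w \<in> pos_dom)
        (\<lambda>w. g_map (block_diag (a_scale M K f h V lS n) (a_scale M K f h V lG n) *v mu_hat M K h V U n w)) (bt n)" for n
      using bt[of n] by (simp add: mut muh A)
  qed (use assms U_measurable U_id in auto)
  have A_eq: "S.A = A" and mut_eq: "S.mut = mut" and muh_eq: "mu_hat M K h V U = muh"
    and Smu_eq: "Sigma_mu_hat K f U = Smu" and beta_eq: "S.\<beta> = \<beta>"
    by (auto simp: fun_eq_iff S.A_def A S.mut_def mut muh Smu S.\<mu>_def R.expectation_U S.\<beta>_def R.g_map_mu)
  have card: "CARD('p option) = CARD('p) + 1" by simp
  have Sb_lim: "((\<lambda>(n, w). Sb n w) \<longlongrightarrow> S.S) (prob_filter M)"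
    using S.covariance_estimator_lim[OF S.mu_hat_consistent, of Sb] Sb by (simp add: muh_eq Smu_eq)
  have Sb_measurable: "Sb n \<in> borel_measurable M" for n
    using Sb[of n] by (simp add: rv_where_def)
  show ?thesis
  proof (intro conjI impI allI)
    assume unbiased: "(\<lambda>n. sqrt (real n * h n) * norm (A n - mat 1)) \<longlonglongrightarrow> 0"
    interpret N: asymptotically_normal M "\<lambda>n w. S.J *v S.Z n w" S.S "\<lambda>n. real n * h n" bt \<beta>
      using S.asymptotically_normal_unbiased unbiased by (simp add: A_eq beta_eq)
    show "asymptotic_confidence_set M \<alpha>
          (\<lambda>n w. ellipsoid (real n * h n) (bt n w) (Sbinv n w) (quantile (chi_square (CARD('p) + 1)) (1 - \<alpha>))) \<beta>"
      if "\<forall>n. rv_where M (\<lambda>w. invertible (Sb n w)) (\<lambda>w. matrix_inv (Sb n w)) (Sbinv n)" for Sbinv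
      using N.asymptotic_ellipsoid[OF Sb_lim _ assms(36,37), of Sbinv] that unfolding card by blast
    show "asymptotic_confidence_set M \<alpha>
          (\<lambda>n w. {bt n w $ j - quantile std_normal_distribution (1 - \<alpha> / 2) * sqrt (Sb n w $ j $ j / (real n * h n)) ..
                  bt n w $ j + quantile std_normal_distribution (1 - \<alpha> / 2) * sqrt (Sb n w $ j $ j / (real n * h n))})
          (\<beta> $ j)" for j
      by (rule N.asymptotic_interval[OF Sb_lim Sb_measurable assms(36,37)])
  next
    fix \<kappa> \<Lambda> Dt St Stinv
    assume smooth: "(\<exists>\<delta>>0. (\<forall>x\<in>ball 0 \<delta>. f differentiable (at x) \<and> deriv f differentiable (at x)) \<and>
             bounded (deriv (deriv f) ` ball 0 \<delta>)) \<and>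
      isCont (deriv (deriv f)) 0 \<and> deriv (deriv f) 0 \<noteq> 0 \<and>
      integrable lborel (\<lambda>u. u\<^sup>2 * K u) \<and>
      (\<exists>c C. 0 < c \<and> (\<forall>n>0. c \<le> real n powr (1/5) * h n \<and> real n powr (1/5) * h n \<le> C))"
      and est: "\<kappa> = deriv (deriv f) 0 * d2 K / (2 * f 0) \<and>
        \<Lambda> = block_diag (lS\<^sup>2) (lG\<^sup>2) \<and>
        (\<forall>n. rv_where M (\<lambda>w. mut n w \<in> pos_dom)
               (\<lambda>w. (\<kappa> * (h n)\<^sup>2) *\<^sub>R (jacobian g_map (at (mut n w)) *v (\<Lambda> *v mut n w))) (Dt n)) \<and>
        (\<forall>n. rv_where M (\<lambda>w. mut n w \<in> pos_dom)
               (\<lambda>w. sandwich (jacobian g_map (at (mut n w))) (Smu n w)) (St n)) \<and>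
        (\<forall>n. rv_where M (\<lambda>w. invertible (St n w)) (\<lambda>w. matrix_inv (St n w)) (Stinv n))"
    obtain \<delta> where \<delta>: "0 < \<delta>" "\<And>x. x \<in> ball 0 \<delta> \<Longrightarrow> f differentiable (at x) \<and> deriv f differentiable (at x)"
      "bounded (deriv (deriv f) ` ball 0 \<delta>)"
      using smooth by blast
    obtain C where C: "\<And>n. 0 < n \<Longrightarrow> real n powr (1/5) * h n \<le> C"
      using smooth by blast
    interpret N: asymptotically_normal M "\<lambda>n w. S.J *v S.Z n w" S.S "\<lambda>n. real n * h n" "\<lambda>n w. bt n w - Dt n w" \<beta>
    proof -
      have "isCont (deriv (deriv f)) 0" "integrable lborel (\<lambda>u. u\<^sup>2 * K u)"
        "\<kappa> = deriv (deriv f) 0 * d2 K / (2 * f 0)"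
        using smooth est by blast+
      moreover have "rv_where M (\<lambda>w. S.mut n w \<in> pos_dom)
          (\<lambda>w. (\<kappa> * (h n)\<^sup>2) *\<^sub>R (jacobian g_map (at (S.mut n w)) *v (block_diag (lS\<^sup>2) (lG\<^sup>2) *v S.mut n w))) (Dt n)" for n
        using est unfolding mut_eq by blast
      ultimately show "asymptotically_normal M (\<lambda>n w. S.J *v S.Z n w) S.S (\<lambda>n. real n * h n) (\<lambda>n w. bt n w - Dt n w) \<beta>"
        using S.asymptotically_normal_bias_corrected[OF \<delta> _ _ C] unfolding beta_eq by blast
    qed
    have St_lim: "((\<lambda>(n, w). St n w) \<longlongrightarrow> S.S) (prob_filter M)"
      using S.covariance_estimator_lim[OF S.mut_lim, of St] est by (simp add: mut_eq Smu_eq)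
    show "asymptotic_confidence_set M \<alpha>
          (\<lambda>n w. ellipsoid (real n * h n) (bt n w - Dt n w) (Stinv n w)
                   (quantile (chi_square (CARD('p) + 1)) (1 - \<alpha>))) \<beta>"
      using N.asymptotic_ellipsoid[OF St_lim _ assms(36,37), of Stinv] est unfolding card by blast
    show "asymptotic_confidence_set M \<alpha>
          (\<lambda>n w. {bt n w $ j - Dt n w $ j - quantile std_normal_distribution (1 - \<alpha> / 2)
                                 * sqrt (Sb n w $ j $ j / (real n * h n)) ..
                  bt n w $ j - Dt n w $ j + quantile std_normal_distribution (1 - \<alpha> / 2)
                                 * sqrt (Sb n w $ j $ j / (real n * h n))})
          (\<beta> $ j)" for j
      using N.asymptotic_interval[OF Sb_lim Sb_measurable assms(36,37), of j] by simp
  qed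
qed

end
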